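(* Let $(M^8,\Phi)$ be an $8$-manifold with a $\mathrm{Spin}(7)$-structure $\Phi$, and let $\nabla$ be the Levi-Civita connection of the associated Riemannian metric $g=g_\Phi$. Let $P_\Phi\in\Omega^3(M^8,TM^8)$ be the associated $3$-fold cross product and $[\cdot,\cdot]^{FN}$ the Frölicher–Nijenhuis bracket. Then for every $p\in M^8$ the following are equivalent: (1) The $\mathrm{Spin}(7)$-structure is torsion-free at $p$, i.e. $(\nabla\Phi)_p=0$. (2) $[P_\Phi,P_\Phi]^{FN}_p=0\in\Lambda^6T_p^*M^8\otimes T_pM^8$.
   Context: All objects are smooth. $\Omega^k(M,TM)$ denotes the $TM$-valued $k$-forms. $\mathrm{Spin}(7)$-structure: on an oriented $8$-manifold $M$, a $4$-form $\Phi\in\Omega^4(M)$ such that at each $p\in M$ there is a positively oriented basis $(e_\mu)_{\mu=0}^7$ of $T_pM$ with dual basis $(e^\mu)$ (a $\mathrm{Spin}(7)$-frame) with $\Phi_p=e^{0123}+e^{0145}+e^{0167}+e^{0246}-e^{0257}-e^{0347}-e^{0356}+e^{4567}+e^{2367}+e^{2345}+e^{1357}-e^{1346}-e^{1256}-e^{1247}$, where $e^{\mu_1\cdots\mu_k}=e^{\mu_1}\wedge\cdots\wedge e^{\mu_k}$. There is a unique Riemannian metric $g_\Phi$ for which every $\mathrm{Spin}(7)$-frame is orthonormal. Cross product: for a Riemannian metric $g$ and a $(k+1)$-form $\Psi$, $\delta_g(\Psi):=\sum_\mu(\imath_{e_\mu}\Psi)\otimes(e^\mu)^\#$ (any local frame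 with dual frame). $P_\Phi:=-\delta_{g_\Phi}(\Phi)$, i.e. $g_\Phi(P_\Phi(x,y,z),w)=\Phi(x,y,z,w)$. Frölicher–Nijenhuis bracket: the $\mathbb{R}$-bilinear bracket $[\cdot,\cdot]^{FN}:\Omega^k(M,TM)\times\Omega^l(M,TM)\to\Omega^{k+l}(M,TM)$ given for $\alpha\in\Omega^k(M)$, $\beta\in\Omega^l(M)$ and vector fields $X_1,X_2$ by $[\alpha\otimes X_1,\beta\otimes X_2]^{FN}=\alpha\wedge\beta\otimes[X_1,X_2]+\alpha\wedge\mathcal{L}_{X_1}\beta\otimes X_2-\mathcal{L}_{X_2}\alpha\wedge\beta\otimes X_1+(-1)^k\big(d\alpha\wedge(\imath_{X_1}\beta)\otimes X_2+(\imath_{X_2}\alpha)\wedge d\beta\otimes X_1\big)$, where $\mathcal{L}$ is the Lie derivative and $\imath$ is contraction. The subscript $p$ denotes the value at $p$. *)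

theory Defs
  imports "HOL-Analysis.Analysis"
begin

section \<open>Smooth maps between Euclidean spaces\<close>

text \<open>Used for open sets \<open>S\<close> only: iterated partial derivatives of all orders exist and are
  continuous.\<close>

fun Ck_on :: "nat \<Rightarrow> ('a::euclidean_space \<Rightarrow> 'b::real_normed_vector) \<Rightarrow> 'a set \<Rightarrow> bool" where
  "Ck_on 0 f S \<longleftrightarrow> continuous_on S f"
| "Ck_on (Suc k) f S \<longleftrightarrow>
     f differentiable_on S \<and> (\<forall>b\<in>Basis. Ck_on k (\<lambda>x. frechet_derivative f (at x) b) S)"

definition smooth_on :: "('a::euclidean_space \<Rightarrow> 'b::real_normed_vector) \<Rightarrow> 'a set \<Rightarrow> bool" where
  "smooth_on f S \<longleftrightarrow> (\<forall>k. Ck_on k f S)"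


section \<open>Oriented smooth manifolds\<close>

type_synonym ('a, 'n) chart = "'a set \<times> ('a \<Rightarrow> real^'n)"

definition chart_inv :: "('a, 'n::finite) chart \<Rightarrow> real^'n \<Rightarrow> 'a" where
  "chart_inv c = inv_into (fst c) (snd c)"

definition transition :: "('a, 'n::finite) chart \<Rightarrow> ('a, 'n) chart \<Rightarrow> real^'n \<Rightarrow> real^'n" where
  "transition c d = snd d \<circ> chart_inv c"

definition is_chart :: "'a topology \<Rightarrow> ('a, 'n::finite) chart \<Rightarrow> bool" where
  "is_chart X c \<longleftrightarrow> openin X (fst c) \<and> open (snd c ` fst c) \<and>
     homeomorphic_map (subtopology X (fst c)) (top_of_set (snd c ` fst c)) (snd c)"

definition oriented_manifold :: "'a topology \<Rightarrow> ('a, 'n::finite) chart set \<Rightarrow> bool" where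
  "oriented_manifold X A \<longleftrightarrow>
     Hausdorff_space X \<and> second_countable X \<and>
     (\<forall>c\<in>A. is_chart X c) \<and> (\<Union>c\<in>A. fst c) = topspace X \<and>
     (\<forall>c\<in>A. \<forall>d\<in>A. smooth_on (transition c d) (snd c ` (fst c \<inter> fst d)) \<and>
        (\<forall>x \<in> snd c ` (fst c \<inter> fst d).
           0 < det (matrix (frechet_derivative (transition c d) (at x)))))"

text \<open>
  Every point has a preferred chart, and a tangent vector at \<open>p\<close> is represented by its components
  in the preferred chart at \<open>p\<close>; thus each \<open>T\<^sub>pM\<close> is a copy of \<open>\<real>\<^sup>n\<close>, and the chart at \<open>p\<close>
  being a member of the oriented atlas, its orientation is the standard one.  The preferred
  chart may jump from point to point, so a vector field \<open>'a \<Rightarrow> real^'n\<close> must be converted to the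
  components in one fixed chart before it is differentiated.
  \<open>chart_diff A c p\<close> is the differential at \<open>p\<close> of the chart \<open>c\<close>, and \<open>chart_frame A c p\<close>
  is its inverse: it sends \<open>v\<close> to the tangent vector at \<open>p\<close> whose components in \<open>c\<close> are \<open>v\<close>.
\<close>

definition chart_at :: "('a, 'n::finite) chart set \<Rightarrow> 'a \<Rightarrow> ('a, 'n) chart" where
  "chart_at A p = (SOME c. c \<in> A \<and> p \<in> fst c)"

definition chart_diff ::
    "('a, 'n::finite) chart set \<Rightarrow> ('a, 'n) chart \<Rightarrow> 'a \<Rightarrow> real^'n \<Rightarrow> real^'n" where
  "chart_diff A c p =
     frechet_derivative (transition (chart_at A p) c) (at (snd (chart_at A p) p))"

definition chart_frame ::
    "('a, 'n::finite) chart set \<Rightarrow> ('a, 'n) chart \<Rightarrow> 'a \<Rightarrow> real^'n \<Rightarrow> real^'n" where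
  "chart_frame A c p = frechet_derivative (transition c (chart_at A p)) (at (snd c p))"


section \<open>Functions, vector fields and forms\<close>

type_synonym ('a, 'n) vfield = "'a \<Rightarrow> real^'n"

text \<open>Only the values of a \<open>k\<close>-form (or \<open>TM\<close>-valued \<open>k\<close>-form) on argument lists of length \<open>k\<close>
  are meaningful.\<close>

type_synonym ('a, 'n) form = "'a \<Rightarrow> (real^'n) list \<Rightarrow> real"
type_synonym ('a, 'n) vform = "'a \<Rightarrow> (real^'n) list \<Rightarrow> real^'n"

definition fun_rep :: "('a, 'n::finite) chart \<Rightarrow> ('a \<Rightarrow> real) \<Rightarrow> real^'n \<Rightarrow> real" where
  "fun_rep c f x = f (chart_inv c x)"

definition vf_rep :: "('a, 'n::finite) chart set \<Rightarrow> ('a, 'n) chart \<Rightarrow> ('a, 'n) vfield \<Rightarrow>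
    real^'n \<Rightarrow> real^'n" where
  "vf_rep A c V x = chart_diff A c (chart_inv c x) (V (chart_inv c x))"

definition form_rep :: "('a, 'n::finite) chart set \<Rightarrow> ('a, 'n) chart \<Rightarrow> ('a, 'n) form \<Rightarrow>
    real^'n \<Rightarrow> (real^'n) list \<Rightarrow> real" where
  "form_rep A c \<alpha> x vs = \<alpha> (chart_inv c x) (map (chart_frame A c (chart_inv c x)) vs)"

definition smooth_fun :: "('a, 'n::finite) chart set \<Rightarrow> 'a set \<Rightarrow> ('a \<Rightarrow> real) \<Rightarrow> bool" where
  "smooth_fun A W f \<longleftrightarrow> (\<forall>c\<in>A. smooth_on (fun_rep c f) (snd c ` (fst c \<inter> W)))"

definition smooth_vf :: "('a, 'n::finite) chart set \<Rightarrow> 'a set \<Rightarrow> ('a, 'n) vfield \<Rightarrow> bool" where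
  "smooth_vf A W V \<longleftrightarrow> (\<forall>c\<in>A. smooth_on (vf_rep A c V) (snd c ` (fst c \<inter> W)))"

definition alternating :: "nat \<Rightarrow> ((real^'n::finite) list \<Rightarrow> real) \<Rightarrow> bool" where
  "alternating k a \<longleftrightarrow>
     (\<forall>vs i. length vs = k \<longrightarrow> i < k \<longrightarrow> linear (\<lambda>v. a (vs[i := v]))) \<and>
     (\<forall>vs i j. length vs = k \<longrightarrow> i < j \<longrightarrow> j < k \<longrightarrow> vs ! i = vs ! j \<longrightarrow> a vs = 0)"

definition smooth_form ::
    "('a, 'n::finite) chart set \<Rightarrow> nat \<Rightarrow> 'a set \<Rightarrow> ('a, 'n) form \<Rightarrow> bool" where
  "smooth_form A k W \<alpha> \<longleftrightarrow>
     (\<forall>p\<in>W. alternating k (\<alpha> p)) \<and>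
     (\<forall>c\<in>A. \<forall>vs. length vs = k \<longrightarrow>
        smooth_on (\<lambda>x. form_rep A c \<alpha> x vs) (snd c ` (fst c \<inter> W)))"

definition coord_vf ::
    "('a, 'n::finite) chart set \<Rightarrow> ('a, 'n) chart \<Rightarrow> real^'n \<Rightarrow> ('a, 'n) vfield" where
  "coord_vf A c v = (\<lambda>q. chart_frame A c q v)"


section \<open>Differential calculus\<close>

text \<open>All operations are computed at \<open>p\<close> in the preferred chart at \<open>p\<close>, so their values and
  vector arguments need no conversion.\<close>

definition wedge :: "nat \<Rightarrow> nat \<Rightarrow> ((real^'n::finite) list \<Rightarrow> real) \<Rightarrow> ((real^'n) list \<Rightarrow> real) \<Rightarrow>
    (real^'n) list \<Rightarrow> real" where
  "wedge k l a b vs =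
     (\<Sum>\<sigma> | \<sigma> permutes {..<k + l}. of_int (sign \<sigma>) *
        a (map (\<lambda>i. vs ! \<sigma> i) [0..<k]) * b (map (\<lambda>i. vs ! \<sigma> i) [k..<k + l])) / (fact k * fact l)"

text \<open>The contraction of a \<open>0\<close>-form is zero.\<close>

definition contract :: "nat \<Rightarrow> ('a, 'n::finite) vfield \<Rightarrow> ('a, 'n) form \<Rightarrow> ('a, 'n) form" where
  "contract k V \<alpha> p vs = (if k = 0 then 0 else \<alpha> p (V p # vs))"

definition dir_deriv :: "('a, 'n::finite) chart set \<Rightarrow> ('a \<Rightarrow> real) \<Rightarrow> 'a \<Rightarrow> real^'n \<Rightarrow> real" where
  "dir_deriv A f p v =
     (let c = chart_at A p in frechet_derivative (fun_rep c f) (at (snd c p)) v)"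

definition lie_bracket ::
    "('a, 'n::finite) chart set \<Rightarrow> ('a, 'n) vfield \<Rightarrow> ('a, 'n) vfield \<Rightarrow> ('a, 'n) vfield" where
  "lie_bracket A V W p =
     (let c = chart_at A p; x = snd c p in
        frechet_derivative (vf_rep A c W) (at x) (vf_rep A c V x)
        - frechet_derivative (vf_rep A c V) (at x) (vf_rep A c W x))"

text \<open>\<open>d\<alpha>(v\<^sub>0,\<dots>,v\<^sub>k) = \<Sum>\<^sub>i (-1)\<^sup>i (\<partial>\<^bsub>v\<^sub>i\<^esub> \<alpha>)(v\<^sub>0,\<dots>,v\<^sub>k)\<close> with the \<open>i\<close>-th argument omitted on the right.\<close>

definition ext_deriv :: "('a, 'n::finite) chart set \<Rightarrow> ('a, 'n) form \<Rightarrow> ('a, 'n) form" where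
  "ext_deriv A \<alpha> p vs =
     (let c = chart_at A p in
        \<Sum>i<length vs. (-1) ^ i *
          frechet_derivative (\<lambda>y. form_rep A c \<alpha> y (take i vs @ drop (Suc i) vs))
            (at (snd c p)) (vs ! i))"

text \<open>\<open>(L\<^sub>V\<alpha>)(v\<^sub>1,\<dots>,v\<^sub>k) = V(\<alpha>(v\<^sub>1,\<dots>,v\<^sub>k)) - \<Sum>\<^sub>i \<alpha>(v\<^sub>1,\<dots>,[V,v\<^sub>i],\<dots>,v\<^sub>k)\<close> for coordinate-constant
  fields \<open>v\<^sub>i\<close>, for which \<open>[V,v\<^sub>i] = -\<partial>\<^bsub>v\<^sub>i\<^esub>V\<close>.\<close>

definition lie_deriv ::
    "('a, 'n::finite) chart set \<Rightarrow> ('a, 'n) vfield \<Rightarrow> ('a, 'n) form \<Rightarrow> ('a, 'n) form" where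
  "lie_deriv A V \<alpha> p vs =
     (let c = chart_at A p; x = snd c p in
        frechet_derivative (\<lambda>y. form_rep A c \<alpha> y vs) (at x) (vf_rep A c V x)
        + (\<Sum>i<length vs. form_rep A c \<alpha> x
             (vs[i := frechet_derivative (vf_rep A c V) (at x) (vs ! i)])))"


section \<open>The Froelicher--Nijenhuis bracket\<close>

text \<open>\<open>fn_simple A k l \<alpha> V \<beta> W\<close> is the bracket of \<open>\<alpha> \<otimes> V\<close> and \<open>\<beta> \<otimes> W\<close> for a \<open>k\<close>-form \<open>\<alpha>\<close> and an
  \<open>l\<close>-form \<open>\<beta>\<close>.\<close>

definition fn_simple :: "('a, 'n::finite) chart set \<Rightarrow> nat \<Rightarrow> nat \<Rightarrow>
    ('a, 'n) form \<Rightarrow> ('a, 'n) vfield \<Rightarrow> ('a, 'n) form \<Rightarrow> ('a, 'n) vfield \<Rightarrow> ('a, 'n) vform" where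
  "fn_simple A k l \<alpha> V \<beta> W p vs =
     wedge k l (\<alpha> p) (\<beta> p) vs *\<^sub>R lie_bracket A V W p
     + wedge k l (\<alpha> p) (lie_deriv A V \<beta> p) vs *\<^sub>R W p
     - wedge k l (lie_deriv A W \<alpha> p) (\<beta> p) vs *\<^sub>R V p
     + (-1) ^ k *\<^sub>R
        (wedge (k + 1) (l - 1) (ext_deriv A \<alpha> p) (contract l V \<beta> p) vs *\<^sub>R W p
         + wedge (k - 1) (l + 1) (contract k W \<alpha> p) (ext_deriv A \<beta> p) vs *\<^sub>R V p)"

text \<open>On the domain of a chart \<open>c\<close>, \<open>K = \<Sum>\<^sub>i K\<^sup>i \<otimes> \<partial>\<^sub>i\<close> with scalar forms \<open>K\<^sup>i\<close>.\<close>

definition vform_component :: "('a, 'n::finite) chart set \<Rightarrow> ('a, 'n) chart \<Rightarrow>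
    ('a, 'n) vform \<Rightarrow> 'n \<Rightarrow> ('a, 'n) form" where
  "vform_component A c K i = (\<lambda>q vs. chart_diff A c q (K q vs) $ i)"

text \<open>The bracket is a local operator, so its value at \<open>p\<close> may be computed on the domain of the
  preferred chart \<open>c\<close> at \<open>p\<close>, where bilinearity gives
  \<open>[K,L] = \<Sum>\<^sub>i \<Sum>\<^sub>j [K\<^sup>i \<otimes> \<partial>\<^sub>i, L\<^sup>j \<otimes> \<partial>\<^sub>j]\<close>.\<close>

definition fn_bracket :: "('a, 'n::finite) chart set \<Rightarrow> nat \<Rightarrow> nat \<Rightarrow>
    ('a, 'n) vform \<Rightarrow> ('a, 'n) vform \<Rightarrow> ('a, 'n) vform" where
  "fn_bracket A k l K L p vs =
     (let c = chart_at A p in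
        \<Sum>i\<in>UNIV. \<Sum>j\<in>UNIV.
          fn_simple A k l
            (vform_component A c K i) (coord_vf A c (axis i 1))
            (vform_component A c L j) (coord_vf A c (axis j 1)) p vs)"


section \<open>Riemannian metrics and the Levi-Civita connection\<close>

type_synonym ('a, 'n) metric = "'a \<Rightarrow> real^'n \<Rightarrow> real^'n \<Rightarrow> real"

definition riemannian_metric ::
    "'a topology \<Rightarrow> ('a, 'n::finite) chart set \<Rightarrow> ('a, 'n) metric \<Rightarrow> bool" where
  "riemannian_metric X A g \<longleftrightarrow>
     (\<forall>p\<in>topspace X. bilinear (g p) \<and> (\<forall>v w. g p v w = g p w v) \<and> (\<forall>v. v \<noteq> 0 \<longrightarrow> 0 < g p v v)) \<and>
     (\<forall>c\<in>A. \<forall>v w. smooth_on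
        (fun_rep c (\<lambda>q. g q (coord_vf A c v q) (coord_vf A c w q))) (snd c ` fst c))"

text \<open>A connection acts on locally defined sections: \<open>D p v Y\<close> is the covariant derivative
  in direction \<open>v \<in> T\<^sub>pM\<close> of a vector field \<open>Y\<close> that is smooth near \<open>p\<close>.\<close>

type_synonym ('a, 'n) connection = "'a \<Rightarrow> real^'n \<Rightarrow> ('a, 'n) vfield \<Rightarrow> real^'n"

definition affine_connection ::
    "'a topology \<Rightarrow> ('a, 'n::finite) chart set \<Rightarrow> ('a, 'n) connection \<Rightarrow> bool" where
  "affine_connection X A D \<longleftrightarrow>
     (\<forall>W. openin X W \<longrightarrow>
       (\<forall>V Y. smooth_vf A W V \<longrightarrow> smooth_vf A W Y \<longrightarrow> smooth_vf A W (\<lambda>p. D p (V p) Y)) \<and>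
       (\<forall>Y. smooth_vf A W Y \<longrightarrow> (\<forall>p\<in>W. linear (\<lambda>v. D p v Y))) \<and>
       (\<forall>Y Z. smooth_vf A W Y \<longrightarrow> smooth_vf A W Z \<longrightarrow>
          (\<forall>q\<in>W. Y q = Z q) \<longrightarrow> (\<forall>p\<in>W. \<forall>v. D p v Y = D p v Z)) \<and>
       (\<forall>Y Z. smooth_vf A W Y \<longrightarrow> smooth_vf A W Z \<longrightarrow>
          (\<forall>p\<in>W. \<forall>v. D p v (\<lambda>q. Y q + Z q) = D p v Y + D p v Z)) \<and>
       (\<forall>f Y. smooth_fun A W f \<longrightarrow> smooth_vf A W Y \<longrightarrow>
          (\<forall>p\<in>W. \<forall>v. D p v (\<lambda>q. f q *\<^sub>R Y q) = dir_deriv A f p v *\<^sub>R Y p + f p *\<^sub>R D p v Y)))"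

definition levi_civita :: "'a topology \<Rightarrow> ('a, 'n::finite) chart set \<Rightarrow> ('a, 'n) metric \<Rightarrow>
    ('a, 'n) connection \<Rightarrow> bool" where
  "levi_civita X A g D \<longleftrightarrow> affine_connection X A D \<and>
     (\<forall>W V Y. openin X W \<longrightarrow> smooth_vf A W V \<longrightarrow> smooth_vf A W Y \<longrightarrow>
        (\<forall>p\<in>W. D p (V p) Y - D p (Y p) V = lie_bracket A V Y p) \<and>
        (\<forall>p\<in>W. \<forall>v. dir_deriv A (\<lambda>q. g q (V q) (Y q)) p v
                    = g p (D p v V) (Y p) + g p (V p) (D p v Y)))"

text \<open>\<open>(\<nabla>\<^sub>v\<alpha>)(w\<^sub>1,\<dots>,w\<^sub>k) = v(\<alpha>(Y\<^sub>1,\<dots>,Y\<^sub>k)) - \<Sum>\<^sub>i \<alpha>(w\<^sub>1,\<dots>,\<nabla>\<^sub>vY\<^sub>i,\<dots>,w\<^sub>k)\<close> for any local fields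
  \<open>Y\<^sub>i\<close> with \<open>Y\<^sub>i(p) = w\<^sub>i\<close>; the coordinate-constant extensions are used.\<close>

definition nabla_form :: "('a, 'n::finite) chart set \<Rightarrow> ('a, 'n) connection \<Rightarrow> ('a, 'n) form \<Rightarrow>
    'a \<Rightarrow> real^'n \<Rightarrow> (real^'n) list \<Rightarrow> real" where
  "nabla_form A D \<alpha> p v ws =
     (let Y = coord_vf A (chart_at A p) in
        dir_deriv A (\<lambda>q. \<alpha> q (map (\<lambda>w. Y w q) ws)) p v
        - (\<Sum>i<length ws. \<alpha> p (ws[i := D p v (Y (ws ! i))])))"


section \<open>Spin(7)-structures\<close>

definition pos_basis :: "('n \<Rightarrow> real^'n::finite) \<Rightarrow> bool" where
  "pos_basis e \<longleftrightarrow> 0 < det (\<chi> i \<mu>. e \<mu> $ i)"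

definition dual_basis :: "('n \<Rightarrow> real^'n::finite) \<Rightarrow> 'n \<Rightarrow> real^'n \<Rightarrow> real" where
  "dual_basis e = (THE \<theta>. \<forall>\<mu>. linear (\<theta> \<mu>) \<and> (\<forall>\<nu>. \<theta> \<mu> (e \<nu>) = (if \<mu> = \<nu> then 1 else 0)))"

fun wedge_list :: "(real^'n::finite \<Rightarrow> real) list \<Rightarrow> (real^'n) list \<Rightarrow> real" where
  "wedge_list [] = (\<lambda>_. 1)"
| "wedge_list (\<theta> # \<theta>s) = wedge 1 (length \<theta>s) (\<lambda>vs. \<theta> (hd vs)) (wedge_list \<theta>s)"

definition spin7_std :: "(8 \<Rightarrow> real^8) \<Rightarrow> (real^8) list \<Rightarrow> real" where
  "spin7_std e vs =
     (let E = (\<lambda>\<mu>s. wedge_list (map (dual_basis e) \<mu>s) vs) in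
        E [0,1,2,3] + E [0,1,4,5] + E [0,1,6,7] + E [0,2,4,6]
        - E [0,2,5,7] - E [0,3,4,7] - E [0,3,5,6]
        + E [4,5,6,7] + E [2,3,6,7] + E [2,3,4,5] + E [1,3,5,7]
        - E [1,3,4,6] - E [1,2,5,6] - E [1,2,4,7])"

definition spin7_frame :: "('a, 8) form \<Rightarrow> 'a \<Rightarrow> (8 \<Rightarrow> real^8) \<Rightarrow> bool" where
  "spin7_frame \<Phi> p e \<longleftrightarrow> pos_basis e \<and> (\<forall>vs. length vs = 4 \<longrightarrow> \<Phi> p vs = spin7_std e vs)"

definition spin7_structure ::
    "'a topology \<Rightarrow> ('a, 8) chart set \<Rightarrow> ('a, 8) form \<Rightarrow> bool" where
  "spin7_structure X A \<Phi> \<longleftrightarrow>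
     smooth_form A 4 (topspace X) \<Phi> \<and> (\<forall>p\<in>topspace X. \<exists>e. spin7_frame \<Phi> p e)"

text \<open>\<open>g\<close> is the metric \<open>g\<^sub>\<Phi>\<close>: this determines \<open>g\<close> on \<open>topspace X\<close> when \<open>\<Phi>\<close> is a
  Spin(7)-structure.\<close>

definition spin7_metric ::
    "'a topology \<Rightarrow> ('a, 8) chart set \<Rightarrow> ('a, 8) form \<Rightarrow> ('a, 8) metric \<Rightarrow> bool" where
  "spin7_metric X A \<Phi> g \<longleftrightarrow> riemannian_metric X A g \<and>
     (\<forall>p\<in>topspace X. \<forall>e. spin7_frame \<Phi> p e \<longrightarrow>
        (\<forall>\<mu> \<nu>. g p (e \<mu>) (e \<nu>) = (if \<mu> = \<nu> then 1 else 0)))"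

definition sharp :: "('a, 'n::finite) metric \<Rightarrow> 'a \<Rightarrow> (real^'n \<Rightarrow> real) \<Rightarrow> real^'n" where
  "sharp g p \<theta> = (THE u. \<forall>w. g p u w = \<theta> w)"

text \<open>\<open>\<delta>\<^sub>g(\<Psi>) = \<Sum>\<^sub>\<mu> (\<iota>\<^bsub>e\<^sub>\<mu>\<^esub> \<Psi>) \<otimes> (e\<^sup>\<mu>)\<^sup>#\<close>, which does not depend on the frame; the standard basis of
  \<open>T\<^sub>pM = \<real>\<^sup>n\<close> is used.\<close>

definition delta_form :: "('a, 'n::finite) metric \<Rightarrow> ('a, 'n) form \<Rightarrow> ('a, 'n) vform" where
  "delta_form g \<Psi> p vs =
     (\<Sum>\<mu>\<in>UNIV. \<Psi> p (axis \<mu> 1 # vs) *\<^sub>R sharp g p (\<lambda>w. w $ \<mu>))"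

definition cross_product :: "('a, 'n::finite) metric \<Rightarrow> ('a, 'n) form \<Rightarrow> ('a, 'n) vform" where
  "cross_product g \<Phi> p vs = - delta_form g \<Phi> p vs"

end

(* The bracket [P,P] of the cross product P is first order in P and may be computed with the
   Levi-Civita connection: with T = nabla Phi and g(w, .) applied, its value at p is, up to a constant factor,
   the alternation over x1, ..., x6 of
     T_{P(x1,x2,x3)}(x4,x5,x6,w) + 3 T_{x1}(x2,x3,x4,P(x5,x6,w)).
   So it vanishes if T does.  Conversely, Phi has comass 1, hence for an orthonormal quadruple
   with Phi(x,y,z,w) = 1 the function |x|^2|y|^2|z|^2|w|^2 - Phi(x,y,z,w)^2 has a minimum 0 at p, and
   differentiating it shows T_v(x,y,z,w) = 0.  In a Spin(7)-frame this leaves 56 components of T, seven for each v,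
   and the vanishing of the bracket is a linear system for them that splits into eight
   invertible 7 x 7 systems. *)

theory Submission
  imports Defs
begin

section \<open>Alternating sums over permutations\<close>

text \<open>The connection may replace the coordinate derivative because the bracket alternates over
  all six arguments: a symmetric \<open>\<Gamma>\<close> drops out where it meets two arguments or
  two values of P, and its other contributions cancel by virtue of the factor 3. The comass bound
  comes from the multiplicativity of the octonion norm. Differentiating the minimum gives a partial
  derivative of Phi; that the Christoffel terms in T match those of the metric follows from the
  first-order condition of the same inequality in each single argument. The splitting comes from a
  grading. Number the frame 0, ..., 7 and add indices as binary vectors. The 14 quadruples of sum 0
  are those of the standard form, and T_v vanishes on them; polarizing this vanishing shows that on
  the other 56 quadruples, eight for each nonzero sum, T_v depends up to sign only on the sum. P
  adds indices as well, so in an equation whose seven vectors are all frame vectors except e_d,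
  every component of T_{e_n} has sum n + d. Hence each d has its own block of seven
  unknowns.\<close>

definition alt_sum :: "nat \<Rightarrow> ((nat \<Rightarrow> 'v) \<Rightarrow> 'r::real_vector) \<Rightarrow> (nat \<Rightarrow> 'v) \<Rightarrow> 'r" where
  "alt_sum n h u = (\<Sum>\<sigma> | \<sigma> permutes {..<n}. of_int (sign \<sigma>) *\<^sub>R h (u \<circ> \<sigma>))"

lemma alt_sum_0 [simp]: "alt_sum 0 h u = h u"
  by (simp add: alt_sum_def sign_id)

text \<open>The symmetric group on n + 1 points is the union of the cosets of transpositions (n b)
  with b <= n; b = n gives the identity, and the others contribute the sign -1.\<close>

lemma alt_sum_Suc:
  "alt_sum (Suc n) h u = alt_sum n h u - (\<Sum>b<n. alt_sum n h (u \<circ> Transposition.transpose n b))"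
proof -
  have sgn: "sign (Transposition.transpose n b \<circ> \<sigma>) = (if b = n then 1 else -1) * sign \<sigma>"
    if "\<sigma> permutes {..<n}" for \<sigma> b
  proof -
    have "permutation \<sigma>"
      using that by (auto simp: permutation_permutes)
    then show ?thesis
      by (simp add: sign_compose permutation_swap_id sign_swap_id)
  qed
  have "alt_sum (Suc n) h u = (\<Sum>b\<in>insert n {..<n}. \<Sum>\<sigma> | \<sigma> permutes {..<n}.
      of_int (sign (Transposition.transpose n b \<circ> \<sigma>)) *\<^sub>R h (u \<circ> (Transposition.transpose n b \<circ> \<sigma>)))"
    unfolding alt_sum_def lessThan_Suc
    by (rule sum_over_permutations_insert) auto
  also have "\<dots> = (\<Sum>b\<in>insert n {..<n}. (if b = n then 1 else -1) *\<^sub>R alt_sum n h (u \<circ> Transposition.transpose n b))"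
    unfolding alt_sum_def scaleR_sum_right
    by (intro sum.cong refl) (simp_all add: sgn comp_assoc)
  also have "\<dots> = alt_sum n h u + (\<Sum>b<n. - alt_sum n h (u \<circ> Transposition.transpose n b))"
  proof -
    have "(\<Sum>b<n. (if b = n then 1 else -1) *\<^sub>R alt_sum n h (u \<circ> Transposition.transpose n b))
        = (\<Sum>b<n. - alt_sum n h (u \<circ> Transposition.transpose n b))"
      by (rule sum.cong) auto
    then show ?thesis by simp
  qed
  finally show ?thesis
    by (simp only: sum_negf add_uminus_conv_diff)
qed

lemma alt_sum_add: "alt_sum n (\<lambda>u. h u + h' u) u = alt_sum n h u + alt_sum n h' u"
  by (simp add: alt_sum_def sum.distrib scaleR_right_distrib)

lemma alt_sum_minus: "alt_sum n (\<lambda>u. - h u) u = - alt_sum n h u"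
  by (simp add: alt_sum_def sum_negf)

lemma alt_sum_diff: "alt_sum n (\<lambda>u. h u - h' u) u = alt_sum n h u - alt_sum n h' u"
  by (simp add: alt_sum_def sum_subtractf scaleR_right_diff_distrib)

lemma alt_sum_sum: "alt_sum n (\<lambda>u. \<Sum>i\<in>I. h i u) u = (\<Sum>i\<in>I. alt_sum n (h i) u)"
  unfolding alt_sum_def scaleR_sum_right by (rule sum.swap)

lemma alt_sum_linear: 
  assumes "linear f"
  shows "f (alt_sum n h u) = alt_sum n (\<lambda>u. f (h u)) u"
  by (simp add: alt_sum_def linear_sum[OF assms] linear_scale[OF assms] o_def)

text \<open>Reindexing the sum by \<open>\<sigma> \<circ> ?t\<close> flips every sign.\<close>

lemma alt_sum_transpose:
  assumes "i < n" "j < n" "i \<noteq> j"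
  shows "alt_sum n (\<lambda>u. h (u \<circ> Transposition.transpose i j)) u = - alt_sum n h u"
proof -
  let ?t = "Transposition.transpose i j"
  have t: "?t permutes {..<n}"
    using assms by (intro permutes_swap_id) auto
  have sgn: "of_int (sign (\<sigma> \<circ> ?t)) = - (of_int (sign \<sigma>) :: real)" if "\<sigma> permutes {..<n}" for \<sigma>
  proof -
    have "permutation \<sigma>"
      using that by (auto simp: permutation_permutes)
    then show ?thesis
      using assms by (simp add: sign_compose permutation_swap_id sign_swap_id)
  qed
  have "alt_sum n h u = (\<Sum>\<sigma> | \<sigma> permutes {..<n}. of_int (sign (\<sigma> \<circ> ?t)) *\<^sub>R h (u \<circ> (\<sigma> \<circ> ?t)))"
    unfolding alt_sum_def
    using sum_permutations_compose_right[OF t, of "\<lambda>\<sigma>. of_int (sign \<sigma>) *\<^sub>R h (u \<circ> \<sigma>)"] by simp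
  also have "\<dots> = - alt_sum n (\<lambda>u. h (u \<circ> ?t)) u"
    unfolding alt_sum_def sum_negf[symmetric] 
    by (intro sum.cong refl) (auto simp: sgn comp_assoc)
  finally show ?thesis by simp
qed

lemma eq_minus_self: "x = 0" if "x = - x" for x :: "'a::real_vector"
proof -
  have "2 *\<^sub>R x = x + x"
    by (rule scaleR_2)
  also have "\<dots> = 0"
    using that by (metis add.right_inverse)
  finally show ?thesis
    by simp
qed

lemma alt_sum_eq_0:
  assumes "i < n" "j < n" "i \<noteq> j" and sym: "\<And>u. h (u \<circ> Transposition.transpose i j) = h u"
  shows "alt_sum n h u = 0"
proof -
  have "alt_sum n h u = - alt_sum n h u"
    using alt_sum_transpose[OF assms(1-3), of h u] unfolding sym .
  then show ?thesis
    by (rule eq_minus_self)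
qed

lemma wedge_alt_sum:
  "wedge k l a b vs = alt_sum (k + l) (\<lambda>u. a (map u [0..<k]) * b (map u [k..<k + l])) (\<lambda>i. vs ! i)
    / (fact k * fact l)"
  by (simp add: wedge_def alt_sum_def o_def mult.assoc)

text \<open>Base case of the expansions below: the two adjacent transpositions generate the
  permutations of three points, so all six terms agree.\<close>

lemma alt_sum_antisym3:
  assumes "\<And>u. h (u \<circ> Transposition.transpose 0 1) = - h u" "\<And>u. h (u \<circ> Transposition.transpose 1 2) = - h u"
  shows "alt_sum 3 h u = 6 *\<^sub>R h u"
proof -
  have "Transposition.transpose 0 2 = Transposition.transpose 0 1 \<circ> Transposition.transpose 1 2 \<circ> Transposition.transpose 0 (1::nat)"
    by (auto simp: Transposition.transpose_def fun_eq_iff)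
  then have "h (u \<circ> Transposition.transpose 0 2) = - h u" for u
    using assms by (metis comp_assoc add.inverse_inverse)
  then show ?thesis using assms
    by (simp add: numeral_3_eq_3 numeral_2_eq_2 alt_sum_Suc transpose_commute algebra_simps flip: scaleR_2)
      (simp flip: scaleR_add_left)
qed

lemma alt_sum_unroll:
  "alt_sum 4 h u = alt_sum 3 h u - (\<Sum>b\<leftarrow>[0, 1, 2]. alt_sum 3 h (u \<circ> Transposition.transpose 3 b))"
  "alt_sum 5 h u = alt_sum 4 h u - (\<Sum>b\<leftarrow>[0, 1, 2, 3]. alt_sum 4 h (u \<circ> Transposition.transpose 4 b))"
  "alt_sum 6 h u = alt_sum 5 h u - (\<Sum>b\<leftarrow>[0, 1, 2, 3, 4]. alt_sum 5 h (u \<circ> Transposition.transpose 5 b))"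
proof -
  have s: "4 = Suc 3" "5 = Suc 4" "6 = Suc 5" by simp_all
  show "alt_sum 4 h u = alt_sum 3 h u - (\<Sum>b\<leftarrow>[0, 1, 2]. alt_sum 3 h (u \<circ> Transposition.transpose 3 b))"
    unfolding s(1) alt_sum_Suc[of 3] by (simp add: eval_nat_numeral)
  show "alt_sum 5 h u = alt_sum 4 h u - (\<Sum>b\<leftarrow>[0, 1, 2, 3]. alt_sum 4 h (u \<circ> Transposition.transpose 4 b))"
    unfolding s(2) alt_sum_Suc[of 4] by (simp add: eval_nat_numeral)
  show "alt_sum 6 h u = alt_sum 5 h u - (\<Sum>b\<leftarrow>[0, 1, 2, 3, 4]. alt_sum 5 h (u \<circ> Transposition.transpose 5 b))"
    unfolding s(3) alt_sum_Suc[of 5] by (simp add: eval_nat_numeral)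
qed

text \<open>Antisymmetry in the two blocks collapses the 720 permutations to 20 shuffles, each
  counted 3! 3! = 36 times. The sum is unrolled one index at a time and equal terms are collected at
  each stage, so the 720 terms never occur together.\<close>

lemma alt_sum_3_3:
  fixes h :: "'v \<Rightarrow> 'v \<Rightarrow> 'v \<Rightarrow> 'v \<Rightarrow> 'v \<Rightarrow> 'v \<Rightarrow> real"
  assumes "\<And>x y z a b c. h y x z a b c = - h x y z a b c" "\<And>x y z a b c. h x z y a b c = - h x y z a b c"
    and "\<And>x y z a b c. h x y z b a c = - h x y z a b c" "\<And>x y z a b c. h x y z a c b = - h x y z a b c"
  shows "alt_sum 6 (\<lambda>u. h (u 0) (u 1) (u 2) (u 3) (u 4) (u 5)) u = 36 * (h (u 0) (u 1) (u 2) (u 3) (u 4) (u 5) - h (u 0) (u 1) (u 3) (u 2) (u 4) (u 5) + h (u 0) (u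
      1) (u 4) (u 2) (u 3) (u 5) - h (u 0) (u 1) (u 5) (u 2) (u 3) (u 4) + h (u 0) (u 2) (u 3) (u
      1) (u 4) (u 5) - h (u 0) (u 2) (u 4) (u 1) (u 3) (u 5) + h (u 0) (u 2) (u 5) (u 1) (u 3) (u
      4) + h (u 0) (u 3) (u 4) (u 1) (u 2) (u 5) - h (u 0) (u 3) (u 5) (u 1) (u 2) (u 4) + h (u 0)
      (u 4) (u 5) (u 1) (u 2) (u 3) - h (u 1) (u 2) (u 3) (u 0) (u 4) (u 5) + h (u 1) (u 2) (u 4)
      (u 0) (u 3) (u 5) - h (u 1) (u 2) (u 5) (u 0) (u 3) (u 4) - h (u 1) (u 3) (u 4) (u 0) (u 2)
      (u 5) + h (u 1) (u 3) (u 5) (u 0) (u 2) (u 4) - h (u 1) (u 4) (u 5) (u 0) (u 2) (u 3) + h (u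
      2) (u 3) (u 4) (u 0) (u 1) (u 5) - h (u 2) (u 3) (u 5) (u 0) (u 1) (u 4) + h (u 2) (u 4) (u
      5) (u 0) (u 1) (u 3) - h (u 3) (u 4) (u 5) (u 0) (u 1) (u 2))"
proof -
  define H where "H u i j k l m n = h (u i) (u j) (u k) (u l) (u m) (u n)" for u :: "nat \<Rightarrow> 'v" and i j k l m n
  \<comment> \<open>The guards compare indices, which orients antisymmetry into terminating rules
    that sort each block.\<close>
  have H: "j < i \<Longrightarrow> H u i j k l m n = - H u j i k l m n" "k < j \<Longrightarrow> H u i j k l m n = - H u i k j l m n"
    "m < l \<Longrightarrow> H u i j k l m n = - H u i j k m l n" "n < m \<Longrightarrow> H u i j k l m n = - H u i j k l n m"
    "H (u \<circ> \<tau>) i j k l m n = H u (\<tau> i) (\<tau> j) (\<tau> k) (\<tau> l) (\<tau> m) (\<tau> n)" for u \<tau> i j k l m n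
    unfolding H_def o_apply by (rule assms refl)+
  let ?H = "\<lambda>u. H u 0 1 2 3 4 5"
  have 3: "alt_sum 3 ?H u = 6 * ?H u" for u
    by (subst alt_sum_antisym3) (simp_all add: H Transposition.transpose_def)
  have 4: "alt_sum 4 ?H u = 6 * (H u 0 1 2 3 4 5 - H u 0 1 3 2 4 5 + H u 0 2 3 1 4 5 - H u 1 2 3 0 4 5)" for u
    unfolding alt_sum_unroll 3 by (simp add: H Transposition.transpose_def)
  have 5: "alt_sum 5 ?H u = 12 * (H u 0 1 2 3 4 5 - H u 0 1 3 2 4 5 + H u 0 1 4 2 3 5 + H u 0 2 3 1 4 5 - H u 0 2 4 1 3 5 + H
      u 0 3 4 1 2 5 - H u 1 2 3 0 4 5 + H u 1 2 4 0 3 5 - H u 1 3 4 0 2 5 + H u 2 3 4 0 1 5)" for u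
    unfolding alt_sum_unroll(2) 4 by (simp add: H Transposition.transpose_def)
  have 6: "alt_sum 6 ?H u = 36 * (H u 0 1 2 3 4 5 - H u 0 1 3 2 4 5 + H u 0 1 4 2 3 5 - H u 0 1 5 2 3 4 + H u 0 2 3 1 4 5 - H
      u 0 2 4 1 3 5 + H u 0 2 5 1 3 4 + H u 0 3 4 1 2 5 - H u 0 3 5 1 2 4 + H u 0 4 5 1 2 3 - H u
      1 2 3 0 4 5 + H u 1 2 4 0 3 5 - H u 1 2 5 0 3 4 - H u 1 3 4 0 2 5 + H u 1 3 5 0 2 4 - H u 1
      4 5 0 2 3 + H u 2 3 4 0 1 5 - H u 2 3 5 0 1 4 + H u 2 4 5 0 1 3 - H u 3 4 5 0 1 2)" for u
    unfolding alt_sum_unroll(3) 5 by (simp add: H Transposition.transpose_def)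
  show ?thesis
    using 6[of u] by (simp only: H_def)
qed

text \<open>Same method with blocks of sizes 3, 2 and 1: 60 shuffles, each counted 3! 2! 1! = 12
  times.\<close>

lemma alt_sum_3_2_1:
  fixes h :: "'v \<Rightarrow> 'v \<Rightarrow> 'v \<Rightarrow> 'v \<Rightarrow> 'v \<Rightarrow> 'v \<Rightarrow> real"
  assumes "\<And>x y z a b c. h y x z a b c = - h x y z a b c" "\<And>x y z a b c. h x z y a b c = - h x y z a b c"
    and "\<And>x y z a b c. h x y z b a c = - h x y z a b c"
  shows "alt_sum 6 (\<lambda>u. h (u 0) (u 1) (u 2) (u 3) (u 4) (u 5)) u = 12 * (h (u 0) (u 1) (u 2) (u 3) (u 4) (u 5) - h (u 0) (u 1) (u 2) (u 3) (u 5) (u 4) + h (u 0) (u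
      1) (u 2) (u 4) (u 5) (u 3) - h (u 0) (u 1) (u 3) (u 2) (u 4) (u 5) + h (u 0) (u 1) (u 3) (u
      2) (u 5) (u 4) - h (u 0) (u 1) (u 3) (u 4) (u 5) (u 2) + h (u 0) (u 1) (u 4) (u 2) (u 3) (u
      5) - h (u 0) (u 1) (u 4) (u 2) (u 5) (u 3) + h (u 0) (u 1) (u 4) (u 3) (u 5) (u 2) - h (u 0)
      (u 1) (u 5) (u 2) (u 3) (u 4) + h (u 0) (u 1) (u 5) (u 2) (u 4) (u 3) - h (u 0) (u 1) (u 5)
      (u 3) (u 4) (u 2) + h (u 0) (u 2) (u 3) (u 1) (u 4) (u 5) - h (u 0) (u 2) (u 3) (u 1) (u 5)
      (u 4) + h (u 0) (u 2) (u 3) (u 4) (u 5) (u 1) - h (u 0) (u 2) (u 4) (u 1) (u 3) (u 5) + h (u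
      0) (u 2) (u 4) (u 1) (u 5) (u 3) - h (u 0) (u 2) (u 4) (u 3) (u 5) (u 1) + h (u 0) (u 2) (u
      5) (u 1) (u 3) (u 4) - h (u 0) (u 2) (u 5) (u 1) (u 4) (u 3) + h (u 0) (u 2) (u 5) (u 3) (u
      4) (u 1) + h (u 0) (u 3) (u 4) (u 1) (u 2) (u 5) - h (u 0) (u 3) (u 4) (u 1) (u 5) (u 2) + h
      (u 0) (u 3) (u 4) (u 2) (u 5) (u 1) - h (u 0) (u 3) (u 5) (u 1) (u 2) (u 4) + h (u 0) (u 3)
      (u 5) (u 1) (u 4) (u 2) - h (u 0) (u 3) (u 5) (u 2) (u 4) (u 1) + h (u 0) (u 4) (u 5) (u 1)
      (u 2) (u 3) - h (u 0) (u 4) (u 5) (u 1) (u 3) (u 2) + h (u 0) (u 4) (u 5) (u 2) (u 3) (u 1)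
      - h (u 1) (u 2) (u 3) (u 0) (u 4) (u 5) + h (u 1) (u 2) (u 3) (u 0) (u 5) (u 4) - h (u 1) (u
      2) (u 3) (u 4) (u 5) (u 0) + h (u 1) (u 2) (u 4) (u 0) (u 3) (u 5) - h (u 1) (u 2) (u 4) (u
      0) (u 5) (u 3) + h (u 1) (u 2) (u 4) (u 3) (u 5) (u 0) - h (u 1) (u 2) (u 5) (u 0) (u 3) (u
      4) + h (u 1) (u 2) (u 5) (u 0) (u 4) (u 3) - h (u 1) (u 2) (u 5) (u 3) (u 4) (u 0) - h (u 1)
      (u 3) (u 4) (u 0) (u 2) (u 5) + h (u 1) (u 3) (u 4) (u 0) (u 5) (u 2) - h (u 1) (u 3) (u 4)
      (u 2) (u 5) (u 0) + h (u 1) (u 3) (u 5) (u 0) (u 2) (u 4) - h (u 1) (u 3) (u 5) (u 0) (u 4)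
      (u 2) + h (u 1) (u 3) (u 5) (u 2) (u 4) (u 0) - h (u 1) (u 4) (u 5) (u 0) (u 2) (u 3) + h (u
      1) (u 4) (u 5) (u 0) (u 3) (u 2) - h (u 1) (u 4) (u 5) (u 2) (u 3) (u 0) + h (u 2) (u 3) (u
      4) (u 0) (u 1) (u 5) - h (u 2) (u 3) (u 4) (u 0) (u 5) (u 1) + h (u 2) (u 3) (u 4) (u 1) (u
      5) (u 0) - h (u 2) (u 3) (u 5) (u 0) (u 1) (u 4) + h (u 2) (u 3) (u 5) (u 0) (u 4) (u 1) - h
      (u 2) (u 3) (u 5) (u 1) (u 4) (u 0) + h (u 2) (u 4) (u 5) (u 0) (u 1) (u 3) - h (u 2) (u 4)
      (u 5) (u 0) (u 3) (u 1) + h (u 2) (u 4) (u 5) (u 1) (u 3) (u 0) - h (u 3) (u 4) (u 5) (u 0)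
      (u 1) (u 2) + h (u 3) (u 4) (u 5) (u 0) (u 2) (u 1) - h (u 3) (u 4) (u 5) (u 1) (u 2) (u 0))"
proof -
  define H where "H u i j k l m n = h (u i) (u j) (u k) (u l) (u m) (u n)" for u :: "nat \<Rightarrow> 'v" and i j k l m n
  have H: "j < i \<Longrightarrow> H u i j k l m n = - H u j i k l m n" "k < j \<Longrightarrow> H u i j k l m n = - H u i k j l m n"
    "m < l \<Longrightarrow> H u i j k l m n = - H u i j k m l n"
    "H (u \<circ> \<tau>) i j k l m n = H u (\<tau> i) (\<tau> j) (\<tau> k) (\<tau> l) (\<tau> m) (\<tau> n)" for u \<tau> i j k l m n
    unfolding H_def o_apply by (rule assms refl)+
  let ?H = "\<lambda>u. H u 0 1 2 3 4 5"
  have 3: "alt_sum 3 ?H u = 6 * ?H u" for u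
    by (subst alt_sum_antisym3) (simp_all add: H Transposition.transpose_def)
  have 4: "alt_sum 4 ?H u = 6 * (H u 0 1 2 3 4 5 - H u 0 1 3 2 4 5 + H u 0 2 3 1 4 5 - H u 1 2 3 0 4 5)" for u
    unfolding alt_sum_unroll 3 by (simp add: H Transposition.transpose_def)
  have 5: "alt_sum 5 ?H u = 12 * (H u 0 1 2 3 4 5 - H u 0 1 3 2 4 5 + H u 0 1 4 2 3 5 + H u 0 2 3 1 4 5 - H u 0 2 4 1 3 5 + H
      u 0 3 4 1 2 5 - H u 1 2 3 0 4 5 + H u 1 2 4 0 3 5 - H u 1 3 4 0 2 5 + H u 2 3 4 0 1 5)" for u
    unfolding alt_sum_unroll(2) 4 by (simp add: H Transposition.transpose_def)
  have 6: "alt_sum 6 ?H u = 12 * (H u 0 1 2 3 4 5 - H u 0 1 2 3 5 4 + H u 0 1 2 4 5 3 - H u 0 1 3 2 4 5 + H u 0 1 3 2 5 4 - H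
      u 0 1 3 4 5 2 + H u 0 1 4 2 3 5 - H u 0 1 4 2 5 3 + H u 0 1 4 3 5 2 - H u 0 1 5 2 3 4 + H u
      0 1 5 2 4 3 - H u 0 1 5 3 4 2 + H u 0 2 3 1 4 5 - H u 0 2 3 1 5 4 + H u 0 2 3 4 5 1 - H u 0
      2 4 1 3 5 + H u 0 2 4 1 5 3 - H u 0 2 4 3 5 1 + H u 0 2 5 1 3 4 - H u 0 2 5 1 4 3 + H u 0 2
      5 3 4 1 + H u 0 3 4 1 2 5 - H u 0 3 4 1 5 2 + H u 0 3 4 2 5 1 - H u 0 3 5 1 2 4 + H u 0 3 5
      1 4 2 - H u 0 3 5 2 4 1 + H u 0 4 5 1 2 3 - H u 0 4 5 1 3 2 + H u 0 4 5 2 3 1 - H u 1 2 3 0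
      4 5 + H u 1 2 3 0 5 4 - H u 1 2 3 4 5 0 + H u 1 2 4 0 3 5 - H u 1 2 4 0 5 3 + H u 1 2 4 3 5
      0 - H u 1 2 5 0 3 4 + H u 1 2 5 0 4 3 - H u 1 2 5 3 4 0 - H u 1 3 4 0 2 5 + H u 1 3 4 0 5 2
      - H u 1 3 4 2 5 0 + H u 1 3 5 0 2 4 - H u 1 3 5 0 4 2 + H u 1 3 5 2 4 0 - H u 1 4 5 0 2 3 +
      H u 1 4 5 0 3 2 - H u 1 4 5 2 3 0 + H u 2 3 4 0 1 5 - H u 2 3 4 0 5 1 + H u 2 3 4 1 5 0 - H
      u 2 3 5 0 1 4 + H u 2 3 5 0 4 1 - H u 2 3 5 1 4 0 + H u 2 4 5 0 1 3 - H u 2 4 5 0 3 1 + H u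
      2 4 5 1 3 0 - H u 3 4 5 0 1 2 + H u 3 4 5 0 2 1 - H u 3 4 5 1 2 0)" for u
    unfolding alt_sum_unroll(3) 5 by (simp add: H Transposition.transpose_def)
  show ?thesis
    using 6[of u] by (simp only: H_def)
qed

section \<open>The torsion tensor at a point\<close>

text \<open>An insertion sort: fact 3 inserts the last argument into an increasing triple, fact 2
  the third argument into an increasing pair. Swaps only change the sign, and a repeated argument
  gives 0.\<close>

lemma alternating_4_eq_0:
  fixes f :: "nat \<Rightarrow> nat \<Rightarrow> nat \<Rightarrow> nat \<Rightarrow> real"
  assumes swap: "\<And>a b c d. f b a c d = - f a b c d" "\<And>a b c d. f a c b d = - f a b c d" "\<And>a b c d. f a b d c = - f a b c d"
    and sorted: "\<And>a b c d. a < b \<Longrightarrow> b < c \<Longrightarrow> c < d \<Longrightarrow> d < n \<Longrightarrow> f a b c d = 0"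
    and "a < n" "b < n" "c < n" "d < n"
  shows "f a b c d = 0"
proof -
  have sym: "f a b c d = 0 \<longleftrightarrow> f b a c d = 0" "f a b c d = 0 \<longleftrightarrow> f a c b d = 0" "f a b c d = 0 \<longleftrightarrow> f a b d c = 0" for a b c d
    using swap(1)[of b a c d] swap(2)[of a c b d] swap(3)[of a b d c] by auto
  have rep: "f a a c d = 0" "f a b b d = 0" "f a b c c = 0" for a b c d
    using swap(1)[of a a c d] swap(2)[of a b b d] swap(3)[of a b c c] by auto
  have 3: "f a b c d = 0" if "a < b" "b < c" "c < n" "d < n" for a b c d
  proof -
    consider "c < d" | "c = d" | "b < d \<and> d < c" | "b = d" | "a < d \<and> d < b" | "a = d" | "d < a"
      by linarith
    then show ?thesis
      using that sorted[of a b c d] sorted[of a b d c] sorted[of a d b c] sorted[of d a b c] rep sym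
      by cases metis+
  qed
  have 2: "f a b c d = 0" if "a < b" "b < n" "c < n" "d < n" for a b c d
  proof -
    consider "b < c" | "b = c" | "a < c \<and> c < b" | "a = c" | "c < a"
      by linarith
    then show ?thesis
      using that 3[of a b c d] 3[of a c b d] 3[of c a b d] rep sym
      by cases metis+
  qed
  consider "a < b" | "a = b" | "b < a"
    by linarith
  then show ?thesis
    using assms(5-) 2[of a b c d] 2[of b a c d] rep sym by cases metis+
qed

text \<open>At a point \<open>p\<close> of a Spin(7)-manifold \<open>F\<close> is the value of \<open>\<Phi>\<close>, \<open>q\<close> the cross product and
  \<open>T v x y z w\<close> the value of \<open>\<nabla>\<^sub>v\<Phi>\<close>.  The assumption \<open>T_calibrated\<close> replaces the statement
  that \<open>\<nabla>\<^sub>v\<Phi>\<close> lies in the seven-dimensional summand of \<open>\<Lambda>\<^sup>4\<close>, and \<open>torsion_eq\<close> below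
  expresses that the bracket vanishes.\<close>

locale spin7_torsion =
  fixes g :: "'v::real_vector \<Rightarrow> 'v \<Rightarrow> real" and F :: "'v \<Rightarrow> 'v \<Rightarrow> 'v \<Rightarrow> 'v \<Rightarrow> real"
    and q :: "'v \<Rightarrow> 'v \<Rightarrow> 'v \<Rightarrow> 'v" and T :: "'v \<Rightarrow> 'v \<Rightarrow> 'v \<Rightarrow> 'v \<Rightarrow> 'v \<Rightarrow> real"
    and E :: "nat \<Rightarrow> 'v"
  assumes g_bilinear: "bilinear g" and g_commute: "g x y = g y x" and g_pos: "x \<noteq> 0 \<Longrightarrow> 0 < g x x"
    and F_linear: "linear (\<lambda>x. F x y z w)"
    and F_swap: "F y x z w = - F x y z w" "F x z y w = - F x y z w" "F x y w z = - F x y z w"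
    and F_le: "(F x y z w)\<^sup>2 \<le> g x x * g y y * g z z * g w w"
    and g_q: "g (q x y z) w = F x y z w"
    and T_linear_fst: "linear (\<lambda>v. T v x y z w)" and T_linear: "linear (\<lambda>x. T v x y z w)"
    and T_swap: "T v y x z w = - T v x y z w" "T v x z y w = - T v x y z w" "T v x y w z = - T v x y z w"
    and T_calibrated: "(F x y z w)\<^sup>2 = g x x * g y y * g z z * g w w \<Longrightarrow> F x y z w \<noteq> 0 \<Longrightarrow> T v x y z w = 0"
    and g_E: "i < 8 \<Longrightarrow> j < 8 \<Longrightarrow> g (E i) (E j) = (if i = j then 1 else 0)"
    and E_span: "x = (\<Sum>i<8. g x (E i) *\<^sub>R E i)"
    and F_E:
      "F (E 0) (E 1) (E 2) (E 3) = 1"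
      "F (E 0) (E 1) (E 4) (E 5) = 1"
      "F (E 0) (E 1) (E 6) (E 7) = 1"
      "F (E 0) (E 2) (E 4) (E 6) = 1"
      "F (E 0) (E 2) (E 5) (E 7) = - 1"
      "F (E 0) (E 3) (E 4) (E 7) = - 1"
      "F (E 0) (E 3) (E 5) (E 6) = - 1"
      "F (E 4) (E 5) (E 6) (E 7) = 1"
      "F (E 2) (E 3) (E 6) (E 7) = 1"
      "F (E 2) (E 3) (E 4) (E 5) = 1"
      "F (E 1) (E 3) (E 5) (E 7) = 1"
      "F (E 1) (E 3) (E 4) (E 6) = - 1"
      "F (E 1) (E 2) (E 5) (E 6) = - 1"
      "F (E 1) (E 2) (E 4) (E 7) = - 1"
begin

text \<open>Index terms such as \<open>E 1\<close> have to keep their literal form to match the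
  tables below.\<close>

declare One_nat_def [simp del]

section \<open>Multilinear algebra of the form, the cross product and the torsion\<close>

lemma g_simps:
  "g (x + x') y = g x y + g x' y" "g x (y + y') = g x y + g x y'" "g (- x) y = - g x y" "g x (- y) = - g x y"
  "g (x - x') y = g x y - g x' y" "g x (y - y') = g x y - g x y'" "g (c *\<^sub>R x) y = c * g x y" 
  using g_bilinear by (simp_all add: bilinear_ladd bilinear_radd bilinear_lneg bilinear_rneg bilinear_lsub
      bilinear_rsub bilinear_lmul)

lemma g_nondegenerate: "x = y" if "\<And>w. g x w = g y w"
proof -
  have "g (x - y) (x - y) = 0"
    using that by (simp add: g_simps)
  then show ?thesis
    using g_pos[of "x - y"] by force
qed

lemma F_add: "F (x + x') y z w = F x y z w + F x' y z w" "F x y z (w + w') = F x y z w + F x y z w'"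
  "F (- x) y z w = - F x y z w" "F x y z (- w) = - F x y z w"
proof -
  have rot: "F x y z w = - F w x y z" for x y z w
    by (metis F_swap add.inverse_inverse)
  show "F (x + x') y z w = F x y z w + F x' y z w" "F (- x) y z w = - F x y z w" for x x' y z w
    using linear_add[OF F_linear] linear_neg[OF F_linear] by blast+
  then show "F x y z (w + w') = F x y z w + F x y z w'" "F x y z (- w) = - F x y z w"
    by (simp_all add: rot[of x])
qed

lemma T_rot: "T v x y z w = - T v w x y z"
  by (metis T_swap add.inverse_inverse)

lemma T_add: "T v (x + x') y z w = T v x y z w + T v x' y z w" "T v x y z (w + w') = T v x y z w + T v x y z w'"
  "T v (- x) y z w = - T v x y z w" "T v x y z (- w) = - T v x y z w"
  "T (- v) x y z w = - T v x y z w"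
proof -
  show "T v (x + x') y z w = T v x y z w + T v x' y z w" "T v (- x) y z w = - T v x y z w" for v x x' y z w
    using linear_add[OF T_linear] linear_neg[OF T_linear] by blast+
  then show "T v x y z (w + w') = T v x y z w + T v x y z w'" "T v x y z (- w) = - T v x y z w"
    by (simp_all add: T_rot[of v x])
  show "T (- v) x y z w = - T v x y z w"
    using linear_neg[OF T_linear_fst] by blast
qed

lemma q_swap: "q y x z = - q x y z" "q x z y = - q x y z"
  by (rule g_nondegenerate; simp add: g_simps g_q F_swap(1)[of y x] F_swap(2)[of x z])+

lemma T_repeated: "T v x x z w = 0" "T v x y y w = 0" "T v x y z z = 0"
  using T_swap(1)[of v x x z w] T_swap(2)[of v x y y w] T_swap(3)[of v x y z z] by linarith+

text \<open>The comass bound turns a value \<open>1\<close> of \<open>F\<close> on an orthonormal quadruple into the value of the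
  cross product.\<close>

lemma q_eqI:
  assumes "g x x = 1" "g y y = 1" "g z z = 1" "g w w = 1" "F x y z w = 1"
  shows "q x y z = w"
proof -
  let ?q = "q x y z"
  have "(g ?q ?q)\<^sup>2 \<le> g ?q ?q"
    using F_le[of x y z ?q] assms by (simp add: g_q)
  then have "g ?q ?q \<le> 1"
    using mult_strict_right_mono[of 1 "g ?q ?q" "g ?q ?q"] by (fastforce simp: power2_eq_square)
  moreover have "g ?q w = 1"
    by (simp add: g_q assms)
  ultimately have "g (?q - w) (?q - w) \<le> 0"
    using assms(4) g_commute[of w ?q] by (simp add: g_simps)
  then show ?thesis
    using g_pos[of "?q - w"] by force
qed

text \<open>Omitting one of the four vectors and moving it to the last place costs alternating
  signs, so each value of \<open>F\<close> yields four entries of the multiplication table of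
  \<open>q\<close>.\<close>

lemma q_E:
  assumes "i < 8" "j < 8" "k < 8" "l < 8" "F (E i) (E j) (E k) (E l) = s" "s = 1 \<or> s = -1"
  shows "q (E i) (E j) (E k) = s *\<^sub>R E l" "q (E i) (E j) (E l) = - s *\<^sub>R E k"
    "q (E i) (E k) (E l) = s *\<^sub>R E j" "q (E j) (E k) (E l) = - s *\<^sub>R E i"
proof -
  have unit: "g (s *\<^sub>R E m) (s *\<^sub>R E m) = 1" "g (- s *\<^sub>R E m) (- s *\<^sub>R E m) = 1" "g (E m) (E m) = 1" if "m < 8" for m
    using that assms(6) g_E[of m m] by (auto simp: g_simps)
  have F: "F x y z (s *\<^sub>R w) = 1" if "F x y z w = s" for x y z w
    using that assms(6) by (auto simp: F_add)
  have F': "F x y z (- s *\<^sub>R w) = 1" if "F x y z w = - s" for x y z w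
    using that assms(6) by (auto simp: F_add)
  show "q (E i) (E j) (E k) = s *\<^sub>R E l"
    by (intro q_eqI unit assms F)
  show "q (E i) (E j) (E l) = - s *\<^sub>R E k"
    by (intro q_eqI unit assms F') (metis F_swap assms(5))
  show "q (E i) (E k) (E l) = s *\<^sub>R E j"
    by (intro q_eqI unit assms F) (metis F_swap assms(5) add.inverse_inverse)
  show "q (E j) (E k) (E l) = - s *\<^sub>R E i"
    by (intro q_eqI unit assms F') (metis F_swap assms(5) add.inverse_inverse)
qed

text \<open>The 14 quadruples form a Steiner system S(3,4,8): 14 * 4 = 56 is the number of triples
  of indices, and each triple lies in exactly one quadruple. Up to the order of arguments this is
  therefore the whole table of \<open>q\<close> on distinct basis vectors.\<close>

lemmas cross_E =
  q_E[OF _ _ _ _ F_E(1), simplified]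
  q_E[OF _ _ _ _ F_E(2), simplified]
  q_E[OF _ _ _ _ F_E(3), simplified]
  q_E[OF _ _ _ _ F_E(4), simplified]
  q_E[OF _ _ _ _ F_E(5), simplified]
  q_E[OF _ _ _ _ F_E(6), simplified]
  q_E[OF _ _ _ _ F_E(7), simplified]
  q_E[OF _ _ _ _ F_E(8), simplified]
  q_E[OF _ _ _ _ F_E(9), simplified]
  q_E[OF _ _ _ _ F_E(10), simplified]
  q_E[OF _ _ _ _ F_E(11), simplified]
  q_E[OF _ _ _ _ F_E(12), simplified]
  q_E[OF _ _ _ _ F_E(13), simplified]
  q_E[OF _ _ _ _ F_E(14), simplified]

section \<open>Components of the torsion determined by calibrated quadruples\<close>

lemma T_cross:
  assumes "i < 8" "j < 8" "k < 8" "g (q (E i) (E j) (E k)) (q (E i) (E j) (E k)) = 1"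
  shows "T v (E i) (E j) (E k) (q (E i) (E j) (E k)) = 0"
proof -
  have "F (E i) (E j) (E k) (q (E i) (E j) (E k)) = 1"
    using assms(4) by (simp add: g_q)
  then show ?thesis
    by (intro T_calibrated) (simp_all add: g_E assms)
qed

text \<open>The polarization of \<open>T_cross\<close>.\<close>

lemma T_exchange:
  assumes "i < 8" "i' < 8" "j < 8" "k < 8" "i \<noteq> i'" and w: "w = q (E i) (E j) (E k)" and w': "w' = q (E i') (E j) (E k)"
    and "g w w = 1" "g w' w' = 1" "g w w' = 0" 
  shows "T v (E i) (E j) (E k) w' = - T v (E i') (E j) (E k) w"
proof -
  have F: "F (E i) (E j) (E k) w = 1" "F (E i') (E j) (E k) w' = 1" "F (E i) (E j) (E k) w' = 0" "F (E i') (E j) (E k) w = 0"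
    using assms(8-10) g_commute[of w w'] unfolding w w' by (simp_all add: g_q)
  have "T v (E i + E i') (E j) (E k) (w + w') = 0"
    using assms(1-5,8-10) g_commute[of w w'] by (intro T_calibrated) (simp_all add: F F_add g_simps g_E power2_eq_square)
  moreover have "T v (E i) (E j) (E k) w = 0" "T v (E i') (E j) (E k) w' = 0"
    unfolding w w' using assms(1-4,8,9) by (auto intro!: T_cross simp: w w')
  ultimately show ?thesis
    by (simp add: T_add)
qed

text \<open>A variant with the opposite sign. Below, each instance uses the variant whose left side
  sorts to a component without a minus sign, as a rewrite rule needs.\<close>

lemma T_exchange':
  assumes "i < 8" "i' < 8" "j < 8" "k < 8" "i \<noteq> i'" and w: "w = q (E i) (E j) (E k)" and w': "w' = q (E i') (E j) (E k)"
    and "g w w = 1" "g w' w' = 1" "g w w' = 0" 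
  shows "T v (E j) (E i) (E k) w' = T v (E i') (E j) (E k) w"
  using T_exchange[OF assms] T_swap(1) by metis

text \<open>The guard on the indices turns antisymmetry into a rule that sorts arguments and then
  stops; likewise for \<open>q_sort\<close>.\<close>

lemma T_sort:
  "j < i \<Longrightarrow> T v (E i) (E j) z w = - T v (E j) (E i) z w"
  "j < i \<Longrightarrow> T v x (E i) (E j) w = - T v x (E j) (E i) w"
  "j < i \<Longrightarrow> T v x y (E i) (E j) = - T v x y (E j) (E i)"
  by (rule T_swap)+

lemma q_sort:
  "j < i \<Longrightarrow> q (E i) (E j) z = - q (E j) (E i) z"
  "j < i \<Longrightarrow> q x (E i) (E j) = - q x (E j) (E i)"
  by (rule q_swap)+

context
  notes [simp] = cross_E g_E g_simps T_add T_sort q_sort T_repeated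
begin

lemmas T_E_0 =
  T_cross[of 0 1 2, simplified]
  T_cross[of 0 1 4, simplified]
  T_cross[of 0 1 6, simplified]
  T_cross[of 0 2 4, simplified]
  T_cross[of 0 2 5, simplified]
  T_cross[of 0 3 4, simplified]
  T_cross[of 0 3 5, simplified]
  T_cross[of 4 5 6, simplified]
  T_cross[of 2 3 6, simplified]
  T_cross[of 2 3 4, simplified]
  T_cross[of 1 3 5, simplified]
  T_cross[of 1 3 4, simplified]
  T_cross[of 1 2 5, simplified]
  T_cross[of 1 2 4, simplified]

text \<open>Add indices by the exclusive or of their binary digits; then \<open>q\<close> adds indices up to sign.
  The rules below express every component \<open>T v (E a) (E b) (E c) (E d)\<close> by one of seven, according
  to the value \<open>a + b + c + d \<noteq> 0\<close>; the index sets with sum \<open>0\<close> are those of \<open>T_E_0\<close>.\<close>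

lemmas T_E_exchange =
  T_exchange[OF _ _ _ _ _ refl refl, of 3 4 0 1, simplified]
  T_exchange[OF _ _ _ _ _ refl refl, of 3 4 0 2, simplified]
  T_exchange'[OF _ _ _ _ _ refl refl, of 5 2 0 4, simplified]
  T_exchange'[OF _ _ _ _ _ refl refl, of 3 4 1 2, simplified]
  T_exchange[OF _ _ _ _ _ refl refl, of 5 2 1 4, simplified]
  T_exchange'[OF _ _ _ _ _ refl refl, of 6 1 2 4, simplified]
  T_exchange[OF _ _ _ _ _ refl refl, of 6 1 3 5, simplified]
  T_exchange'[OF _ _ _ _ _ refl refl, of 3 5 0 1, simplified]
  T_exchange'[OF _ _ _ _ _ refl refl, of 3 5 0 2, simplified]
  T_exchange'[OF _ _ _ _ _ refl refl, of 4 2 0 5, simplified]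
  T_exchange'[OF _ _ _ _ _ refl refl, of 3 5 1 2, simplified]
  T_exchange'[OF _ _ _ _ _ refl refl, of 4 2 1 5, simplified]
  T_exchange'[OF _ _ _ _ _ refl refl, of 6 0 2 5, simplified]
  T_exchange'[OF _ _ _ _ _ refl refl, of 6 0 3 4, simplified]
  T_exchange[OF _ _ _ _ _ refl refl, of 3 6 0 1, simplified]
  T_exchange'[OF _ _ _ _ _ refl refl, of 3 6 0 2, simplified]
  T_exchange[OF _ _ _ _ _ refl refl, of 4 1 0 6, simplified]
  T_exchange[OF _ _ _ _ _ refl refl, of 3 6 1 2, simplified]
  T_exchange'[OF _ _ _ _ _ refl refl, of 5 0 1 6, simplified]
  T_exchange[OF _ _ _ _ _ refl refl, of 4 1 2 6, simplified]
  T_exchange'[OF _ _ _ _ _ refl refl, of 4 1 3 7, simplified]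
  T_exchange'[OF _ _ _ _ _ refl refl, of 3 7 0 1, simplified]
  T_exchange[OF _ _ _ _ _ refl refl, of 3 7 0 2, simplified]
  T_exchange[OF _ _ _ _ _ refl refl, of 5 1 0 7, simplified]
  T_exchange[OF _ _ _ _ _ refl refl, of 3 7 1 2, simplified]
  T_exchange'[OF _ _ _ _ _ refl refl, of 4 0 1 7, simplified]
  T_exchange[OF _ _ _ _ _ refl refl, of 4 0 2 7, simplified]
  T_exchange[OF _ _ _ _ _ refl refl, of 4 0 3 6, simplified]
  T_exchange[OF _ _ _ _ _ refl refl, of 5 6 0 1, simplified]
  T_exchange[OF _ _ _ _ _ refl refl, of 2 1 0 4, simplified]
  T_exchange[OF _ _ _ _ _ refl refl, of 2 1 0 6, simplified]
  T_exchange'[OF _ _ _ _ _ refl refl, of 3 0 1 4, simplified]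
  T_exchange'[OF _ _ _ _ _ refl refl, of 3 0 1 6, simplified]
  T_exchange'[OF _ _ _ _ _ refl refl, of 2 1 4 6, simplified]
  T_exchange[OF _ _ _ _ _ refl refl, of 2 1 5 7, simplified]
  T_exchange'[OF _ _ _ _ _ refl refl, of 5 7 0 1, simplified]
  T_exchange[OF _ _ _ _ _ refl refl, of 3 1 0 4, simplified]
  T_exchange[OF _ _ _ _ _ refl refl, of 3 1 0 7, simplified]
  T_exchange'[OF _ _ _ _ _ refl refl, of 2 0 1 4, simplified]
  T_exchange'[OF _ _ _ _ _ refl refl, of 2 0 1 7, simplified]
  T_exchange'[OF _ _ _ _ _ refl refl, of 2 0 4 7, simplified]
  T_exchange'[OF _ _ _ _ _ refl refl, of 2 0 5 6, simplified]
  T_exchange[OF _ _ _ _ _ refl refl, of 5 4 0 2, simplified]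
  T_exchange[OF _ _ _ _ _ refl refl, of 3 2 0 4, simplified]
  T_exchange'[OF _ _ _ _ _ refl refl, of 3 2 0 7, simplified]
  T_exchange[OF _ _ _ _ _ refl refl, of 1 0 2 4, simplified]
  T_exchange'[OF _ _ _ _ _ refl refl, of 1 0 2 7, simplified]
  T_exchange'[OF _ _ _ _ _ refl refl, of 1 0 4 7, simplified]
  T_exchange'[OF _ _ _ _ _ refl refl, of 1 0 5 6, simplified]
end

text \<open>The two alternations are added when the direction of differentiation is the first of the
  six arguments. Here it is the last one, \<open>u 5\<close>, and a 6-cycle is odd; this puts the
  second sum on the other side.\<close>

context
  assumes torsion_eq: "\<And>u w. alt_sum 6 (\<lambda>u. T (q (u 0) (u 1) (u 2)) (u 3) (u 4) (u 5) w) u =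
      3 * alt_sum 6 (\<lambda>u. T (u 5) (u 0) (u 1) (u 2) (q (u 3) (u 4) w)) u"
begin

text \<open>The multiplicities 36 on the left and 3 * 12 on the right of \<open>torsion_eq\<close>
  cancel, so that only coefficients 1 and -1 remain.\<close>

lemma shuffle_eq:
  "T (q x0 x1 x2) x3 x4 x5 w - T (q x0 x1 x3) x2 x4 x5 w + T (q x0 x1 x4) x2 x3 x5 w - T (q x0
      x1 x5) x2 x3 x4 w + T (q x0 x2 x3) x1 x4 x5 w - T (q x0 x2 x4) x1 x3 x5 w + T (q x0 x2 x5)
      x1 x3 x4 w + T (q x0 x3 x4) x1 x2 x5 w - T (q x0 x3 x5) x1 x2 x4 w + T (q x0 x4 x5) x1 x2 x3
      w - T (q x1 x2 x3) x0 x4 x5 w + T (q x1 x2 x4) x0 x3 x5 w - T (q x1 x2 x5) x0 x3 x4 w - T (q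
      x1 x3 x4) x0 x2 x5 w + T (q x1 x3 x5) x0 x2 x4 w - T (q x1 x4 x5) x0 x2 x3 w + T (q x2 x3
      x4) x0 x1 x5 w - T (q x2 x3 x5) x0 x1 x4 w + T (q x2 x4 x5) x0 x1 x3 w - T (q x3 x4 x5) x0
      x1 x2 w =
   T x5 x0 x1 x2 (q x3 x4 w) - T x4 x0 x1 x2 (q x3 x5 w) + T x3 x0 x1 x2 (q x4 x5 w) - T x5 x0
      x1 x3 (q x2 x4 w) + T x4 x0 x1 x3 (q x2 x5 w) - T x2 x0 x1 x3 (q x4 x5 w) + T x5 x0 x1 x4 (q
      x2 x3 w) - T x3 x0 x1 x4 (q x2 x5 w) + T x2 x0 x1 x4 (q x3 x5 w) - T x4 x0 x1 x5 (q x2 x3 w)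
      + T x3 x0 x1 x5 (q x2 x4 w) - T x2 x0 x1 x5 (q x3 x4 w) + T x5 x0 x2 x3 (q x1 x4 w) - T x4
      x0 x2 x3 (q x1 x5 w) + T x1 x0 x2 x3 (q x4 x5 w) - T x5 x0 x2 x4 (q x1 x3 w) + T x3 x0 x2 x4
      (q x1 x5 w) - T x1 x0 x2 x4 (q x3 x5 w) + T x4 x0 x2 x5 (q x1 x3 w) - T x3 x0 x2 x5 (q x1 x4
      w) + T x1 x0 x2 x5 (q x3 x4 w) + T x5 x0 x3 x4 (q x1 x2 w) - T x2 x0 x3 x4 (q x1 x5 w) + T
      x1 x0 x3 x4 (q x2 x5 w) - T x4 x0 x3 x5 (q x1 x2 w) + T x2 x0 x3 x5 (q x1 x4 w) - T x1 x0 x3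
      x5 (q x2 x4 w) + T x3 x0 x4 x5 (q x1 x2 w) - T x2 x0 x4 x5 (q x1 x3 w) + T x1 x0 x4 x5 (q x2
      x3 w) - T x5 x1 x2 x3 (q x0 x4 w) + T x4 x1 x2 x3 (q x0 x5 w) - T x0 x1 x2 x3 (q x4 x5 w) +
      T x5 x1 x2 x4 (q x0 x3 w) - T x3 x1 x2 x4 (q x0 x5 w) + T x0 x1 x2 x4 (q x3 x5 w) - T x4 x1
      x2 x5 (q x0 x3 w) + T x3 x1 x2 x5 (q x0 x4 w) - T x0 x1 x2 x5 (q x3 x4 w) - T x5 x1 x3 x4 (q
      x0 x2 w) + T x2 x1 x3 x4 (q x0 x5 w) - T x0 x1 x3 x4 (q x2 x5 w) + T x4 x1 x3 x5 (q x0 x2 w)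
      - T x2 x1 x3 x5 (q x0 x4 w) + T x0 x1 x3 x5 (q x2 x4 w) - T x3 x1 x4 x5 (q x0 x2 w) + T x2
      x1 x4 x5 (q x0 x3 w) - T x0 x1 x4 x5 (q x2 x3 w) + T x5 x2 x3 x4 (q x0 x1 w) - T x1 x2 x3 x4
      (q x0 x5 w) + T x0 x2 x3 x4 (q x1 x5 w) - T x4 x2 x3 x5 (q x0 x1 w) + T x1 x2 x3 x5 (q x0 x4
      w) - T x0 x2 x3 x5 (q x1 x4 w) + T x3 x2 x4 x5 (q x0 x1 w) - T x1 x2 x4 x5 (q x0 x3 w) + T
      x0 x2 x4 x5 (q x1 x3 w) - T x2 x3 x4 x5 (q x0 x1 w) + T x1 x3 x4 x5 (q x0 x2 w) - T x0 x3 x4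
      x5 (q x1 x2 w)"
proof -
  define u where "u = (!) [x0, x1, x2, x3, x4, x5]"
  have u: "u 0 = x0" "u 1 = x1" "u 2 = x2" "u 3 = x3" "u 4 = x4" "u 5 = x5"
    by (simp_all add: u_def)
  have "alt_sum 6 (\<lambda>u. T (q (u 0) (u 1) (u 2)) (u 3) (u 4) (u 5) w) u = 36 * (T (q x0 x1 x2) x3 x4 x5 w - T (q x0 x1 x3) x2 x4 x5 w + T (q x0 x1 x4) x2 x3 x5 w - T (q x0
      x1 x5) x2 x3 x4 w + T (q x0 x2 x3) x1 x4 x5 w - T (q x0 x2 x4) x1 x3 x5 w + T (q x0 x2 x5)
      x1 x3 x4 w + T (q x0 x3 x4) x1 x2 x5 w - T (q x0 x3 x5) x1 x2 x4 w + T (q x0 x4 x5) x1 x2 x3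
      w - T (q x1 x2 x3) x0 x4 x5 w + T (q x1 x2 x4) x0 x3 x5 w - T (q x1 x2 x5) x0 x3 x4 w - T (q
      x1 x3 x4) x0 x2 x5 w + T (q x1 x3 x5) x0 x2 x4 w - T (q x1 x4 x5) x0 x2 x3 w + T (q x2 x3
      x4) x0 x1 x5 w - T (q x2 x3 x5) x0 x1 x4 w + T (q x2 x4 x5) x0 x1 x3 w - T (q x3 x4 x5) x0
      x1 x2 w)"
    unfolding u[symmetric] by (rule alt_sum_3_3[of "\<lambda>a b c d e f. T (q a b c) d e f w"])
      (metis q_swap T_add(5), metis q_swap T_add(5), (rule T_swap)+)
  moreover have "alt_sum 6 (\<lambda>u. T (u 5) (u 0) (u 1) (u 2) (q (u 3) (u 4) w)) u = 12 * (T x5 x0 x1 x2 (q x3 x4 w) - T x4 x0 x1 x2 (q x3 x5 w) + T x3 x0 x1 x2 (q x4 x5 w) - T x5 x0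
      x1 x3 (q x2 x4 w) + T x4 x0 x1 x3 (q x2 x5 w) - T x2 x0 x1 x3 (q x4 x5 w) + T x5 x0 x1 x4 (q
      x2 x3 w) - T x3 x0 x1 x4 (q x2 x5 w) + T x2 x0 x1 x4 (q x3 x5 w) - T x4 x0 x1 x5 (q x2 x3 w)
      + T x3 x0 x1 x5 (q x2 x4 w) - T x2 x0 x1 x5 (q x3 x4 w) + T x5 x0 x2 x3 (q x1 x4 w) - T x4
      x0 x2 x3 (q x1 x5 w) + T x1 x0 x2 x3 (q x4 x5 w) - T x5 x0 x2 x4 (q x1 x3 w) + T x3 x0 x2 x4
      (q x1 x5 w) - T x1 x0 x2 x4 (q x3 x5 w) + T x4 x0 x2 x5 (q x1 x3 w) - T x3 x0 x2 x5 (q x1 x4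
      w) + T x1 x0 x2 x5 (q x3 x4 w) + T x5 x0 x3 x4 (q x1 x2 w) - T x2 x0 x3 x4 (q x1 x5 w) + T
      x1 x0 x3 x4 (q x2 x5 w) - T x4 x0 x3 x5 (q x1 x2 w) + T x2 x0 x3 x5 (q x1 x4 w) - T x1 x0 x3
      x5 (q x2 x4 w) + T x3 x0 x4 x5 (q x1 x2 w) - T x2 x0 x4 x5 (q x1 x3 w) + T x1 x0 x4 x5 (q x2
      x3 w) - T x5 x1 x2 x3 (q x0 x4 w) + T x4 x1 x2 x3 (q x0 x5 w) - T x0 x1 x2 x3 (q x4 x5 w) +
      T x5 x1 x2 x4 (q x0 x3 w) - T x3 x1 x2 x4 (q x0 x5 w) + T x0 x1 x2 x4 (q x3 x5 w) - T x4 x1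
      x2 x5 (q x0 x3 w) + T x3 x1 x2 x5 (q x0 x4 w) - T x0 x1 x2 x5 (q x3 x4 w) - T x5 x1 x3 x4 (q
      x0 x2 w) + T x2 x1 x3 x4 (q x0 x5 w) - T x0 x1 x3 x4 (q x2 x5 w) + T x4 x1 x3 x5 (q x0 x2 w)
      - T x2 x1 x3 x5 (q x0 x4 w) + T x0 x1 x3 x5 (q x2 x4 w) - T x3 x1 x4 x5 (q x0 x2 w) + T x2
      x1 x4 x5 (q x0 x3 w) - T x0 x1 x4 x5 (q x2 x3 w) + T x5 x2 x3 x4 (q x0 x1 w) - T x1 x2 x3 x4
      (q x0 x5 w) + T x0 x2 x3 x4 (q x1 x5 w) - T x4 x2 x3 x5 (q x0 x1 w) + T x1 x2 x3 x5 (q x0 x4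
      w) - T x0 x2 x3 x5 (q x1 x4 w) + T x3 x2 x4 x5 (q x0 x1 w) - T x1 x2 x4 x5 (q x0 x3 w) + T
      x0 x2 x4 x5 (q x1 x3 w) - T x2 x3 x4 x5 (q x0 x1 w) + T x1 x3 x4 x5 (q x0 x2 w) - T x0 x3 x4
      x5 (q x1 x2 w))"
    unfolding u[symmetric] by (rule alt_sum_3_2_1[of "\<lambda>a b c d e f. T f a b c (q d e w)"])
      ((rule T_swap)+, metis q_swap T_add(4))
  ultimately show ?thesis
    using torsion_eq[of w u] by simp
qed

context
  notes [simp] = cross_E T_add T_sort q_sort T_repeated T_E_0 T_E_exchange
begin

text \<open>The equation indexed by \<open>(d, b)\<close> has \<open>w = E b\<close> and the six basis vectors other than \<open>E d\<close> and
  \<open>E b\<close> as arguments.  By the grading it involves only the components of \<open>T (E n)\<close> of index sum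
  \<open>n + d\<close>; for fixed \<open>d\<close> this gives seven equations in seven unknowns, and up to signs and a common factor their
  matrix is \<open>I + J\<close> with \<open>J\<close> the all-ones matrix, hence invertible.\<close>

lemmas shuffle_eqs_0 =
  shuffle_eq[of "E 2" "E 3" "E 4" "E 5" "E 6" "E 7" "E 1", simplified]
  shuffle_eq[of "E 1" "E 3" "E 4" "E 5" "E 6" "E 7" "E 2", simplified]
  shuffle_eq[of "E 1" "E 2" "E 4" "E 5" "E 6" "E 7" "E 3", simplified]
  shuffle_eq[of "E 1" "E 2" "E 3" "E 5" "E 6" "E 7" "E 4", simplified]
  shuffle_eq[of "E 1" "E 2" "E 3" "E 4" "E 6" "E 7" "E 5", simplified]
  shuffle_eq[of "E 1" "E 2" "E 3" "E 4" "E 5" "E 7" "E 6", simplified]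
  shuffle_eq[of "E 1" "E 2" "E 3" "E 4" "E 5" "E 6" "E 7", simplified]

lemmas shuffle_eqs_1 =
  shuffle_eq[of "E 2" "E 3" "E 4" "E 5" "E 6" "E 7" "E 0", simplified]
  shuffle_eq[of "E 0" "E 3" "E 4" "E 5" "E 6" "E 7" "E 2", simplified]
  shuffle_eq[of "E 0" "E 2" "E 4" "E 5" "E 6" "E 7" "E 3", simplified]
  shuffle_eq[of "E 0" "E 2" "E 3" "E 5" "E 6" "E 7" "E 4", simplified]
  shuffle_eq[of "E 0" "E 2" "E 3" "E 4" "E 6" "E 7" "E 5", simplified]
  shuffle_eq[of "E 0" "E 2" "E 3" "E 4" "E 5" "E 7" "E 6", simplified]
  shuffle_eq[of "E 0" "E 2" "E 3" "E 4" "E 5" "E 6" "E 7", simplified]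

lemmas shuffle_eqs_2 =
  shuffle_eq[of "E 1" "E 3" "E 4" "E 5" "E 6" "E 7" "E 0", simplified]
  shuffle_eq[of "E 0" "E 3" "E 4" "E 5" "E 6" "E 7" "E 1", simplified]
  shuffle_eq[of "E 0" "E 1" "E 4" "E 5" "E 6" "E 7" "E 3", simplified]
  shuffle_eq[of "E 0" "E 1" "E 3" "E 5" "E 6" "E 7" "E 4", simplified]
  shuffle_eq[of "E 0" "E 1" "E 3" "E 4" "E 6" "E 7" "E 5", simplified]
  shuffle_eq[of "E 0" "E 1" "E 3" "E 4" "E 5" "E 7" "E 6", simplified]
  shuffle_eq[of "E 0" "E 1" "E 3" "E 4" "E 5" "E 6" "E 7", simplified]

lemmas shuffle_eqs_3 =
  shuffle_eq[of "E 1" "E 2" "E 4" "E 5" "E 6" "E 7" "E 0", simplified]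
  shuffle_eq[of "E 0" "E 2" "E 4" "E 5" "E 6" "E 7" "E 1", simplified]
  shuffle_eq[of "E 0" "E 1" "E 4" "E 5" "E 6" "E 7" "E 2", simplified]
  shuffle_eq[of "E 0" "E 1" "E 2" "E 5" "E 6" "E 7" "E 4", simplified]
  shuffle_eq[of "E 0" "E 1" "E 2" "E 4" "E 6" "E 7" "E 5", simplified]
  shuffle_eq[of "E 0" "E 1" "E 2" "E 4" "E 5" "E 7" "E 6", simplified]
  shuffle_eq[of "E 0" "E 1" "E 2" "E 4" "E 5" "E 6" "E 7", simplified]

lemmas shuffle_eqs_4 =
  shuffle_eq[of "E 1" "E 2" "E 3" "E 5" "E 6" "E 7" "E 0", simplified]
  shuffle_eq[of "E 0" "E 2" "E 3" "E 5" "E 6" "E 7" "E 1", simplified]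
  shuffle_eq[of "E 0" "E 1" "E 3" "E 5" "E 6" "E 7" "E 2", simplified]
  shuffle_eq[of "E 0" "E 1" "E 2" "E 5" "E 6" "E 7" "E 3", simplified]
  shuffle_eq[of "E 0" "E 1" "E 2" "E 3" "E 6" "E 7" "E 5", simplified]
  shuffle_eq[of "E 0" "E 1" "E 2" "E 3" "E 5" "E 7" "E 6", simplified]
  shuffle_eq[of "E 0" "E 1" "E 2" "E 3" "E 5" "E 6" "E 7", simplified]

lemmas shuffle_eqs_5 =
  shuffle_eq[of "E 1" "E 2" "E 3" "E 4" "E 6" "E 7" "E 0", simplified]
  shuffle_eq[of "E 0" "E 2" "E 3" "E 4" "E 6" "E 7" "E 1", simplified]
  shuffle_eq[of "E 0" "E 1" "E 3" "E 4" "E 6" "E 7" "E 2", simplified]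
  shuffle_eq[of "E 0" "E 1" "E 2" "E 4" "E 6" "E 7" "E 3", simplified]
  shuffle_eq[of "E 0" "E 1" "E 2" "E 3" "E 6" "E 7" "E 4", simplified]
  shuffle_eq[of "E 0" "E 1" "E 2" "E 3" "E 4" "E 7" "E 6", simplified]
  shuffle_eq[of "E 0" "E 1" "E 2" "E 3" "E 4" "E 6" "E 7", simplified]

lemmas shuffle_eqs_6 =
  shuffle_eq[of "E 1" "E 2" "E 3" "E 4" "E 5" "E 7" "E 0", simplified]
  shuffle_eq[of "E 0" "E 2" "E 3" "E 4" "E 5" "E 7" "E 1", simplified]
  shuffle_eq[of "E 0" "E 1" "E 3" "E 4" "E 5" "E 7" "E 2", simplified]
  shuffle_eq[of "E 0" "E 1" "E 2" "E 4" "E 5" "E 7" "E 3", simplified]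
  shuffle_eq[of "E 0" "E 1" "E 2" "E 3" "E 5" "E 7" "E 4", simplified]
  shuffle_eq[of "E 0" "E 1" "E 2" "E 3" "E 4" "E 7" "E 5", simplified]
  shuffle_eq[of "E 0" "E 1" "E 2" "E 3" "E 4" "E 5" "E 7", simplified]

lemmas shuffle_eqs_7 =
  shuffle_eq[of "E 1" "E 2" "E 3" "E 4" "E 5" "E 6" "E 0", simplified]
  shuffle_eq[of "E 0" "E 2" "E 3" "E 4" "E 5" "E 6" "E 1", simplified]
  shuffle_eq[of "E 0" "E 1" "E 3" "E 4" "E 5" "E 6" "E 2", simplified]
  shuffle_eq[of "E 0" "E 1" "E 2" "E 4" "E 5" "E 6" "E 3", simplified]
  shuffle_eq[of "E 0" "E 1" "E 2" "E 3" "E 5" "E 6" "E 4", simplified]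
  shuffle_eq[of "E 0" "E 1" "E 2" "E 3" "E 4" "E 6" "E 5", simplified]
  shuffle_eq[of "E 0" "E 1" "E 2" "E 3" "E 4" "E 5" "E 6", simplified]

text \<open>In the block with omitted index d, the representative paired with \<open>T (E n)\<close>
  is the one of index sum n + d. Sum 0 is excluded because those components vanish already, hence n
  runs over the seven indices other than d.\<close>

lemma T_root_0:
    "T (E 1) (E 0) (E 2) (E 4) (E 7) = 0"
    "T (E 2) (E 0) (E 1) (E 4) (E 7) = 0"
    "T (E 3) (E 0) (E 1) (E 4) (E 6) = 0"
    "T (E 4) (E 0) (E 1) (E 2) (E 7) = 0"
    "T (E 5) (E 0) (E 1) (E 2) (E 6) = 0"
    "T (E 6) (E 0) (E 1) (E 2) (E 5) = 0"
    "T (E 7) (E 0) (E 1) (E 2) (E 4) = 0"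
  using shuffle_eqs_0 by linarith+

lemma T_root_1:
    "T (E 0) (E 0) (E 2) (E 4) (E 7) = 0"
    "T (E 2) (E 0) (E 1) (E 4) (E 6) = 0"
    "T (E 3) (E 0) (E 1) (E 4) (E 7) = 0"
    "T (E 4) (E 0) (E 1) (E 2) (E 6) = 0"
    "T (E 5) (E 0) (E 1) (E 2) (E 7) = 0"
    "T (E 6) (E 0) (E 1) (E 2) (E 4) = 0"
    "T (E 7) (E 0) (E 1) (E 2) (E 5) = 0"
  using shuffle_eqs_1 by linarith+

lemma T_root_2:
    "T (E 0) (E 0) (E 1) (E 4) (E 7) = 0"
    "T (E 1) (E 0) (E 1) (E 4) (E 6) = 0"
    "T (E 3) (E 0) (E 2) (E 4) (E 7) = 0"
    "T (E 4) (E 0) (E 1) (E 2) (E 5) = 0"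
    "T (E 5) (E 0) (E 1) (E 2) (E 4) = 0"
    "T (E 6) (E 0) (E 1) (E 2) (E 7) = 0"
    "T (E 7) (E 0) (E 1) (E 2) (E 6) = 0"
  using shuffle_eqs_2 by linarith+

lemma T_root_3:
    "T (E 0) (E 0) (E 1) (E 4) (E 6) = 0"
    "T (E 1) (E 0) (E 1) (E 4) (E 7) = 0"
    "T (E 2) (E 0) (E 2) (E 4) (E 7) = 0"
    "T (E 4) (E 0) (E 1) (E 2) (E 4) = 0"
    "T (E 5) (E 0) (E 1) (E 2) (E 5) = 0"
    "T (E 6) (E 0) (E 1) (E 2) (E 6) = 0"
    "T (E 7) (E 0) (E 1) (E 2) (E 7) = 0"
  using shuffle_eqs_3 by linarith+

lemma T_root_4:
    "T (E 0) (E 0) (E 1) (E 2) (E 7) = 0"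
    "T (E 1) (E 0) (E 1) (E 2) (E 6) = 0"
    "T (E 2) (E 0) (E 1) (E 2) (E 5) = 0"
    "T (E 3) (E 0) (E 1) (E 2) (E 4) = 0"
    "T (E 5) (E 0) (E 2) (E 4) (E 7) = 0"
    "T (E 6) (E 0) (E 1) (E 4) (E 7) = 0"
    "T (E 7) (E 0) (E 1) (E 4) (E 6) = 0"
  using shuffle_eqs_4 by linarith+

lemma T_root_5:
    "T (E 0) (E 0) (E 1) (E 2) (E 6) = 0"
    "T (E 1) (E 0) (E 1) (E 2) (E 7) = 0"
    "T (E 2) (E 0) (E 1) (E 2) (E 4) = 0"
    "T (E 3) (E 0) (E 1) (E 2) (E 5) = 0"
    "T (E 4) (E 0) (E 2) (E 4) (E 7) = 0"
    "T (E 6) (E 0) (E 1) (E 4) (E 6) = 0"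
    "T (E 7) (E 0) (E 1) (E 4) (E 7) = 0"
  using shuffle_eqs_5 by linarith+

lemma T_root_6:
    "T (E 0) (E 0) (E 1) (E 2) (E 5) = 0"
    "T (E 1) (E 0) (E 1) (E 2) (E 4) = 0"
    "T (E 2) (E 0) (E 1) (E 2) (E 7) = 0"
    "T (E 3) (E 0) (E 1) (E 2) (E 6) = 0"
    "T (E 4) (E 0) (E 1) (E 4) (E 7) = 0"
    "T (E 5) (E 0) (E 1) (E 4) (E 6) = 0"
    "T (E 7) (E 0) (E 2) (E 4) (E 7) = 0"
  using shuffle_eqs_6 by linarith+

lemma T_root_7:
    "T (E 0) (E 0) (E 1) (E 2) (E 4) = 0"
    "T (E 1) (E 0) (E 1) (E 2) (E 5) = 0"
    "T (E 2) (E 0) (E 1) (E 2) (E 6) = 0"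
    "T (E 3) (E 0) (E 1) (E 2) (E 7) = 0"
    "T (E 4) (E 0) (E 1) (E 4) (E 6) = 0"
    "T (E 5) (E 0) (E 1) (E 4) (E 7) = 0"
    "T (E 6) (E 0) (E 2) (E 4) (E 7) = 0"
  using shuffle_eqs_7 by linarith+

lemmas T_root = T_root_0 T_root_1 T_root_2 T_root_3 T_root_4 T_root_5 T_root_6 T_root_7

end

section \<open>From the representatives to all components and all vectors\<close>

lemma T_E_eq_0_sorted:
  assumes "n < 8" "d < 8" "a < b" "b < c" "c < d"
  shows "T (E n) (E a) (E b) (E c) (E d) = 0"
proof -
  have n: "n \<in> {0, 1, 2, 3, 4, 5, 6, 7}"
    using assms(1) by auto
  have root: "T (E n) (E 0) (E 1) (E 2) (E 4) = 0"
      "T (E n) (E 0) (E 1) (E 2) (E 5) = 0"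
      "T (E n) (E 0) (E 1) (E 2) (E 6) = 0"
      "T (E n) (E 0) (E 1) (E 2) (E 7) = 0"
      "T (E n) (E 0) (E 1) (E 4) (E 6) = 0"
      "T (E n) (E 0) (E 1) (E 4) (E 7) = 0"
      "T (E n) (E 0) (E 2) (E 4) (E 7) = 0"
    using n by (elim insertE emptyE; simp add: T_root)+
  \<comment> \<open>Peels the largest value off a bounded quantifier, so that the next claim unfolds
    into the 70 increasing quadruples.\<close>
  have all_less: "(\<forall>i<numeral k. Q i) \<longleftrightarrow> (\<forall>i<pred_numeral k. Q i) \<and> Q (pred_numeral k)" for k and Q :: "nat \<Rightarrow> bool"
    by (metis less_Suc_eq numeral_eq_Suc)
  have "\<forall>d<8. \<forall>c<d. \<forall>b<c. \<forall>a<b. T (E n) (E a) (E b) (E c) (E d) = 0"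
    by (simp add: all_less T_E_0 T_E_exchange root)
  then show ?thesis
    using assms by blast
qed

lemma T_E_eq_0:
  assumes "n < 8" "a < 8" "b < 8" "c < 8" "d < 8"
  shows "T (E n) (E a) (E b) (E c) (E d) = 0"
  by (rule alternating_4_eq_0[of "\<lambda>a b c d. T (E n) (E a) (E b) (E c) (E d)" 8])
    (rule T_swap assms T_E_eq_0_sorted[OF assms(1)] | assumption)+

lemma linear_eq_0_E:
  fixes f :: "'v \<Rightarrow> real"
  assumes "linear f" "\<And>i. i < 8 \<Longrightarrow> f (E i) = 0"
  shows "f x = 0"
proof -
  have "f x = f (\<Sum>i<8. g x (E i) *\<^sub>R E i)"
    by (rule arg_cong[OF E_span])
  also have "\<dots> = 0"
    by (simp add: linear_sum[OF assms(1)] linear_scale[OF assms(1)] assms(2))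
  finally show ?thesis .
qed

text \<open>Linearity is available in the direction and in the first argument of the form. The other
  arguments are freed one at a time by swapping them into the first place.\<close>

theorem T_eq_0: "T v x y z w = 0"
proof (rule linear_eq_0_E[OF T_linear_fst])
  fix n :: nat assume n: "n < 8"
  have 1: "T (E n) x (E b) (E c) (E d) = 0" if "b < 8" "c < 8" "d < 8" for x b c d
    by (rule linear_eq_0_E[OF T_linear]) (rule T_E_eq_0[OF n _ that])
  have 2: "T (E n) x y (E c) (E d) = 0" if "c < 8" "d < 8" for x y c d
  proof (rule linear_eq_0_E[OF T_linear])
    fix i :: nat assume "i < 8"
    then show "T (E n) (E i) y (E c) (E d) = 0"
      using that 1[of i c d y] by (subst T_swap(1)) simp
  qed
  have 3: "T (E n) x y z (E d) = 0" if "d < 8" for x y z d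
  proof (rule linear_eq_0_E[OF T_linear])
    fix i :: nat assume "i < 8"
    then show "T (E n) (E i) y z (E d) = 0"
      using that 2[of i d y z] by (subst T_swap(1), subst T_swap(2)) simp
  qed
  show "T (E n) x y z w = 0"
  proof (rule linear_eq_0_E[OF T_linear])
    fix i :: nat assume "i < 8"
    then show "T (E n) (E i) y z w = 0"
      using 3[of i y z w] T_rot[of "E n" y z w "E i"] by simp
  qed
qed

end
end

section \<open>The bracket as an alternating sum\<close>

lemma alt_sum_swap_eq:
  assumes "i < n" "j < n" "i \<noteq> j" and "\<And>u. h' (u \<circ> Transposition.transpose i j) = - h u"
  shows "alt_sum n h' u = alt_sum n h u"
  using alt_sum_transpose[OF assms(1-3), of h' u] by (simp add: assms(4) alt_sum_minus)

text \<open>The bracket may be computed with any torsion-free connection in place of the coordinate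
  derivative: the terms in which \<open>\<Gamma>\<close> meets two of the arguments, or two values of \<open>q\<close>, cancel by the symmetry
  of \<open>\<Gamma>\<close>, and the others cancel between the two sums.\<close>

lemma alt_sum_connection_terms:
  fixes q :: "'v::real_vector \<Rightarrow> 'v \<Rightarrow> 'v \<Rightarrow> 'v" and \<Gamma> :: "'v \<Rightarrow> 'v \<Rightarrow> 'v"
  assumes q_linear: "\<And>y z. linear (\<lambda>x. q x y z)"
    and q_swap: "\<And>x y z. q y x z = - q x y z" "\<And>x y z. q x z y = - q x y z"
    and \<Gamma>_sym: "\<And>x y. \<Gamma> x y = \<Gamma> y x"
    and r: "\<And>v x y z. r v x y z = D v x y z - \<Gamma> v (q x y z) + q (\<Gamma> v x) y z + q x (\<Gamma> v y) z + q x y (\<Gamma> v z)"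
  shows "alt_sum 6 (\<lambda>u. r (q (u 0) (u 1) (u 2)) (u 3) (u 4) (u 5)) u
      + 3 *\<^sub>R alt_sum 6 (\<lambda>u. q (r (u 5) (u 0) (u 1) (u 2)) (u 3) (u 4)) u
    = alt_sum 6 (\<lambda>u. D (q (u 0) (u 1) (u 2)) (u 3) (u 4) (u 5)) u
      + 3 *\<^sub>R alt_sum 6 (\<lambda>u. q (D (u 5) (u 0) (u 1) (u 2)) (u 3) (u 4)) u"
proof -
  define h where "h u = q (\<Gamma> (q (u 0) (u 1) (u 2)) (u 3)) (u 4) (u 5)" for u :: "nat \<Rightarrow> 'v"
  have q_add: "q (x + x') y z = q x y z + q x' y z" "q (x - x') y z = q x y z - q x' y z" for x x' y z
    using linear_add[OF q_linear] linear_diff[OF q_linear] by blast+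
  have scaleR_3: "3 *\<^sub>R x = x + x + x" for x :: 'v
    using scaleR_add_left[of 2 1 x] by (simp add: scaleR_2)
  \<comment> \<open>The facts \<open>h3\<close>, \<open>h4\<close>, \<open>h5\<close> concern the
    three terms of the first sum in which \<open>\<Gamma>\<close> acts on an argument of the outer
    \<open>q\<close>; \<open>h6\<close> concerns the one term of the second sum that comes with
    factor -3. All four equal the same sum.\<close>
  have h3: "alt_sum 6 (\<lambda>u. q (\<Gamma> (q (u 0) (u 1) (u 2)) (u 3)) (u 4) (u 5)) u = alt_sum 6 h u"
    unfolding h_def[abs_def] by (rule refl)
  have h4: "alt_sum 6 (\<lambda>u. q (u 3) (\<Gamma> (q (u 0) (u 1) (u 2)) (u 4)) (u 5)) u = alt_sum 6 h u"
    by (rule alt_sum_swap_eq[where i = 3 and j = 4])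
      (simp_all add: h_def Transposition.transpose_def, rule q_swap(1))
  have h5: "alt_sum 6 (\<lambda>u. q (u 3) (u 4) (\<Gamma> (q (u 0) (u 1) (u 2)) (u 5))) u = alt_sum 6 h u"
  proof -
    have "alt_sum 6 (\<lambda>u. q (u 3) (u 4) (\<Gamma> (q (u 0) (u 1) (u 2)) (u 5))) u
       = alt_sum 6 (\<lambda>u. q (u 3) (\<Gamma> (q (u 0) (u 1) (u 2)) (u 4)) (u 5)) u"
      by (rule alt_sum_swap_eq[where i = 4 and j = 5])
        (simp_all add: Transposition.transpose_def, rule q_swap(2))
    then show ?thesis
      by (simp only: h4)
  qed
  have h6: "alt_sum 6 (\<lambda>u. q (\<Gamma> (u 5) (q (u 0) (u 1) (u 2))) (u 3) (u 4)) u = alt_sum 6 h u"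
    by (rule alt_sum_swap_eq[where i = 3 and j = 5])
      (simp_all add: h_def Transposition.transpose_def, subst \<Gamma>_sym, rule q_swap(2))
  have 0: "alt_sum 6 (\<lambda>u. q (q (\<Gamma> (u 5) (u 0)) (u 1) (u 2)) (u 3) (u 4)) u = 0"
    "alt_sum 6 (\<lambda>u. q (q (u 0) (\<Gamma> (u 5) (u 1)) (u 2)) (u 3) (u 4)) u = 0"
    "alt_sum 6 (\<lambda>u. q (q (u 0) (u 1) (\<Gamma> (u 5) (u 2))) (u 3) (u 4)) u = 0"
    by (rule alt_sum_eq_0[where i = 5 and j = 0] alt_sum_eq_0[where i = 5 and j = 1] alt_sum_eq_0[where i = 5 and j = 2];
        simp add: Transposition.transpose_def \<Gamma>_sym)+
  \<comment> \<open>Exchanging the two blocks of three arguments is a product of three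
    transpositions, hence odd, while symmetry of \<open>\<Gamma>\<close> leaves the term
    unchanged.\<close>
  have 1: "alt_sum 6 (\<lambda>u. \<Gamma> (q (u 0) (u 1) (u 2)) (q (u 3) (u 4) (u 5))) u = 0"
  proof -
    let ?k = "\<lambda>u. \<Gamma> (q (u 0) (u 1) (u 2)) (q (u 3) (u 4) (u 5))"
    have "alt_sum 6 ?k u = - alt_sum 6 (\<lambda>u. \<Gamma> (q (u 3) (u 1) (u 2)) (q (u 0) (u 4) (u 5))) u"
      using alt_sum_transpose[of 0 6 3 ?k u] by (simp add: Transposition.transpose_def)
    also have "\<dots> = alt_sum 6 (\<lambda>u. \<Gamma> (q (u 3) (u 4) (u 2)) (q (u 0) (u 1) (u 5))) u"
      using alt_sum_transpose[of 1 6 4 "\<lambda>u. \<Gamma> (q (u 3) (u 1) (u 2)) (q (u 0) (u 4) (u 5))" u]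
      by (simp add: Transposition.transpose_def)
    also have "\<dots> = - alt_sum 6 (\<lambda>u. \<Gamma> (q (u 3) (u 4) (u 5)) (q (u 0) (u 1) (u 2))) u"
      using alt_sum_transpose[of 2 6 5 "\<lambda>u. \<Gamma> (q (u 3) (u 4) (u 2)) (q (u 0) (u 1) (u 5))" u]
      by (simp add: Transposition.transpose_def)
    also have "\<dots> = - alt_sum 6 ?k u"
      by (subst \<Gamma>_sym) (rule refl)
    finally show ?thesis
      by (rule eq_minus_self)
  qed
  show ?thesis
    unfolding r q_add alt_sum_add alt_sum_diff h3 h4 h5 h6 0 1
    by (simp add: scaleR_3 algebra_simps)
qed

lemma alt_sum_nth: "alt_sum n h u $ m = alt_sum n (\<lambda>u. h u $ m) u"
  by (simp add: alt_sum_def)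

lemma sum_scaleR_axis: "(\<Sum>j\<in>UNIV. c j *\<^sub>R axis j (1::real)) $ m = c m" for c :: "'n::finite \<Rightarrow> real"
  by (simp add: axis_def if_distrib cong: if_cong)

text \<open>Reassembles a vector-valued form from its components. The sum that remains has the shape
  of \<open>sum_nth_scaleR_linear\<close>: when \<open>b\<close> comes from a linear map evaluated
  at the basis vectors, it inserts the vector \<open>a\<close> into that map.\<close>

lemma sum_wedge_vec:
  fixes a :: "(real^'n) list \<Rightarrow> real^'n" and b :: "'n::finite \<Rightarrow> (real^'n) list \<Rightarrow> real^'n"
  shows "(\<Sum>i\<in>UNIV. \<Sum>j\<in>UNIV. wedge k l (\<lambda>ws. a ws $ i) (\<lambda>ws. b i ws $ j) vs *\<^sub>R axis j 1)
    = (1 / (fact k * fact l)) *\<^sub>R alt_sum (k + l)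
        (\<lambda>u. \<Sum>i\<in>UNIV. a (map u [0..<k]) $ i *\<^sub>R b i (map u [k..<k + l])) ((!) vs)" (is "?l = ?r")
    and "(\<Sum>i\<in>UNIV. \<Sum>j\<in>UNIV. wedge k l (\<lambda>ws. b j ws $ i) (\<lambda>ws. a ws $ j) vs *\<^sub>R axis i 1)
    = (1 / (fact k * fact l)) *\<^sub>R alt_sum (k + l)
        (\<lambda>u. \<Sum>j\<in>UNIV. a (map u [k..<k + l]) $ j *\<^sub>R b j (map u [0..<k])) ((!) vs)" (is "?l' = ?r'")
proof -
  have "?l $ m = ?r $ m" for m
    unfolding sum_component sum_scaleR_axis[unfolded sum_component]
    by (simp add: wedge_alt_sum alt_sum_nth alt_sum_sum flip: sum_divide_distrib)
  then show "?l = ?r"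
    by (simp add: vec_eq_iff)
  have swap: "?l' = (\<Sum>j\<in>UNIV. \<Sum>i\<in>UNIV. wedge k l (\<lambda>ws. b j ws $ i) (\<lambda>ws. a ws $ j) vs *\<^sub>R axis i 1)"
    by (rule sum.swap)
  have "?l' $ m = ?r' $ m" for m
    unfolding swap sum_component sum_scaleR_axis[unfolded sum_component]
    by (simp add: wedge_alt_sum alt_sum_nth alt_sum_sum mult.commute flip: sum_divide_distrib)
  then show "?l' = ?r'"
    by (simp add: vec_eq_iff)
qed

text \<open>The formula of \<open>ext_deriv\<close> with the derivative kept abstract:
  \<open>R v ws\<close> stands for the derivative in direction \<open>v\<close> of the coefficient
  at \<open>ws\<close>.\<close>

definition alt_deriv :: "('v \<Rightarrow> 'v list \<Rightarrow> 'r::real_vector) \<Rightarrow> 'v list \<Rightarrow> 'r" where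
  "alt_deriv R ws = (\<Sum>i<length ws. (-1) ^ i *\<^sub>R R (ws ! i) (take i ws @ drop (Suc i) ws))"

lemma alt_deriv_4: "alt_deriv R [a, b, c, d] = R a [b, c, d] - R b [a, c, d] + R c [a, b, d] - R d [a, b, c]"
  by (simp add: alt_deriv_def eval_nat_numeral)

text \<open>After renaming arguments, each of the four terms of the exterior derivative contributes
  the same amount. The sign is -1 because the direction is put after the other three
  arguments.\<close>

lemma alt_sum_alt_deriv:
  fixes Q :: "'v::real_vector list \<Rightarrow> 'v" and R :: "'v \<Rightarrow> 'v list \<Rightarrow> 'v"
  assumes Q_linear: "\<And>y z. linear (\<lambda>x. Q [x, y, z])"
    and R_swap: "\<And>v x y z. R v [y, x, z] = - R v [x, y, z]" "\<And>v x y z. R v [x, z, y] = - R v [x, y, z]"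
    and "distinct [a, b, c, d, e, f]" "a < n" "b < n" "c < n" "d < n" "e < n" "f < n"
  shows "alt_sum n (\<lambda>u. Q [alt_deriv R [u a, u b, u c, u d], u e, u f]) u
    = - 4 *\<^sub>R alt_sum n (\<lambda>u. Q [R (u d) [u a, u b, u c], u e, u f]) u"
proof -
  let ?h = "\<lambda>u. Q [R (u d) [u a, u b, u c], u e, u f]"
  have Q: "Q [x + y, v, w] = Q [x, v, w] + Q [y, v, w]" "Q [x - y, v, w] = Q [x, v, w] - Q [y, v, w]" 
    "Q [- x, v, w] = - Q [x, v, w]" for x y v w
    using linear_add[OF Q_linear] linear_diff[OF Q_linear] linear_neg[OF Q_linear] by blast+
  have neq: "a \<noteq> b" "a \<noteq> c" "a \<noteq> d" "a \<noteq> e" "a \<noteq> f" "b \<noteq> c" "b \<noteq> d" "b \<noteq> e" "b \<noteq> f" "c \<noteq> d" "c \<noteq> e" "c \<noteq> f"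
    "d \<noteq> e" "d \<noteq> f" "e \<noteq> f"
    using assms(4) by auto
  note [simp] = Transposition.transpose_def neq neq[symmetric] assms(5-)
  have "alt_sum n (\<lambda>u. Q [R (u c) [u a, u b, u d], u e, u f]) u = - alt_sum n ?h u"
    using alt_sum_transpose[of c n d ?h u] by simp
  moreover have "alt_sum n (\<lambda>u. Q [R (u b) [u a, u c, u d], u e, u f]) u = alt_sum n ?h u"
    by (rule alt_sum_swap_eq[where i = b and j = d]) (simp_all flip: Q(3) R_swap(2))
  moreover have "alt_sum n (\<lambda>u. Q [R (u a) [u b, u c, u d], u e, u f]) u = - alt_sum n ?h u"
  proof -
    have "R x [y, v, w] = R x [v, w, y]" for x y v w
      by (metis R_swap add.inverse_inverse)
    then have "R (u a) [u d, u b, u c] = R (u a) [u b, u c, u d]" for u :: "nat \<Rightarrow> 'v"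
      by blast
    then show ?thesis
      using alt_sum_transpose[of a n d ?h u] by simp
  qed
  moreover have "(4::real) = 1 + 1 + 1 + 1"
    by simp
  ultimately show ?thesis
    by (simp only: alt_deriv_4 Q alt_sum_add alt_sum_diff scaleR_minus_left scaleR_add_left scaleR_one) simp
qed

lemma sum_nth_scaleR_linear:
  fixes f :: "real^'n::finite \<Rightarrow> 'b::real_vector"
  assumes "linear f"
  shows "(\<Sum>i\<in>UNIV. x $ i *\<^sub>R f (axis i 1)) = f x"
proof -
  have "f x = f (\<Sum>i\<in>UNIV. x $ i *\<^sub>R axis i 1)"
    by (simp add: basis_expansion flip: scalar_mult_eq_scaleR)
  then show ?thesis
    by (simp add: linear_sum[OF assms] linear_scale[OF assms])
qed

text \<open>Origin of the constants: each of the two Lie derivative terms gives 1 / (3! 3!) = 1/36,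
  together 1/18. Each of the two exterior derivative terms gives -4 / (4! 2!) = -1/12, and the sign
  (-1)^3 of the bracket turns them into 1/6 = 3/18.\<close>

lemma bracket_alt_sum:
  fixes Q :: "(real^'n::finite) list \<Rightarrow> real^'n" and R :: "real^'n \<Rightarrow> (real^'n) list \<Rightarrow> real^'n"
  assumes Q_linear: "\<And>y z. linear (\<lambda>x. Q [x, y, z])" and R_linear: "\<And>ws. linear (\<lambda>v. R v ws)"
    and Q_swap: "\<And>x y z. Q [y, x, z] = - Q [x, y, z]" "\<And>x y z. Q [x, z, y] = - Q [x, y, z]"
    and R_swap: "\<And>v x y z. R v [y, x, z] = - R v [x, y, z]" "\<And>v x y z. R v [x, z, y] = - R v [x, y, z]"
  shows "(\<Sum>i\<in>UNIV. \<Sum>j\<in>UNIV.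
        wedge 3 3 (\<lambda>ws. Q ws $ i) (\<lambda>ws. R (axis i 1) ws $ j) vs *\<^sub>R axis j 1
      - wedge 3 3 (\<lambda>ws. R (axis j 1) ws $ i) (\<lambda>ws. Q ws $ j) vs *\<^sub>R axis i 1
      - (wedge 4 2 (\<lambda>ws. alt_deriv R ws $ i) (\<lambda>ws. Q (axis i 1 # ws) $ j) vs *\<^sub>R axis j 1
       + wedge 2 4 (\<lambda>ws. Q (axis j 1 # ws) $ i) (\<lambda>ws. alt_deriv R ws $ j) vs *\<^sub>R axis i 1))
    = (1 / 18) *\<^sub>R (alt_sum 6 (\<lambda>u. R (Q [u 0, u 1, u 2]) [u 3, u 4, u 5]) ((!) vs)
      + 3 *\<^sub>R alt_sum 6 (\<lambda>u. Q [R (u 5) [u 0, u 1, u 2], u 3, u 4]) ((!) vs))"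
proof -
  let ?u = "(!) vs"
  let ?h = "\<lambda>u. R (Q [u 0, u 1, u 2]) [u 3, u 4, u 5]" and ?k = "\<lambda>u. Q [R (u 5) [u 0, u 1, u 2], u 3, u 4]"
  have upt: "[0..<3] = [0, 1, 2]" "[3..<6] = [3, 4, 5]" "[0..<4] = [0, 1, 2, 3]" "[4..<6] = [4, 5]" "[0..<2] = [0, 1]" "[2..<6] = [2, 3, 4, 5]"
    by (simp_all add: upt_rec)
  have fact: "fact 4 = (24::real)" "fact 3 = (6::real)" "fact 2 = (2::real)"
    by (simp_all add: fact_numeral)
  have 1: "(\<Sum>i\<in>UNIV. \<Sum>j\<in>UNIV. wedge 3 3 (\<lambda>ws. Q ws $ i) (\<lambda>ws. R (axis i 1) ws $ j) vs *\<^sub>R axis j 1)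
      = (1 / 36) *\<^sub>R alt_sum 6 ?h ?u"
    unfolding sum_wedge_vec(1)[of 3 3 Q "\<lambda>i. R (axis i 1)"] sum_nth_scaleR_linear[OF R_linear]
    by (simp add: upt fact del: One_nat_def)
  have 2: "(\<Sum>i\<in>UNIV. \<Sum>j\<in>UNIV. wedge 3 3 (\<lambda>ws. R (axis j 1) ws $ i) (\<lambda>ws. Q ws $ j) vs *\<^sub>R axis i 1)
      = - (1 / 36) *\<^sub>R alt_sum 6 ?h ?u"
  proof -
    have "alt_sum 6 (\<lambda>u. R (Q [u 3, u 4, u 5]) [u 0, u 1, u 2]) ?u = - alt_sum 6 ?h ?u"
    proof -
      have "alt_sum 6 ?h ?u = - alt_sum 6 (\<lambda>u. R (Q [u 3, u 1, u 2]) [u 0, u 4, u 5]) ?u"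
        using alt_sum_transpose[of 0 6 3 ?h ?u] by (simp add: Transposition.transpose_def)
      also have "\<dots> = alt_sum 6 (\<lambda>u. R (Q [u 3, u 4, u 2]) [u 0, u 1, u 5]) ?u"
        using alt_sum_transpose[of 1 6 4 "\<lambda>u. R (Q [u 3, u 1, u 2]) [u 0, u 4, u 5]" ?u]
        by (simp add: Transposition.transpose_def)
      also have "\<dots> = - alt_sum 6 (\<lambda>u. R (Q [u 3, u 4, u 5]) [u 0, u 1, u 2]) ?u"
        using alt_sum_transpose[of 2 6 5 "\<lambda>u. R (Q [u 3, u 4, u 2]) [u 0, u 1, u 5]" ?u]
        by (simp add: Transposition.transpose_def)
      finally show ?thesis by (simp only: minus_minus)
    qed
    then show ?thesis
      unfolding sum_wedge_vec(2)[of 3 3 "\<lambda>j. R (axis j 1)" Q] sum_nth_scaleR_linear[OF R_linear]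
      by (simp add: upt fact del: One_nat_def)
  qed
  have 3: "(\<Sum>i\<in>UNIV. \<Sum>j\<in>UNIV. wedge 4 2 (\<lambda>ws. alt_deriv R ws $ i) (\<lambda>ws. Q (axis i 1 # ws) $ j) vs *\<^sub>R axis j 1)
      = - (1 / 12) *\<^sub>R alt_sum 6 ?k ?u"
  proof -
    have "alt_sum 6 (\<lambda>u. Q [R (u 3) [u 0, u 1, u 2], u 4, u 5]) ?u = alt_sum 6 ?k ?u"
      by (rule alt_sum_swap_eq[where i = 3 and j = 5]) (simp_all add: Transposition.transpose_def, rule Q_swap)
    then show ?thesis
      unfolding sum_wedge_vec(1)[of 4 2 "alt_deriv R" "\<lambda>i ws. Q (axis i 1 # ws)"]
      using alt_sum_alt_deriv[of Q R 0 1 2 3 4 5 6 ?u, OF Q_linear R_swap]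
      by (simp add: upt fact sum_nth_scaleR_linear[OF Q_linear] del: One_nat_def)
  qed
  have 4: "(\<Sum>i\<in>UNIV. \<Sum>j\<in>UNIV. wedge 2 4 (\<lambda>ws. Q (axis j 1 # ws) $ i) (\<lambda>ws. alt_deriv R ws $ j) vs *\<^sub>R axis i 1)
      = - (1 / 12) *\<^sub>R alt_sum 6 ?k ?u"
  proof -
    have "alt_sum 6 (\<lambda>u. Q [R (u 5) [u 2, u 3, u 4], u 0, u 1]) ?u = alt_sum 6 ?k ?u"
    proof -
      have "alt_sum 6 ?k ?u = - alt_sum 6 (\<lambda>u. Q [R (u 5) [u 3, u 1, u 2], u 0, u 4]) ?u"
        using alt_sum_transpose[of 0 6 3 ?k ?u] by (simp add: Transposition.transpose_def)
      also have "\<dots> = alt_sum 6 (\<lambda>u. Q [R (u 5) [u 3, u 4, u 2], u 0, u 1]) ?u"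
        using alt_sum_transpose[of 1 6 4 "\<lambda>u. Q [R (u 5) [u 3, u 1, u 2], u 0, u 4]" ?u]
        by (simp add: Transposition.transpose_def)
      also have "R v [x, y, z] = R v [z, x, y]" for v x y z
        by (metis R_swap add.inverse_inverse)
      then have "(\<lambda>u :: nat \<Rightarrow> real^'n. Q [R (u 5) [u 3, u 4, u 2], u 0, u 1])
          = (\<lambda>u. Q [R (u 5) [u 2, u 3, u 4], u 0, u 1])"
        by (intro ext) (metis (no_types))
      finally show ?thesis ..
    qed
    then show ?thesis
      unfolding sum_wedge_vec(2)[of 2 4 "\<lambda>j ws. Q (axis j 1 # ws)" "alt_deriv R"]
      using alt_sum_alt_deriv[of Q R 2 3 4 5 0 1 6 ?u, OF Q_linear R_swap]
      by (simp add: upt fact sum_nth_scaleR_linear[OF Q_linear] del: One_nat_def)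
  qed
  show ?thesis
    unfolding sum_subtractf sum.distrib 1 2 3 4 by (simp add: scaleR_add_right flip: scaleR_add_left)
qed

section \<open>The Spin(7)-form in a frame\<close>

text \<open>The octonion product of \<open>y\<close> with the conjugate of \<open>z\<close>.  Since the octonion norm is
  multiplicative, writing the Spin(7)-form in terms of two such products bounds its comass by \<open>1\<close>.\<close>

definition oct_mult :: "(8 \<Rightarrow> real) \<Rightarrow> (8 \<Rightarrow> real) \<Rightarrow> 8 \<Rightarrow> real" where
  "oct_mult y z k = (
     if k = 0 then y 0 * z 0 + y 1 * z 1 + y 2 * z 2 + y 3 * z 3 + y 4 * z 4 + y 5 * z 5 + y 6 * z 6 + y 7 * z 7 else
     if k = 1 then - y 0 * z 1 + y 1 * z 0 - y 2 * z 3 + y 3 * z 2 - y 4 * z 5 + y 5 * z 4 - y 6 * z 7 + y 7 * z 6 else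
     if k = 2 then - y 0 * z 2 + y 1 * z 3 + y 2 * z 0 - y 3 * z 1 - y 4 * z 6 + y 5 * z 7 + y 6 * z 4 - y 7 * z 5 else
     if k = 3 then - y 0 * z 3 - y 1 * z 2 + y 2 * z 1 + y 3 * z 0 + y 4 * z 7 + y 5 * z 6 - y 6 * z 5 - y 7 * z 4 else
     if k = 4 then - y 0 * z 4 + y 1 * z 5 + y 2 * z 6 - y 3 * z 7 + y 4 * z 0 - y 5 * z 1 - y 6 * z 2 + y 7 * z 3 else
     if k = 5 then - y 0 * z 5 - y 1 * z 4 - y 2 * z 7 - y 3 * z 6 + y 4 * z 1 + y 5 * z 0 + y 6 * z 3 + y 7 * z 2 else
     if k = 6 then - y 0 * z 6 + y 1 * z 7 - y 2 * z 4 + y 3 * z 5 + y 4 * z 2 - y 5 * z 3 + y 6 * z 0 - y 7 * z 1 else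
     - y 0 * z 7 - y 1 * z 6 + y 2 * z 5 + y 3 * z 4 - y 4 * z 3 - y 5 * z 2 + y 6 * z 1 + y 7 * z 0)"

text \<open>The 4 x 4 minor with rows \<open>x\<close>, \<open>y\<close>, \<open>z\<close>,
  \<open>w\<close> and columns \<open>a\<close>, \<open>b\<close>, \<open>c\<close>,
  \<open>d\<close>, in Laplace expansion along the first two rows.\<close>

definition det4 :: "(8 \<Rightarrow> real) \<Rightarrow> (8 \<Rightarrow> real) \<Rightarrow> (8 \<Rightarrow> real) \<Rightarrow> (8 \<Rightarrow> real) \<Rightarrow> 8 \<Rightarrow> 8 \<Rightarrow> 8 \<Rightarrow> 8 \<Rightarrow> real" where
  "det4 x y z w a b c d =
     (x a * y b - x b * y a) * (z c * w d - z d * w c) - (x a * y c - x c * y a) * (z b * w d - z d * w b)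
     + (x a * y d - x d * y a) * (z b * w c - z c * w b) + (x b * y c - x c * y b) * (z a * w d - z d * w a)
     - (x b * y d - x d * y b) * (z a * w c - z c * w a) + (x c * y d - x d * y c) * (z a * w b - z b * w a)"

definition cayley_form :: "(8 \<Rightarrow> real) \<Rightarrow> (8 \<Rightarrow> real) \<Rightarrow> (8 \<Rightarrow> real) \<Rightarrow> (8 \<Rightarrow> real) \<Rightarrow> real" where
  "cayley_form x y z w = (let E = det4 x y z w in
     E 0 1 2 3 + E 0 1 4 5 + E 0 1 6 7 + E 0 2 4 6 - E 0 2 5 7 - E 0 3 4 7 - E 0 3 5 6
     + E 4 5 6 7 + E 2 3 6 7 + E 2 3 4 5 + E 1 3 5 7 - E 1 3 4 6 - E 1 2 5 6 - E 1 2 4 7)"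

lemma UNIV_8: "(UNIV :: 8 set) = {0, 1, 2, 3, 4, 5, 6, 7}"
proof -
  have "card {0, 1, 2, 3, 4, 5, 6, 7 :: 8} = 8"
    by simp
  then show ?thesis
    by (intro card_subset_eq[symmetric]) simp_all
qed

lemma sum_8: "sum f (UNIV :: 8 set) = f 0 + f 1 + f 2 + f 3 + f 4 + f 5 + f 6 + f 7"
  unfolding UNIV_8 by (simp add: add.assoc)

lemmas oct_mult_simps =
  oct_mult_def[of _ _ 0, simplified] oct_mult_def[of _ _ 1, simplified] oct_mult_def[of _ _ 2, simplified]
  oct_mult_def[of _ _ 3, simplified] oct_mult_def[of _ _ 4, simplified] oct_mult_def[of _ _ 5, simplified]
  oct_mult_def[of _ _ 6, simplified] oct_mult_def[of _ _ 7, simplified]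

lemma oct_mult_norm: "(\<Sum>k\<in>UNIV. (oct_mult y z k)\<^sup>2) = (\<Sum>k\<in>UNIV. (y k)\<^sup>2) * (\<Sum>k\<in>UNIV. (z k)\<^sup>2)"
  unfolding sum_8 oct_mult_simps by algebra

text \<open>With z' for the conjugate of z, twice the form is the antisymmetrization in
  \<open>x\<close> and \<open>z\<close> of the inner product of y z' and x w', as for the triple
  cross product of octonions. In coordinates it is a polynomial identity.\<close>

lemma cayley_form_oct_mult:
  "2 * cayley_form x y z w = (\<Sum>k\<in>UNIV. oct_mult y z k * oct_mult x w k) - (\<Sum>k\<in>UNIV. oct_mult y x k * oct_mult z w k)"
  unfolding sum_8 oct_mult_simps cayley_form_def det4_def Let_def by algebra

lemma cayley_form_le:
  "(cayley_form x y z w)\<^sup>2 \<le> (\<Sum>k\<in>UNIV. (x k)\<^sup>2) * (\<Sum>k\<in>UNIV. (y k)\<^sup>2) * (\<Sum>k\<in>UNIV. (z k)\<^sup>2) * (\<Sum>k\<in>UNIV. (w k)\<^sup>2)"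
  (is "_ \<le> ?K")
proof -
  let ?a = "\<Sum>k\<in>UNIV. oct_mult y z k * oct_mult x w k" and ?b = "\<Sum>k\<in>UNIV. oct_mult y x k * oct_mult z w k"
  have cs: "(\<Sum>k\<in>UNIV. f k * g k)\<^sup>2 \<le> (\<Sum>k\<in>UNIV. (f k)\<^sup>2) * (\<Sum>k\<in>UNIV. (g k)\<^sup>2)" for f g :: "8 \<Rightarrow> real"
    by (rule Cauchy_Schwarz_ineq_sum)
  have "?a\<^sup>2 \<le> ?K" "?b\<^sup>2 \<le> ?K"
    using cs[of "oct_mult y z" "oct_mult x w"] cs[of "oct_mult y x" "oct_mult z w"]
    by (simp_all add: oct_mult_norm mult_ac)
  \<comment> \<open>The bound (a - b)^2 <= 2 a^2 + 2 b^2 <= 4 K loses nothing here: the 4 is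
    absorbed by the factor 2 on the left.\<close>
  moreover have "(2 * cayley_form x y z w)\<^sup>2 \<le> 2 * ?a\<^sup>2 + 2 * ?b\<^sup>2"
    using sum_squares_bound[of ?a "- ?b"] unfolding cayley_form_oct_mult by (simp add: power2_diff)
  ultimately show ?thesis
    by (simp add: power_mult_distrib)
qed

text \<open>The normalization 1 / (k! l!) in \<open>wedge\<close> yields the determinant convention,
  in which a product of dual covectors has value 1 on its own basis vectors.\<close>

lemma wedge_list_4:
  "wedge_list (map \<theta> [a, b, c, d]) [x, y, z, w] = det4 (\<lambda>\<mu>. \<theta> \<mu> x) (\<lambda>\<mu>. \<theta> \<mu> y) (\<lambda>\<mu>. \<theta> \<mu> z) (\<lambda>\<mu>. \<theta> \<mu> w) a b c d"
proof -
  have 1: "wedge_list [\<theta> d] [w] = \<theta> d w" for w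
    by (simp add: wedge_alt_sum alt_sum_Suc)
  have 2: "wedge_list [\<theta> c, \<theta> d] [z, w] = \<theta> c z * \<theta> d w - \<theta> c w * \<theta> d z" for z w
    by (simp add: wedge_alt_sum alt_sum_Suc)
  have 3: "wedge_list [\<theta> b, \<theta> c, \<theta> d] [y, z, w] =
      \<theta> b y * (\<theta> c z * \<theta> d w - \<theta> c w * \<theta> d z) - \<theta> b z * (\<theta> c y * \<theta> d w - \<theta> c w * \<theta> d y)
      + \<theta> b w * (\<theta> c y * \<theta> d z - \<theta> c z * \<theta> d y)" for y z w
    unfolding wedge_list.simps(2)[of "\<theta> b"] wedge_alt_sum
    by (simp add: 2 alt_sum_Suc upt_rec Transposition.transpose_def eval_nat_numeral field_simps del: wedge_list.simps)
  show ?thesis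
    unfolding list.map wedge_list.simps(2)[of "\<theta> a"] wedge_alt_sum
    by (simp add: 3 alt_sum_Suc upt_rec Transposition.transpose_def eval_nat_numeral det4_def del: wedge_list.simps) algebra
qed

text \<open>The dual basis is a definite description, so existence and uniqueness are both due. The
  witness \<open>\<theta>\<close> consists of the rows of the inverse of the matrix whose columns
  are the frame.\<close>

lemma dual_basis:
  fixes e :: "'n::finite \<Rightarrow> real^'n"
  assumes "pos_basis e"
  shows linear_dual_basis: "linear (dual_basis e \<mu>)"
    and dual_basis_basis: "dual_basis e \<mu> (e \<nu>) = (if \<mu> = \<nu> then 1 else 0)"
    and dual_basis_expansion: "(\<Sum>\<mu>\<in>UNIV. dual_basis e \<mu> v *\<^sub>R e \<mu>) = v"
proof -
  define M where "M = (\<chi> i \<mu>. e \<mu> $ i)"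
  have "invertible M"
    using assms by (simp add: pos_basis_def M_def invertible_det_nz)
  then obtain B where MB: "M ** B = mat 1" and BM: "B ** M = mat 1"
    by (auto simp: invertible_def)
  define \<theta> where "\<theta> \<mu> v = (B *v v) $ \<mu>" for \<mu> v
  have e: "e \<nu> = M *v axis \<nu> 1" for \<nu>
    by (simp add: M_def matrix_vector_mult_basis column_def vec_eq_iff)
  have lin: "linear (\<theta> \<mu>)" for \<mu>
    unfolding \<theta>_def by (intro linearI) (simp_all add: matrix_vector_right_distrib matrix_vector_mult_scaleR)
  have \<theta>_e: "\<theta> \<mu> (e \<nu>) = (if \<mu> = \<nu> then 1 else 0)" for \<mu> \<nu>
    by (simp add: \<theta>_def e matrix_vector_mul_assoc BM axis_def)
  have expand: "(\<Sum>\<mu>\<in>UNIV. \<theta> \<mu> v *\<^sub>R e \<mu>) = v" for v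
  proof -
    have "(\<Sum>\<mu>\<in>UNIV. \<theta> \<mu> v *\<^sub>R e \<mu>) = M *v (B *v v)"
      by (simp add: M_def \<theta>_def vec_eq_iff matrix_vector_mult_def mult.commute)
    then show ?thesis
      by (simp add: matrix_vector_mul_assoc MB)
  qed
  have "dual_basis e = \<theta>"
    unfolding dual_basis_def
  proof (rule the_equality)
    show "\<forall>\<mu>. linear (\<theta> \<mu>) \<and> (\<forall>\<nu>. \<theta> \<mu> (e \<nu>) = (if \<mu> = \<nu> then 1 else 0))"
      using lin \<theta>_e by blast
  next
    fix \<phi> :: "'n \<Rightarrow> real^'n \<Rightarrow> real" assume \<phi>: "\<forall>\<mu>. linear (\<phi> \<mu>) \<and> (\<forall>\<nu>. \<phi> \<mu> (e \<nu>) = (if \<mu> = \<nu> then 1 else 0))"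
    have "\<phi> \<mu> v = \<theta> \<mu> v" for \<mu> v
    proof -
      have "\<phi> \<mu> v = \<phi> \<mu> (\<Sum>\<nu>\<in>UNIV. \<theta> \<nu> v *\<^sub>R e \<nu>)"
        by (simp add: expand)
      also have "\<dots> = (\<Sum>\<nu>\<in>UNIV. \<theta> \<nu> v * \<phi> \<mu> (e \<nu>))"
        using \<phi> by (simp add: linear_sum linear_scale)
      also have "\<dots> = (\<Sum>\<nu>\<in>UNIV. \<theta> \<nu> v * (if \<mu> = \<nu> then 1 else 0))"
        using \<phi> by (intro sum.cong refl) metis
      also have "\<dots> = \<theta> \<mu> v"
        by (simp add: if_distrib cong: if_cong)
      finally show ?thesis .
    qed
    then show "\<phi> = \<theta>" by blast
  qed
  then show "linear (dual_basis e \<mu>)" "dual_basis e \<mu> (e \<nu>) = (if \<mu> = \<nu> then 1 else 0)"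
    "(\<Sum>\<mu>\<in>UNIV. dual_basis e \<mu> v *\<^sub>R e \<mu>) = v"
    using lin \<theta>_e expand by simp_all
qed

lemma spin7_std_cayley_form:
  "spin7_std e [x, y, z, w] = cayley_form (\<lambda>\<mu>. dual_basis e \<mu> x) (\<lambda>\<mu>. dual_basis e \<mu> y)
     (\<lambda>\<mu>. dual_basis e \<mu> z) (\<lambda>\<mu>. dual_basis e \<mu> w)"
  unfolding spin7_std_def cayley_form_def Let_def wedge_list_4 ..

lemma orthonormal_basis_expansion:
  fixes e :: "'n::finite \<Rightarrow> real^'n"
  assumes "pos_basis e" "bilinear g" and e: "\<And>\<mu> \<nu>. g (e \<mu>) (e \<nu>) = (if \<mu> = \<nu> then 1 else 0)"
  shows "g x (e \<mu>) = dual_basis e \<mu> x" "g x x = (\<Sum>\<mu>\<in>UNIV. (dual_basis e \<mu> x)\<^sup>2)"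
proof -
  have lin: "linear (\<lambda>x. g x y)" "linear (g x)" for x y
    using assms(2) by (auto simp: bilinear_def)
  have 1: "g x (e \<mu>) = dual_basis e \<mu> x" for \<mu>
  proof -
    have "g x (e \<mu>) = g (\<Sum>\<nu>\<in>UNIV. dual_basis e \<nu> x *\<^sub>R e \<nu>) (e \<mu>)"
      by (simp add: dual_basis_expansion[OF assms(1)])
    also have "\<dots> = dual_basis e \<mu> x"
      by (simp add: linear_sum[OF lin(1)] linear_scale[OF lin(1)] e if_distrib cong: if_cong)
    finally show ?thesis .
  qed
  have "g x x = g x (\<Sum>\<nu>\<in>UNIV. dual_basis e \<nu> x *\<^sub>R e \<nu>)"
    by (simp add: dual_basis_expansion[OF assms(1)])
  also have "\<dots> = (\<Sum>\<mu>\<in>UNIV. (dual_basis e \<mu> x)\<^sup>2)"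
    by (simp add: linear_sum[OF lin(2)] linear_scale[OF lin(2)] 1 power2_eq_square)
  finally show "g x (e \<mu>) = dual_basis e \<mu> x" "g x x = (\<Sum>\<mu>\<in>UNIV. (dual_basis e \<mu> x)\<^sup>2)"
    using 1 by simp_all
qed

lemma spin7_form_le:
  assumes "spin7_frame \<Phi> p e" "bilinear g" "\<And>\<mu> \<nu>. g (e \<mu>) (e \<nu>) = (if \<mu> = \<nu> then 1 else 0)"
  shows "(\<Phi> p [x, y, z, w])\<^sup>2 \<le> g x x * g y y * g z z * g w w"
proof -
  have "pos_basis e" and \<Phi>: "\<Phi> p [x, y, z, w] = spin7_std e [x, y, z, w]"
    using assms(1) by (auto simp: spin7_frame_def)
  show ?thesis
    unfolding \<Phi> spin7_std_cayley_form orthonormal_basis_expansion(2)[OF \<open>pos_basis e\<close> assms(2,3)] by (rule cayley_form_le)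
qed

lemma spin7_frame_values:
  assumes "spin7_frame \<Phi> p e"
  shows "\<Phi> p [e 0, e 1, e 2, e 3] = 1"
    "\<Phi> p [e 0, e 1, e 4, e 5] = 1"
    "\<Phi> p [e 0, e 1, e 6, e 7] = 1"
    "\<Phi> p [e 0, e 2, e 4, e 6] = 1"
    "\<Phi> p [e 0, e 2, e 5, e 7] = - 1"
    "\<Phi> p [e 0, e 3, e 4, e 7] = - 1"
    "\<Phi> p [e 0, e 3, e 5, e 6] = - 1"
    "\<Phi> p [e 4, e 5, e 6, e 7] = 1"
    "\<Phi> p [e 2, e 3, e 6, e 7] = 1"
    "\<Phi> p [e 2, e 3, e 4, e 5] = 1"
    "\<Phi> p [e 1, e 3, e 5, e 7] = 1"
    "\<Phi> p [e 1, e 3, e 4, e 6] = - 1"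
    "\<Phi> p [e 1, e 2, e 5, e 6] = - 1"
    "\<Phi> p [e 1, e 2, e 4, e 7] = - 1"
proof -
  have e: "pos_basis e" and \<Phi>: "\<Phi> p [x, y, z, w] = spin7_std e [x, y, z, w]" for x y z w
    using assms by (auto simp: spin7_frame_def)
  show "\<Phi> p [e 0, e 1, e 2, e 3] = 1"
    "\<Phi> p [e 0, e 1, e 4, e 5] = 1"
    "\<Phi> p [e 0, e 1, e 6, e 7] = 1"
    "\<Phi> p [e 0, e 2, e 4, e 6] = 1"
    "\<Phi> p [e 0, e 2, e 5, e 7] = - 1"
    "\<Phi> p [e 0, e 3, e 4, e 7] = - 1"
    "\<Phi> p [e 0, e 3, e 5, e 6] = - 1"
    "\<Phi> p [e 4, e 5, e 6, e 7] = 1"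
    "\<Phi> p [e 2, e 3, e 6, e 7] = 1"
    "\<Phi> p [e 2, e 3, e 4, e 5] = 1"
    "\<Phi> p [e 1, e 3, e 5, e 7] = 1"
    "\<Phi> p [e 1, e 3, e 4, e 6] = - 1"
    "\<Phi> p [e 1, e 2, e 5, e 6] = - 1"
    "\<Phi> p [e 1, e 2, e 4, e 7] = - 1"
    unfolding \<Phi> spin7_std_cayley_form dual_basis_basis[OF e] by (simp_all add: cayley_form_def det4_def Let_def)
qed

section \<open>Smooth maps\<close>

lemma has_frechet_derivative:
  assumes "f differentiable_on S" "open S" "x \<in> S"
  shows "(f has_derivative frechet_derivative f (at x)) (at x)"
  using assms by (metis differentiable_on_eq_differentiable_at frechet_derivative_works)

lemma frechet_derivative_eqI: "(f has_derivative f') (at x) \<Longrightarrow> frechet_derivative f (at x) = f'"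
  using frechet_derivative_at by metis

text \<open>Holds without differentiability: \<open>frechet_derivative\<close> is a choice from the
  set of derivatives, and the two sets coincide.\<close>

lemma frechet_derivative_cong:
  assumes "open S" "x \<in> S" "\<And>y. y \<in> S \<Longrightarrow> f y = g y"
  shows "frechet_derivative f (at x) = frechet_derivative g (at x)"
proof -
  have "(f has_derivative D) (at x) \<longleftrightarrow> (g has_derivative D) (at x)" for D
    using has_derivative_transform_within_open[OF _ assms(1,2), of f D UNIV g]
      has_derivative_transform_within_open[OF _ assms(1,2), of g D UNIV f] assms(3) by auto
  then show ?thesis
    by (simp add: frechet_derivative_def)
qed

lemma Ck_on_cong:
  assumes "open S" "\<And>x. x \<in> S \<Longrightarrow> f x = g x" "Ck_on k f S"
  shows "Ck_on k g S"
  using assms(2,3)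
proof (induction k arbitrary: f g)
  case 0
  then show ?case
    by (simp cong: continuous_on_cong)
next
  case (Suc k)
  have "g differentiable_on S"
  proof -
    have "(g has_derivative frechet_derivative f (at x)) (at x)" if "x \<in> S" for x
      using Suc.prems that assms(1) has_frechet_derivative[of f S x]
      by (auto intro: has_derivative_transform_within_open)
    then show ?thesis
      using assms(1) by (metis differentiable_on_eq_differentiable_at differentiableI)
  qed
  moreover have "Ck_on k (\<lambda>x. frechet_derivative g (at x) b) S" if "b \<in> Basis" for b
    by (rule Suc.IH[of "\<lambda>x. frechet_derivative f (at x) b"])
      (use Suc.prems that frechet_derivative_cong[OF assms(1)] in \<open>auto, metis\<close>)
  ultimately show ?case
    by simp
qed

lemma Ck_on_SucD: "Ck_on (Suc k) f S \<Longrightarrow> Ck_on k f S"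
proof (induction k arbitrary: f)
  case 0
  then show ?case
    by (simp add: differentiable_imp_continuous_on)
next
  case (Suc k)
  then show ?case
    by (metis Ck_on.simps(2))
qed

text \<open>Allows a derivative in closed form in place of the chosen one, as the inductions below
  require.\<close>

lemma Ck_on_SucI:
  assumes "open S" "\<And>x. x \<in> S \<Longrightarrow> (f has_derivative f' x) (at x)" "\<And>b. b \<in> Basis \<Longrightarrow> Ck_on k (\<lambda>x. f' x b) S"
  shows "Ck_on (Suc k) f S"
proof -
  have "f differentiable_on S"
    using assms(1,2) by (metis differentiable_on_eq_differentiable_at differentiableI)
  moreover have "Ck_on k (\<lambda>x. frechet_derivative f (at x) b) S" if "b \<in> Basis" for b
    by (rule Ck_on_cong[OF assms(1) _ assms(3)[OF that]]) (simp add: frechet_derivative_eqI[OF assms(2)])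
  ultimately show ?thesis
    by simp
qed

lemma Ck_on_const: "open S \<Longrightarrow> Ck_on k (\<lambda>x. c) S"
  by (induction k arbitrary: c) (auto intro!: Ck_on_SucI[where f' = "\<lambda>_ _. 0"] simp del: Ck_on.simps(2))

lemma Ck_on_bounded_linear:
  assumes "bounded_linear L" "open S" "Ck_on k f S"
  shows "Ck_on k (\<lambda>x. L (f x)) S"
  using assms(3)
proof (induction k arbitrary: f)
  case 0
  then show ?case
    by (simp add: bounded_linear.continuous_on[OF assms(1)])
next
  case (Suc k)
  show ?case
    using Suc.prems
    by (intro Ck_on_SucI[where f' = "\<lambda>x v. L (frechet_derivative f (at x) v)"] assms(2) Suc.IH
        bounded_linear.has_derivative[OF assms(1)] has_frechet_derivative[of f S]) auto
qed

lemma Ck_on_add: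
  assumes "open S" "Ck_on k f S" "Ck_on k g S"
  shows "Ck_on k (\<lambda>x. f x + g x) S"
  using assms(2,3)
proof (induction k arbitrary: f g)
  case 0
  then show ?case
    by (simp add: continuous_on_add)
next
  case (Suc k)
  show ?case
    using Suc.prems
    by (intro Ck_on_SucI[where f' = "\<lambda>x v. frechet_derivative f (at x) v + frechet_derivative g (at x) v"]
        assms(1) Suc.IH has_derivative_add has_frechet_derivative[of _ S]) auto
qed

lemma Ck_on_sum:
  assumes "open S" "\<And>i. i \<in> I \<Longrightarrow> Ck_on k (f i) S"
  shows "Ck_on k (\<lambda>x. \<Sum>i\<in>I. f i x) S"
  using assms(2) by (induction I rule: infinite_finite_induct) (auto intro: Ck_on_const Ck_on_add assms(1))

lemma Ck_on_scaleR:
  assumes "open S" "Ck_on k f S" "Ck_on k g S"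
  shows "Ck_on k (\<lambda>x. f x *\<^sub>R g x) S"
  using assms(2,3)
proof (induction k arbitrary: f g)
  case 0
  then show ?case
    by (simp add: continuous_on_scaleR)
next
  case (Suc k)
  note Suc.prems(1)[THEN Ck_on_SucD] Suc.prems(2)[THEN Ck_on_SucD]
  then show ?case
    using Suc.prems
    by (intro Ck_on_SucI[where f' = "\<lambda>x v. f x *\<^sub>R frechet_derivative g (at x) v + frechet_derivative f (at x) v *\<^sub>R g x"]
        assms(1) Ck_on_add Suc.IH has_derivative_scaleR has_frechet_derivative[of _ S]) auto
qed

lemma frechet_derivative_basis_expansion:
  fixes f :: "'a::euclidean_space \<Rightarrow> 'b::real_normed_vector"
  assumes "f differentiable (at x)"
  shows "frechet_derivative f (at x) v = (\<Sum>b\<in>Basis. (v \<bullet> b) *\<^sub>R frechet_derivative f (at x) b)"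
proof -
  note lin = linear_frechet_derivative[OF assms]
  have "frechet_derivative f (at x) v = frechet_derivative f (at x) (\<Sum>b\<in>Basis. (v \<bullet> b) *\<^sub>R b)"
    by (simp add: euclidean_representation)
  then show ?thesis
    by (simp only: linear_sum[OF lin] linear_scale[OF lin])
qed

text \<open>The chain rule is written in partial derivatives of \<open>f\<close>, so that the
  induction hypothesis applies to each of them composed with the same \<open>g\<close>.\<close>

lemma Ck_on_compose:
  fixes f :: "'b::euclidean_space \<Rightarrow> 'c::real_normed_vector" and g :: "'a::euclidean_space \<Rightarrow> 'b"
  assumes S: "open S" and T: "open T" and sub: "g ` S \<subseteq> T" and f: "Ck_on k f T" and g: "Ck_on k g S"
  shows "Ck_on k (\<lambda>x. f (g x)) S"
  using f g
proof (induction k arbitrary: f)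
  case 0
  then show ?case
    using sub by (auto intro: continuous_on_compose2)
next
  case (Suc k)
  have f': "f differentiable (at (g x))" and g': "g differentiable (at x)" if "x \<in> S" for x
    using Suc.prems that S T sub by (auto simp: differentiable_on_eq_differentiable_at)
  let ?D = "\<lambda>x v. \<Sum>b\<in>Basis. (frechet_derivative g (at x) v \<bullet> b) *\<^sub>R frechet_derivative f (at (g x)) b"
  show ?case
  proof (rule Ck_on_SucI[where f' = ?D, OF S])
    fix x assume x: "x \<in> S"
    have "((\<lambda>x. f (g x)) has_derivative (\<lambda>v. frechet_derivative f (at (g x)) (frechet_derivative g (at x) v))) (at x)"
      using f'[OF x] g'[OF x] unfolding frechet_derivative_works by (rule has_derivative_compose[rotated])
    then show "((\<lambda>x. f (g x)) has_derivative ?D x) (at x)"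
      by (simp add: frechet_derivative_basis_expansion[OF f'[OF x], symmetric])
  next
    fix v :: 'a assume v: "v \<in> Basis"
    have "Ck_on k (\<lambda>x. frechet_derivative f (at (g x)) b) S" if "b \<in> Basis" for b
      using Suc.IH[of "\<lambda>y. frechet_derivative f (at y) b"] Suc.prems Ck_on_SucD[OF Suc.prems(2)] that by simp
    moreover have "Ck_on k (\<lambda>x. frechet_derivative g (at x) v \<bullet> b) S" for b
      using Suc.prems v by (intro Ck_on_bounded_linear[OF bounded_linear_inner_left S]) auto
    ultimately show "Ck_on k (\<lambda>x. ?D x v) S"
      by (intro Ck_on_sum Ck_on_scaleR S) auto
  qed
qed

lemma smooth_on_compose:
  fixes f :: "'b::euclidean_space \<Rightarrow> 'c::real_normed_vector" and g :: "'a::euclidean_space \<Rightarrow> 'b"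
  shows "open S \<Longrightarrow> open T \<Longrightarrow> g ` S \<subseteq> T \<Longrightarrow> smooth_on f T \<Longrightarrow> smooth_on g S \<Longrightarrow> smooth_on (\<lambda>x. f (g x)) S"
  unfolding smooth_on_def by (blast intro: Ck_on_compose)

lemma smooth_on_cong: "open S \<Longrightarrow> (\<And>x. x \<in> S \<Longrightarrow> f x = g x) \<Longrightarrow> smooth_on f S \<Longrightarrow> smooth_on g S"
  unfolding smooth_on_def by (blast intro: Ck_on_cong)

lemma smooth_on_const: "open S \<Longrightarrow> smooth_on (\<lambda>x. c) S"
  by (simp add: smooth_on_def Ck_on_const)

lemma smooth_on_differentiable:
  assumes "smooth_on f S" "open S" "x \<in> S"
  shows "f differentiable (at x)"
proof -
  have "Ck_on (Suc 0) f S"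
    using assms(1) unfolding smooth_on_def by blast
  then show ?thesis
    using assms(2,3) by (simp add: differentiable_on_eq_differentiable_at)
qed

text \<open>\<open>Ck_on\<close> only speaks of basis directions; an arbitrary fixed direction is a
  constant linear combination of them.\<close>

lemma smooth_on_frechet_derivative:
  assumes "smooth_on f S" "open S"
  shows "smooth_on (\<lambda>x. frechet_derivative f (at x) v) S"
  unfolding smooth_on_def
proof
  fix k
  have f: "Ck_on (Suc k) f S"
    using assms(1) unfolding smooth_on_def by blast
  have "Ck_on k (\<lambda>x. \<Sum>b\<in>Basis. (v \<bullet> b) *\<^sub>R frechet_derivative f (at x) b) S"
    using f by (intro Ck_on_sum Ck_on_scaleR Ck_on_const assms(2)) auto
  then show "Ck_on k (\<lambda>x. frechet_derivative f (at x) v) S"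
    by (rule Ck_on_cong[OF assms(2), rotated])
      (simp add: frechet_derivative_basis_expansion[symmetric] smooth_on_differentiable[OF assms])
qed

section \<open>Atlases\<close>

locale atlas =
  fixes X :: "'a topology" and A :: "('a, 'n::finite) chart set"
  assumes oriented_manifold: "oriented_manifold X A"
begin

lemma is_chart: "c \<in> A \<Longrightarrow> is_chart X c"
  using oriented_manifold by (simp add: oriented_manifold_def)

lemma openin_chart: "c \<in> A \<Longrightarrow> openin X (fst c)"
  using is_chart by (simp add: is_chart_def)

lemma chart_subset: "c \<in> A \<Longrightarrow> fst c \<subseteq> topspace X"
  by (rule openin_subset[OF openin_chart])

lemma open_chart_image:
  assumes "c \<in> A" "openin X W"
  shows "open (snd c ` (fst c \<inter> W))"
proof -
  have hom: "homeomorphic_map (subtopology X (fst c)) (top_of_set (snd c ` fst c)) (snd c)" and "open (snd c ` fst c)"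
    using is_chart[OF assms(1)] by (auto simp: is_chart_def)
  have "openin (subtopology X (fst c)) (fst c \<inter> W)"
    using assms(2) by (auto simp: openin_subtopology)
  moreover have "fst c \<inter> W \<subseteq> topspace (subtopology X (fst c))"
    using chart_subset[OF assms(1)] by auto
  ultimately have "openin (top_of_set (snd c ` fst c)) (snd c ` (fst c \<inter> W))"
    using homeomorphic_map_openness_eq[OF hom] by simp
  then show ?thesis
    using \<open>open (snd c ` fst c)\<close> openin_open_trans by blast
qed

lemma open_chart: "c \<in> A \<Longrightarrow> open (snd c ` fst c)"
  using is_chart by (simp add: is_chart_def)

lemma inj_on_chart: "c \<in> A \<Longrightarrow> inj_on (snd c) (fst c)"
  using is_chart[of c] chart_subset[of c] 
  by (auto simp: is_chart_def Int_absorb1 dest!: homeomorphic_imp_injective_map)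

lemma chart_inv_chart [simp]: "c \<in> A \<Longrightarrow> q \<in> fst c \<Longrightarrow> chart_inv c (snd c q) = q"
  by (simp add: chart_inv_def inj_on_chart)

lemma transition_chart [simp]: "c \<in> A \<Longrightarrow> q \<in> fst c \<Longrightarrow> transition c d (snd c q) = snd d q"
  by (simp add: transition_def)

lemma open_overlap: "c \<in> A \<Longrightarrow> d \<in> A \<Longrightarrow> open (snd c ` (fst c \<inter> fst d))"
  by (intro open_chart_image openin_chart)

lemma smooth_transition: "c \<in> A \<Longrightarrow> d \<in> A \<Longrightarrow> smooth_on (transition c d) (snd c ` (fst c \<inter> fst d))"
  using oriented_manifold by (simp add: oriented_manifold_def)

abbreviation jacobian :: "('a, 'n) chart \<Rightarrow> ('a, 'n) chart \<Rightarrow> 'a \<Rightarrow> real^'n \<Rightarrow> real^'n" where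
  "jacobian c d q \<equiv> frechet_derivative (transition c d) (at (snd c q))"

lemma has_derivative_transition:
  assumes "c \<in> A" "d \<in> A" "q \<in> fst c" "q \<in> fst d"
  shows "(transition c d has_derivative jacobian c d q) (at (snd c q))"
  using smooth_on_differentiable[OF smooth_transition[OF assms(1,2)] open_overlap[OF assms(1,2)], of "snd c q"] assms
  by (auto simp: frechet_derivative_works)

lemma linear_jacobian:
  "c \<in> A \<Longrightarrow> d \<in> A \<Longrightarrow> q \<in> fst c \<Longrightarrow> q \<in> fst d \<Longrightarrow> linear (jacobian c d q)"
  using has_derivative_transition has_derivative_linear by blast

lemma jacobian_same: 
  assumes "c \<in> A" "q \<in> fst c"
  shows "jacobian c c q v = v"
proof -
  have "jacobian c c q = frechet_derivative (\<lambda>x. x) (at (snd c q))"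
    by (rule frechet_derivative_cong[OF open_chart[OF assms(1)]]) (use assms in auto)
  then show ?thesis
    by (simp add: frechet_derivative_eqI[OF has_derivative_ident])
qed

lemma jacobian_chain:
  assumes "c \<in> A" "d \<in> A" "e \<in> A" "q \<in> fst c" "q \<in> fst d" "q \<in> fst e"
  shows "jacobian e d q (jacobian c e q v) = jacobian c d q v"
proof -
  have "(transition e d has_derivative jacobian e d q) (at (transition c e (snd c q)))"
    using has_derivative_transition[of e d q] assms by simp
  then have "((\<lambda>y. transition e d (transition c e y)) has_derivative (\<lambda>v. jacobian e d q (jacobian c e q v))) (at (snd c q))"
    using has_derivative_transition[of c e q] assms by (blast intro: has_derivative_compose)
  \<comment> \<open>The composition law for transitions holds only where all three charts overlap;
    openness of that set suffices for the derivative.\<close>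
  moreover have "open (snd c ` (fst c \<inter> (fst d \<inter> fst e)))"
    using assms by (intro open_chart_image openin_Int openin_chart)
  ultimately have "(transition c d has_derivative (\<lambda>v. jacobian e d q (jacobian c e q v))) (at (snd c q))"
    by (rule has_derivative_transform_within_open) (use assms in auto)
  then show ?thesis
    by (simp add: frechet_derivative_eqI)
qed

lemma chart_at:
  assumes "q \<in> topspace X"
  shows "chart_at A q \<in> A" "q \<in> fst (chart_at A q)"
proof -
  have "q \<in> (\<Union>c\<in>A. fst c)"
    using assms oriented_manifold by (simp add: oriented_manifold_def)
  then have "\<exists>c. c \<in> A \<and> q \<in> fst c"
    by blast
  then have "chart_at A q \<in> A \<and> q \<in> fst (chart_at A q)"
    unfolding chart_at_def by (rule someI_ex)
  then show "chart_at A q \<in> A" "q \<in> fst (chart_at A q)"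
    by auto
qed

lemma chart_diff_frame:
  assumes "c \<in> A" "q \<in> fst c"
  shows "chart_diff A c q (chart_frame A c q v) = v" "chart_frame A c q (chart_diff A c q v) = v"
    "linear (chart_frame A c q)" "linear (chart_diff A c q)"
proof -
  note at = chart_at[OF subsetD[OF chart_subset[OF assms(1)] assms(2)]]
  show "chart_diff A c q (chart_frame A c q v) = v"
    unfolding chart_diff_def chart_frame_def
      jacobian_chain[OF assms(1) assms(1) at(1) assms(2) assms(2) at(2)] by (rule jacobian_same[OF assms])
  show "chart_frame A c q (chart_diff A c q v) = v"
    unfolding chart_diff_def chart_frame_def
      jacobian_chain[OF at(1) at(1) assms(1) at(2) at(2) assms(2)] by (rule jacobian_same[OF at])
  show "linear (chart_frame A c q)" "linear (chart_diff A c q)"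
    unfolding chart_diff_def chart_frame_def by (intro linear_jacobian assms at)+
qed

text \<open>Tangent vectors at \<open>q\<close> are by convention their components in the preferred
  chart at \<open>q\<close>, so this chart has the identity as its differential there.\<close>

lemma chart_diff_frame_at:
  assumes "q \<in> topspace X"
  shows "chart_frame A (chart_at A q) q v = v" "chart_diff A (chart_at A q) q v = v"
  unfolding chart_diff_def chart_frame_def by (rule jacobian_same[OF chart_at[OF assms]])+

lemma chart_diff_frame_jacobian:
  assumes "c \<in> A" "d \<in> A" "q \<in> fst c" "q \<in> fst d"
  shows "chart_diff A d q (chart_frame A c q v) = jacobian c d q v"
proof -
  note at = chart_at[OF subsetD[OF chart_subset[OF assms(1)] assms(3)]]
  show ?thesis
    unfolding chart_diff_def chart_frame_def by (rule jacobian_chain) (use assms at in auto)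
qed

text \<open>In another chart \<open>d\<close> the field has as components the derivative of the
  transition from \<open>c\<close> to \<open>d\<close>, read at the point transported back to
  \<open>c\<close>.\<close>

lemma smooth_coord_vf:
  assumes c: "c \<in> A"
  shows "smooth_vf A (fst c) (coord_vf A c v)"
  unfolding smooth_vf_def
proof
  fix d assume d: "d \<in> A"
  have img: "transition d c ` snd d ` (fst d \<inter> fst c) \<subseteq> snd c ` (fst c \<inter> fst d)"
    using d by auto
  have "smooth_on (\<lambda>y. frechet_derivative (transition c d) (at (transition d c y)) v) (snd d ` (fst d \<inter> fst c))"
    by (rule smooth_on_compose[OF open_overlap[OF d c] open_overlap[OF c d] img
          smooth_on_frechet_derivative[OF smooth_transition[OF c d] open_overlap[OF c d]] smooth_transition[OF d c]])
  then show "smooth_on (vf_rep A d (coord_vf A c v)) (snd d ` (fst d \<inter> fst c))"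
    by (rule smooth_on_cong[OF open_overlap[OF d c], rotated])
      (use c d in \<open>auto simp: vf_rep_def coord_vf_def chart_diff_frame_jacobian\<close>)
qed

end

section \<open>The bracket and the Levi-Civita connection in a chart\<close>

lemma wedge_cong:
  assumes "\<And>ws. length ws = k \<Longrightarrow> a ws = a' ws" "\<And>ws. length ws = l \<Longrightarrow> b ws = b' ws"
  shows "wedge k l a b vs = wedge k l a' b' vs"
  by (simp add: wedge_def assms)

lemma frechet_derivative_vec_nth:
  fixes f :: "'a::real_normed_vector \<Rightarrow> real^'n::finite"
  assumes "f differentiable (at x)"
  shows "frechet_derivative (\<lambda>y. f y $ j) (at x) v = frechet_derivative f (at x) v $ j"
proof -
  have "(f has_derivative frechet_derivative f (at x)) (at x)"
    using assms by (simp only: frechet_derivative_works)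
  from bounded_linear.has_derivative[OF bounded_linear_vec_nth this, of j]
  show ?thesis
    by (rule frechet_derivative_eqI[THEN fun_cong])
qed

context atlas
begin

lemma smooth_vf_cong:
  assumes "openin X W" "\<And>q. q \<in> W \<Longrightarrow> V q = V' q" "smooth_vf A W V"
  shows "smooth_vf A W V'"
  unfolding smooth_vf_def
proof
  fix c assume c: "c \<in> A"
  have "smooth_on (vf_rep A c V) (snd c ` (fst c \<inter> W))"
    using assms(3) c by (simp add: smooth_vf_def)
  then show "smooth_on (vf_rep A c V') (snd c ` (fst c \<inter> W))"
    by (rule smooth_on_cong[OF open_chart_image[OF c assms(1)], rotated]) (use assms(2) c in \<open>auto simp: vf_rep_def\<close>)
qed

context
  fixes p c
  assumes p: "p \<in> topspace X" and c_def: "c = chart_at A p"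
begin

lemma chart: "c \<in> A" "p \<in> fst c"
  using chart_at[OF p] by (simp_all add: c_def)

lemma chart_point: "snd c p \<in> snd c ` fst c"
  using chart by simp

lemma frame_at_p: "chart_frame A c p v = v" "chart_diff A c p v = v" "map (chart_frame A c p) vs = vs"
  using chart_diff_frame_at[OF p] by (simp_all add: c_def map_idI)

lemma vf_rep_coord_vf: "y \<in> snd c ` fst c \<Longrightarrow> vf_rep A c (coord_vf A c v) y = v"
  using chart by (auto simp: vf_rep_def coord_vf_def chart_diff_frame)

lemma frechet_derivative_coord_vf: "frechet_derivative (vf_rep A c (coord_vf A c v)) (at (snd c p)) w = 0"
proof -
  have "frechet_derivative (vf_rep A c (coord_vf A c v)) (at (snd c p)) = frechet_derivative (\<lambda>_. v) (at (snd c p))"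
    by (rule frechet_derivative_cong[OF open_chart[OF chart(1)] chart_point]) (rule vf_rep_coord_vf)
  then show ?thesis
    by (simp add: frechet_derivative_eqI[OF has_derivative_const])
qed

lemma lie_bracket_coord_vf: "lie_bracket A (coord_vf A c v) (coord_vf A c w) p = 0"
  by (simp add: lie_bracket_def frechet_derivative_coord_vf flip: c_def)

lemma coord_vf_at_p: "coord_vf A c v p = v"
  by (simp add: coord_vf_def frame_at_p)

text \<open>Coordinate fields commute and have constant components, so the Lie derivative reduces to
  the plain derivative \<open>R\<close>. Its remaining terms have a zero argument, whence the
  hypothesis \<open>zero\<close>.\<close>

lemma fn_bracket_coord:
  fixes K :: "('a, 'n) vform"
  defines "Q \<equiv> \<lambda>y ws. chart_diff A c (chart_inv c y) (K (chart_inv c y) (map (chart_frame A c (chart_inv c y)) ws))"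
  defines "R \<equiv> \<lambda>v ws. if length ws = 3 then frechet_derivative (\<lambda>y. Q y ws) (at (snd c p)) v else 0"
  assumes diff: "\<And>ws. length ws = 3 \<Longrightarrow> (\<lambda>y. Q y ws) differentiable (at (snd c p))"
    and zero: "\<And>ws i. length ws = 3 \<Longrightarrow> i < 3 \<Longrightarrow> K p (ws[i := 0]) = 0"
  shows "fn_bracket A 3 3 K K p vs = (\<Sum>i\<in>UNIV. \<Sum>j\<in>UNIV.
        wedge 3 3 (\<lambda>ws. K p ws $ i) (\<lambda>ws. R (axis i 1) ws $ j) vs *\<^sub>R axis j 1
      - wedge 3 3 (\<lambda>ws. R (axis j 1) ws $ i) (\<lambda>ws. K p ws $ j) vs *\<^sub>R axis i 1
      - (wedge 4 2 (\<lambda>ws. alt_deriv R ws $ i) (\<lambda>ws. K p (axis i 1 # ws) $ j) vs *\<^sub>R axis j 1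
       + wedge 2 4 (\<lambda>ws. K p (axis j 1 # ws) $ i) (\<lambda>ws. alt_deriv R ws $ j) vs *\<^sub>R axis i 1))"
proof -
  let ?\<alpha> = "vform_component A c K" and ?e = "\<lambda>i. coord_vf A c (axis i 1)"
  have \<alpha>: "?\<alpha> i p = (\<lambda>ws. K p ws $ i)" for i
    by (simp add: vform_component_def frame_at_p fun_eq_iff)
  have rep: "form_rep A c (?\<alpha> i) = (\<lambda>y ws. Q y ws $ i)" for i
    by (simp add: form_rep_def vform_component_def Q_def fun_eq_iff)
  have Q: "Q (snd c p) ws = K p ws" for ws
    using chart by (simp add: Q_def frame_at_p)
  have lie: "lie_deriv A (?e i) (?\<alpha> j) p ws = R (axis i 1) ws $ j" if "length ws = 3" for i j ws
    using that diff[OF that] chart_point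
    by (simp add: lie_deriv_def rep frechet_derivative_coord_vf vf_rep_coord_vf Q zero R_def
        frechet_derivative_vec_nth flip: c_def)
  have ext: "ext_deriv A (?\<alpha> i) p ws = alt_deriv R ws $ i" if "length ws = 4" for i ws
    using that diff
    by (auto simp: ext_deriv_def alt_deriv_def rep R_def frechet_derivative_vec_nth simp flip: c_def intro!: sum.cong)
  have con: "contract 3 (?e i) (?\<alpha> j) p = (\<lambda>ws. K p (axis i 1 # ws) $ j)" for i j
    by (simp add: contract_def \<alpha> coord_vf_at_p fun_eq_iff)
  have "fn_simple A 3 3 (?\<alpha> i) (?e i) (?\<alpha> j) (?e j) p vs =
        wedge 3 3 (\<lambda>ws. K p ws $ i) (\<lambda>ws. R (axis i 1) ws $ j) vs *\<^sub>R axis j 1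
      - wedge 3 3 (\<lambda>ws. R (axis j 1) ws $ i) (\<lambda>ws. K p ws $ j) vs *\<^sub>R axis i 1
      - (wedge 4 2 (\<lambda>ws. alt_deriv R ws $ i) (\<lambda>ws. K p (axis i 1 # ws) $ j) vs *\<^sub>R axis j 1
       + wedge 2 4 (\<lambda>ws. K p (axis j 1 # ws) $ i) (\<lambda>ws. alt_deriv R ws $ j) vs *\<^sub>R axis i 1)" for i j
  proof -
    have "wedge 3 3 (?\<alpha> i p) (lie_deriv A (?e i) (?\<alpha> j) p) vs
        = wedge 3 3 (\<lambda>ws. K p ws $ i) (\<lambda>ws. R (axis i 1) ws $ j) vs"
      by (rule wedge_cong) (simp_all add: \<alpha> lie)
    moreover have "wedge 3 3 (lie_deriv A (?e j) (?\<alpha> i) p) (?\<alpha> j p) vs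
        = wedge 3 3 (\<lambda>ws. R (axis j 1) ws $ i) (\<lambda>ws. K p ws $ j) vs"
      by (rule wedge_cong) (simp_all add: \<alpha> lie)
    moreover have "wedge 4 2 (ext_deriv A (?\<alpha> i) p) (contract 3 (?e i) (?\<alpha> j) p) vs
        = wedge 4 2 (\<lambda>ws. alt_deriv R ws $ i) (\<lambda>ws. K p (axis i 1 # ws) $ j) vs"
      by (rule wedge_cong) (simp_all add: con ext)
    moreover have "wedge 2 4 (contract 3 (?e j) (?\<alpha> i) p) (ext_deriv A (?\<alpha> j) p) vs
        = wedge 2 4 (\<lambda>ws. K p (axis j 1 # ws) $ i) (\<lambda>ws. alt_deriv R ws $ j) vs"
      by (rule wedge_cong) (simp_all add: con ext)
    ultimately show ?thesis
      by (simp add: fn_simple_def lie_bracket_coord_vf coord_vf_at_p)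
  qed
  then show ?thesis
    by (simp add: fn_bracket_def flip: c_def)
qed

text \<open>All clauses are applied on the domain of the chart, since coordinate fields are smooth
  only there. For the same reason linearity in \<open>w\<close> needs locality: the coordinate field
  of a sum agrees with the sum of the fields on the chart domain.\<close>

lemma levi_civita_coord:
  assumes "levi_civita X A g D"
  shows linear_connection_fst: "linear (\<lambda>v. D p v (coord_vf A c w))"
    and linear_connection_snd: "linear (\<lambda>w. D p v (coord_vf A c w))"
    and connection_sym: "D p v (coord_vf A c w) = D p w (coord_vf A c v)"
    and connection_metric:
      "frechet_derivative (fun_rep c (\<lambda>q. g q (coord_vf A c u q) (coord_vf A c w q))) (at (snd c p)) v
        = g p (D p v (coord_vf A c u)) w + g p u (D p v (coord_vf A c w))"
proof -
  let ?W = "fst c"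
  have W: "openin X ?W" "p \<in> ?W"
    using openin_chart[OF chart(1)] chart(2) by simp_all
  note smooth = smooth_coord_vf[OF chart(1)]
  have "affine_connection X A D"
    using assms unfolding levi_civita_def by (rule conjunct1)
  note aff = spec[OF this[unfolded affine_connection_def], THEN mp, OF W(1)]
  note aff' = aff[THEN conjunct2] aff[THEN conjunct2, THEN conjunct2] aff[THEN conjunct2, THEN conjunct2, THEN conjunct2]
  have lin: "linear (\<lambda>v. D p v Y)" if "smooth_vf A ?W Y" for Y
    using aff'(1)[THEN conjunct1] that W(2) by blast
  have local: "D p v Y = D p v Z" if "smooth_vf A ?W Y" "smooth_vf A ?W Z" "\<And>q. q \<in> ?W \<Longrightarrow> Y q = Z q" for v Y Z
    using aff'(2)[THEN conjunct1, rule_format, of Y Z p v] that W(2) by blast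
  have add: "D p v (\<lambda>q. Y q + Z q) = D p v Y + D p v Z" if "smooth_vf A ?W Y" "smooth_vf A ?W Z" for v Y Z
    using aff'(3)[THEN conjunct1, rule_format, of Y Z p v] that W(2) by blast
  have leibniz: "D p v (\<lambda>q. f q *\<^sub>R Y q) = dir_deriv A f p v *\<^sub>R Y p + f p *\<^sub>R D p v Y"
    if "smooth_fun A ?W f" "smooth_vf A ?W Y" for f v Y
    using aff'(3)[THEN conjunct2, rule_format, of f Y p v] that W(2) by blast
  show "linear (\<lambda>v. D p v (coord_vf A c w))"
    by (rule lin[OF smooth])
  show "linear (\<lambda>w. D p v (coord_vf A c w))"
  proof (rule linearI)
    fix w w'
    have eq: "coord_vf A c (w + w') q = coord_vf A c w q + coord_vf A c w' q" if "q \<in> ?W" for q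
      using chart_diff_frame(3)[OF chart(1) that] by (simp add: coord_vf_def linear_add)
    show "D p v (coord_vf A c (w + w')) = D p v (coord_vf A c w) + D p v (coord_vf A c w')"
      unfolding add[OF smooth smooth, symmetric]
      by (rule local[OF smooth smooth_vf_cong[OF W(1) eq smooth] eq])
  next
    fix a w
    have eq: "coord_vf A c (a *\<^sub>R w) q = a *\<^sub>R coord_vf A c w q" if "q \<in> ?W" for q
      using chart_diff_frame(3)[OF chart(1) that] by (simp add: coord_vf_def linear_scale)
    have "smooth_fun A ?W (\<lambda>q. a)"
      unfolding smooth_fun_def fun_rep_def[abs_def] by (intro ballI smooth_on_const open_chart_image W(1))
    moreover have "dir_deriv A (\<lambda>q. a) p v = 0"
      unfolding dir_deriv_def fun_rep_def[abs_def] by (simp add: frechet_derivative_eqI[OF has_derivative_const])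
    ultimately have "D p v (\<lambda>q. a *\<^sub>R coord_vf A c w q) = a *\<^sub>R D p v (coord_vf A c w)"
      using leibniz[OF _ smooth, of "\<lambda>q. a" v w] by simp
    then show "D p v (coord_vf A c (a *\<^sub>R w)) = a *\<^sub>R D p v (coord_vf A c w)"
      using local[OF smooth smooth_vf_cong[OF W(1) eq smooth] eq] by simp
  qed
  have lc: "(\<forall>p\<in>?W. D p (V p) Y - D p (Y p) V = lie_bracket A V Y p) \<and>
      (\<forall>p\<in>?W. \<forall>v. dir_deriv A (\<lambda>q. g q (V q) (Y q)) p v = g p (D p v V) (Y p) + g p (V p) (D p v Y))"
    if "smooth_vf A ?W V" "smooth_vf A ?W Y" for V Y
    using assms[unfolded levi_civita_def, THEN conjunct2, THEN spec[of _ ?W], THEN spec[of _ V], THEN spec[of _ Y]] W(1) that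
    by (elim impE)
  have "D p (coord_vf A c v p) (coord_vf A c w) - D p (coord_vf A c w p) (coord_vf A c v)
      = lie_bracket A (coord_vf A c v) (coord_vf A c w) p"
    by (rule bspec[OF conjunct1[OF lc[OF smooth smooth]] W(2)])
  then show "D p v (coord_vf A c w) = D p w (coord_vf A c v)"
    by (simp add: lie_bracket_coord_vf coord_vf_at_p)
  have "dir_deriv A (\<lambda>q. g q (coord_vf A c u q) (coord_vf A c w q)) p v
      = g p (D p v (coord_vf A c u)) (coord_vf A c w p) + g p (coord_vf A c u p) (D p v (coord_vf A c w))"
    by (rule spec[OF bspec[OF conjunct2[OF lc[OF smooth smooth]] W(2)]])
  then show "frechet_derivative (fun_rep c (\<lambda>q. g q (coord_vf A c u q) (coord_vf A c w q))) (at (snd c p)) v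
      = g p (D p v (coord_vf A c u)) w + g p u (D p v (coord_vf A c w))"
    by (simp add: dir_deriv_def coord_vf_at_p flip: c_def)
qed

end

end

section \<open>Raising indices, the cross product, and its differentiability\<close>

lemma sharp_works:
  fixes g :: "('a, 'n::finite) metric"
  assumes "bilinear (g q)" "\<And>v. v \<noteq> 0 \<Longrightarrow> 0 < g q v v" "linear \<theta>"
  shows "g q (sharp g q \<theta>) w = \<theta> w"
proof -
  have lin: "linear (\<lambda>x. g q x y)" "linear (g q x)" for x y
    using assms(1) by (auto simp: bilinear_def)
  define L where "L u = (\<chi> i. g q u (axis i 1))" for u
  have L: "linear L"
    by (rule linearI) (simp_all add: L_def vec_eq_iff linear_add[OF lin(1)] linear_scale[OF lin(1)])
  have ext: "g q u w = \<phi> w" if "linear \<phi>" "\<And>i. g q u (axis i 1) = \<phi> (axis i 1)" for u w \<phi>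
    using sum_nth_scaleR_linear[OF lin(2), of w u] sum_nth_scaleR_linear[OF that(1), of w] that(2) by simp
  \<comment> \<open>Positivity makes lowering the index injective, hence surjective in finite
    dimension; this gives the existence and uniqueness that \<open>sharp\<close>
    presupposes.\<close>
  have "inj L"
    unfolding linear_injective_0[OF L]
  proof (intro allI impI)
    fix u assume "L u = 0"
    then have "g q u (axis i 1) = 0" for i
      by (simp add: L_def vec_eq_iff)
    then have "g q u u = 0"
      using ext[of "\<lambda>_. 0" u u] by (simp add: linear_zero)
    then show "u = 0"
      using assms(2) by force
  qed
  then have "surj L"
    using L linear_injective_imp_surjective by blast
  then obtain u where "L u = (\<chi> i. \<theta> (axis i 1))"
    by (metis surjD)
  then have u: "\<forall>w. g q u w = \<theta> w"
    using ext[OF assms(3)] by (simp add: L_def vec_eq_iff)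
  moreover have "u' = u" if "\<forall>w. g q u' w = \<theta> w" for u'
  proof -
    have "L u' = L u"
      using that u by (simp add: L_def)
    then show ?thesis
      using \<open>inj L\<close> by (simp add: inj_eq)
  qed
  ultimately have "\<forall>w. g q (sharp g q \<theta>) w = \<theta> w"
    unfolding sharp_def by (rule theI)
  then show ?thesis ..
qed

text \<open>\<open>delta_form\<close> contracts the first slot. For a 4-form, moving
  \<open>w\<close> behind three arguments is odd, so the minus sign disappears once \<open>w\<close>
  stands last.\<close>

lemma cross_product_works:
  fixes g :: "('a, 'n::finite) metric"
  assumes "bilinear (g q)" "\<And>v. v \<noteq> 0 \<Longrightarrow> 0 < g q v v" "linear (\<lambda>w. \<Phi> q (w # vs))"
  shows "g q (cross_product g \<Phi> q vs) w = - \<Phi> q (w # vs)"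
proof -
  have lin: "linear (\<lambda>x. g q x w)"
    using assms(1) by (auto simp: bilinear_def)
  have nth: "g q (sharp g q (\<lambda>w. w $ \<mu>)) w = w $ \<mu>" for \<mu>
    by (rule sharp_works) (simp_all add: assms bounded_linear.linear bounded_linear_vec_nth)
  have "g q (cross_product g \<Phi> q vs) w = - (\<Sum>\<mu>\<in>UNIV. w $ \<mu> *\<^sub>R \<Phi> q (axis \<mu> 1 # vs))"
    by (simp add: cross_product_def delta_form_def linear_neg[OF lin] linear_sum[OF lin] linear_scale[OF lin] nth mult.commute)
  then show ?thesis
    by (simp only: sum_nth_scaleR_linear[OF assms(3)])
qed

lemma differentiable_prod:
  fixes f :: "'i \<Rightarrow> 'a::real_normed_vector \<Rightarrow> real"
  assumes "\<And>i. i \<in> I \<Longrightarrow> f i differentiable (at x)"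
  shows "(\<lambda>x. \<Prod>i\<in>I. f i x) differentiable (at x)"
  using assms by (induction I rule: infinite_finite_induct) auto

lemma differentiable_vec:
  fixes f :: "'a::real_normed_vector \<Rightarrow> real^'n::finite"
  assumes "\<And>i. (\<lambda>x. f x $ i) differentiable (at x)"
  shows "f differentiable (at x)"
proof -
  have "(\<lambda>y. \<Sum>i\<in>UNIV. f y $ i *\<^sub>R axis i (1::real)) differentiable (at x)"
    by (intro differentiable_sum ballI differentiable_scaleR assms differentiable_const) simp
  then show ?thesis
    by (simp add: sum_nth_scaleR_linear[OF linear_id, unfolded id_def])
qed

text \<open>By Cramer's rule.\<close>

lemma differentiable_dual:
  fixes G :: "'a::real_normed_vector \<Rightarrow> real^'n \<Rightarrow> real^'n::finite \<Rightarrow> real" and h :: "'a \<Rightarrow> real^'n"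
  assumes "open U" "x \<in> U" and G: "\<And>y. y \<in> U \<Longrightarrow> bilinear (G y)" "\<And>y v. y \<in> U \<Longrightarrow> v \<noteq> 0 \<Longrightarrow> 0 < G y v v"
    and diff: "\<And>v w. (\<lambda>y. G y v w) differentiable (at x)" "\<And>w. (\<lambda>y. b y w) differentiable (at x)"
    and h: "\<And>y w. y \<in> U \<Longrightarrow> G y (h y) w = b y w"
  shows "h differentiable (at x)"
proof -
  define M where "M y = (\<chi> i j. G y (axis j 1) (axis i 1))" for y
  have mult: "(M y *v v) $ i = G y v (axis i 1)" if "y \<in> U" for y v i
  proof -
    have "linear (\<lambda>v. G y v (axis i 1))"
      using G(1)[OF that] by (auto simp: bilinear_def)
    from sum_nth_scaleR_linear[OF this, of v] show ?thesis
      by (simp add: M_def matrix_vector_mult_def mult.commute)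
  qed
  have det: "det (M y) \<noteq> 0" if "y \<in> U" for y
  proof -
    have "v = 0" if "M y *v v = 0" for v
    proof (rule ccontr)
      assume "v \<noteq> 0"
      have "linear (G y v)"
        using G(1)[OF \<open>y \<in> U\<close>] by (auto simp: bilinear_def)
      from sum_nth_scaleR_linear[OF this, of v] have "G y v v = 0"
        using that mult[OF \<open>y \<in> U\<close>, of v] by simp
      then show False
        using G(2)[OF \<open>y \<in> U\<close> \<open>v \<noteq> 0\<close>] by simp
    qed
    then show ?thesis
      by (metis invertible_det_nz invertible_left_inverse matrix_left_invertible_ker)
  qed
  define N where "N y k = (\<chi> i j. if j = k then (\<chi> i. b y (axis i 1)) $ i else M y $ i $ j)" for y k
  have "h y $ k = det (N y k) / det (M y)" if "y \<in> U" for y k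
  proof -
    have "M y *v h y = (\<chi> i. b y (axis i 1))"
      using mult[OF that] h[OF that] by (simp add: vec_eq_iff)
    then have "h y = (\<chi> k. det (\<chi> i j. if j = k then (\<chi> i. b y (axis i 1)) $ i else M y $ i $ j) / det (M y))"
      using cramer[OF det[OF that]] by blast
    then show ?thesis
      by (simp add: N_def)
  qed
  moreover have "(\<lambda>y. det (N y k) / det (M y)) differentiable (at x)" for k
  proof (intro differentiable_divide det assms)
    have "(\<lambda>y. N y k $ i $ j) differentiable (at x)" for i j
      by (cases "j = k") (simp_all add: N_def M_def diff)
    then show "(\<lambda>y. det (N y k)) differentiable (at x)"
      unfolding det_def by (intro differentiable_sum ballI differentiable_mult differentiable_const differentiable_prod) simp_all
    show "(\<lambda>y. det (M y)) differentiable (at x)"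
      unfolding det_def by (intro differentiable_sum ballI differentiable_mult differentiable_const differentiable_prod)
        (simp_all add: M_def diff)
  qed
  ultimately have "(\<lambda>y. h y $ k) differentiable (at x)" for k
    using assms(1,2) unfolding differentiable_def
    by (metis (no_types, lifting) has_derivative_transform_within_open)
  then show ?thesis
    by (rule differentiable_vec)
qed

section \<open>Spin(7)-structures\<close>

lemma alternating_4:
  assumes "alternating 4 a"
  shows "linear (\<lambda>x. a [x, y, z, w])" "linear (\<lambda>y. a [x, y, z, w])" "linear (\<lambda>z. a [x, y, z, w])" "linear (\<lambda>w. a [x, y, z, w])"
    and "a [y, x, z, w] = - a [x, y, z, w]" "a [x, z, y, w] = - a [x, y, z, w]" "a [x, y, w, z] = - a [x, y, z, w]"
proof -
  have lin: "linear (\<lambda>v. a (vs[i := v]))" if "length vs = 4" "i < 4" for vs i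
    using assms that unfolding alternating_def by blast
  show l: "linear (\<lambda>x. a [x, y, z, w])" "linear (\<lambda>y. a [x, y, z, w])" "linear (\<lambda>z. a [x, y, z, w])" "linear (\<lambda>w. a [x, y, z, w])" for x y z w
    using lin[of "[x, y, z, w]" 0] lin[of "[x, y, z, w]" 1] lin[of "[x, y, z, w]" 2] lin[of "[x, y, z, w]" 3]
    by (simp_all add: eval_nat_numeral)
  have zero: "a vs = 0" if "length vs = 4" "i < j" "j < 4" "vs ! i = vs ! j" for vs i j
    using assms that by (auto simp: alternating_def)
  have rep: "a [x, x, z, w] = 0" "a [x, y, y, w] = 0" "a [x, y, z, z] = 0" for x y z w
    using zero[of "[x, x, z, w]" 0 1] zero[of "[x, y, y, w]" 1 2] zero[of "[x, y, z, z]" 2 3] by (simp_all add: eval_nat_numeral)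
  show "a [y, x, z, w] = - a [x, y, z, w]"
  proof -
    have "a [x + y, x + y, z, w] = a [x, x, z, w] + a [x, y, z, w] + (a [y, x, z, w] + a [y, y, z, w])"
      by (simp only: linear_add[OF l(1)] linear_add[OF l(2)] add_ac)
    then show ?thesis
      by (simp add: rep)
  qed
  show "a [x, z, y, w] = - a [x, y, z, w]"
  proof -
    have "a [x, y + z, y + z, w] = a [x, y, y, w] + a [x, y, z, w] + (a [x, z, y, w] + a [x, z, z, w])"
      by (simp only: linear_add[OF l(2)] linear_add[OF l(3)] add_ac)
    then show ?thesis
      by (simp add: rep)
  qed
  show "a [x, y, w, z] = - a [x, y, z, w]"
  proof -
    have "a [x, y, z + w, z + w] = a [x, y, z, z] + a [x, y, z, w] + (a [x, y, w, z] + a [x, y, w, w])"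
      by (simp only: linear_add[OF l(3)] linear_add[OF l(4)] add_ac)
    then show ?thesis
      by (simp add: rep)
  qed
qed

lemma alt_sum_cong:
  assumes "\<And>i. i < n \<Longrightarrow> u i = u' i" "\<And>u u'. (\<And>i. i < n \<Longrightarrow> u i = u' i) \<Longrightarrow> h u = h u'"
  shows "alt_sum n h u = alt_sum n h u'"
  unfolding alt_sum_def
proof (intro sum.cong refl)
  fix \<sigma> assume "\<sigma> \<in> {\<sigma>. \<sigma> permutes {..<n}}"
  then have "\<sigma> i < n" if "i < n" for i
    using that permutes_in_image[of \<sigma> "{..<n}" i] by simp
  then have "h (u \<circ> \<sigma>) = h (u' \<circ> \<sigma>)"
    by (intro assms(2)) (simp add: assms(1))
  then show "of_int (sign \<sigma>) *\<^sub>R h (u \<circ> \<sigma>) = of_int (sign \<sigma>) *\<^sub>R h (u' \<circ> \<sigma>)"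
    by simp
qed

text \<open>The quadratic has a minimum at s = 0, where its derivative is \<open>a\<close>.\<close>

lemma quadratic_nonneg_linear_zero:
  fixes a b :: real
  assumes "\<And>s. 0 \<le> s * a + s\<^sup>2 * b"
  shows "a = 0"
proof (rule ccontr)
  assume "a \<noteq> 0"
  define m where "m = 1 + \<bar>b\<bar>"
  \<comment> \<open>With \<open>b\<close> enlarged to \<open>m\<close>, the value at this
    \<open>s\<close> is exactly 0, hence negative for \<open>b\<close> itself.\<close>
  define s where "s = - a / m"
  have "m > 0"
    by (simp add: m_def)
  then have "s * m = - a" "s \<noteq> 0"
    using \<open>a \<noteq> 0\<close> by (simp_all add: s_def)
  have "s * a + s\<^sup>2 * b < s * a + s\<^sup>2 * m"
    using \<open>s \<noteq> 0\<close> by (simp add: m_def)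
  also have "\<dots> = s * (a + s * m)"
    by (simp add: power2_eq_square algebra_simps)
  also have "\<dots> = 0"
    using \<open>s * m = - a\<close> by simp
  finally show False
    using assms[of s] by simp
qed

locale spin7_point = atlas X A for X :: "'a topology" and A :: "('a, 8) chart set" +
  fixes \<Phi> :: "('a, 8) form" and g :: "('a, 8) metric" and nabla :: "('a, 8) connection" and p :: 'a
  assumes spin7_structure: "spin7_structure X A \<Phi>" and spin7_metric: "spin7_metric X A \<Phi> g"
    and levi_civita: "levi_civita X A g nabla" and p: "p \<in> topspace X"
begin

definition c where "c = chart_at A p"
definition x0 where "x0 = snd c p"

abbreviation "U \<equiv> snd c ` fst c"
abbreviation "F \<equiv> form_rep A c \<Phi>"
abbreviation "K \<equiv> cross_product g \<Phi>"

text \<open>\<open>G\<close>, \<open>F\<close> and \<open>Q\<close> represent the metric, the form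
  and the cross product in the preferred chart at \<open>p\<close>. At \<open>x0\<close> they are
  \<open>g p\<close>, \<open>\<Phi> p\<close> and \<open>K p\<close>, because this chart is the
  identity on tangent vectors at \<open>p\<close>.\<close>

definition G where "G y v w = fun_rep c (\<lambda>q. g q (coord_vf A c v q) (coord_vf A c w q)) y"
definition Q where "Q y ws = chart_diff A c (chart_inv c y) (K (chart_inv c y) (map (chart_frame A c (chart_inv c y)) ws))"
text \<open>The default 0 on lists of other lengths makes \<open>R\<close> linear in the direction
  for every list, as \<open>bracket_alt_sum\<close> demands.\<close>

definition R where "R v ws = (if length ws = 3 then frechet_derivative (\<lambda>y. Q y ws) (at x0) v else 0)"
definition \<Gamma> where "\<Gamma> v w = nabla p v (coord_vf A c w)"
definition T where "T v x y z w = nabla_form A nabla \<Phi> p v [x, y, z, w]"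
text \<open>The covariant derivative of the cross product, with \<open>\<Gamma>\<close> as
  Christoffel symbols.\<close>

definition D where "D v x y z = R v [x, y, z] + \<Gamma> v (K p [x, y, z])
    - K p [\<Gamma> v x, y, z] - K p [x, \<Gamma> v y, z] - K p [x, y, \<Gamma> v z]"

section \<open>Local representatives of the metric, the form and the cross product\<close>

lemma c: "c \<in> A" "p \<in> fst c"
  using chart[OF p c_def] .

lemma open_U: "open U" and x0: "x0 \<in> U" and chart_inv_x0: "chart_inv c x0 = p"
  using open_chart[OF c(1)] c by (simp_all add: x0_def)

lemma chart_inv_topspace: "y \<in> U \<Longrightarrow> chart_inv c y \<in> topspace X" "y \<in> U \<Longrightarrow> chart_inv c y \<in> fst c"
  using chart_subset[OF c(1)] c by auto

lemma frame_p: "chart_frame A c p v = v" "chart_diff A c p v = v" "map (chart_frame A c p) vs = vs"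
  using frame_at_p[OF p c_def] .

lemma metric:
  assumes "q \<in> topspace X"
  shows "bilinear (g q)" "g q v w = g q w v" "v \<noteq> 0 \<Longrightarrow> 0 < g q v v"
  using spin7_metric assms by (auto simp: spin7_metric_def riemannian_metric_def)

lemma form_alternating: "q \<in> topspace X \<Longrightarrow> alternating 4 (\<Phi> q)"
  using spin7_structure by (auto simp: spin7_structure_def smooth_form_def)

lemma frame:
  assumes "q \<in> topspace X"
  obtains e where "spin7_frame \<Phi> q e" "\<And>\<mu> \<nu>. g q (e \<mu>) (e \<nu>) = (if \<mu> = \<nu> then 1 else 0)"
  using assms spin7_structure spin7_metric by (metis spin7_structure_def spin7_metric_def)

lemma form_le:
  assumes "q \<in> topspace X"
  shows "(\<Phi> q [x, y, z, w])\<^sup>2 \<le> g q x x * g q y y * g q z z * g q w w"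
  using frame[OF assms] spin7_form_le metric(1)[OF assms] by metis

lemma G_eq: "G y v w = g (chart_inv c y) (chart_frame A c (chart_inv c y) v) (chart_frame A c (chart_inv c y) w)"
  by (simp add: G_def fun_rep_def coord_vf_def)

lemma F_eq: "F y [a, b, d, e] = \<Phi> (chart_inv c y) [chart_frame A c (chart_inv c y) a, chart_frame A c (chart_inv c y) b,
    chart_frame A c (chart_inv c y) d, chart_frame A c (chart_inv c y) e]"
  by (simp add: form_rep_def)

lemma G_x0: "G x0 = g p" and F_x0: "F x0 = \<Phi> p" and Q_x0: "Q x0 = K p"
  by (simp_all add: fun_eq_iff G_eq form_rep_def Q_def chart_inv_x0 frame_p)

lemma G_bilinear: "y \<in> U \<Longrightarrow> bilinear (G y)" 
  using metric(1)[OF chart_inv_topspace(1)] chart_diff_frame(3)[OF c(1) chart_inv_topspace(2)]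
  unfolding bilinear_def G_eq by (auto intro: linear_compose[unfolded o_def])

lemma G_pos: 
  assumes "y \<in> U" "v \<noteq> 0"
  shows "0 < G y v v"
proof -
  have "chart_frame A c (chart_inv c y) v \<noteq> 0"
    using assms chart_diff_frame(1,4)[OF c(1) chart_inv_topspace(2)] by (metis linear_0)
  then show ?thesis
    unfolding G_eq using metric(3)[OF chart_inv_topspace(1)] assms(1) by blast
qed

lemma F_linear: "y \<in> U \<Longrightarrow> linear (\<lambda>x. F y [x, b, d, e])"
  unfolding F_eq using chart_diff_frame(3)[OF c(1) chart_inv_topspace(2)]
    alternating_4(1)[OF form_alternating[OF chart_inv_topspace(1)]]
  by (auto intro: linear_compose[unfolded o_def])

lemma F_swap:
  assumes "y \<in> U" 
  shows "F y [b, a, d, e] = - F y [a, b, d, e]" "F y [a, d, b, e] = - F y [a, b, d, e]" "F y [a, b, e, d] = - F y [a, b, d, e]"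
  unfolding F_eq by (rule alternating_4[OF form_alternating[OF chart_inv_topspace(1)[OF assms]]])+

lemma F_le: "y \<in> U \<Longrightarrow> (F y [a, b, d, e])\<^sup>2 \<le> G y a a * G y b b * G y d d * G y e e"
  unfolding F_eq G_eq by (rule form_le[OF chart_inv_topspace(1)])

lemma F_differentiable: 
  assumes "length vs = 4"
  shows "(\<lambda>y. F y vs) differentiable (at x0)"
proof -
  have "fst c \<inter> topspace X = fst c"
    using chart_subset[OF c(1)] by auto
  then have "smooth_on (\<lambda>y. F y vs) U"
    using spin7_structure c(1) assms by (auto simp: spin7_structure_def smooth_form_def)
  then show ?thesis
    by (rule smooth_on_differentiable[OF _ open_U x0])
qed

lemma G_differentiable: "(\<lambda>y. G y v w) differentiable (at x0)"
proof -
  have "smooth_on (\<lambda>y. G y v w) U"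
    using spin7_metric c(1) unfolding G_def spin7_metric_def riemannian_metric_def by blast
  then show ?thesis
    by (rule smooth_on_differentiable[OF _ open_U x0])
qed

lemma G_Q:
  assumes "y \<in> U"
  shows "G y (Q y [a, b, d]) w = - F y [w, a, b, d]"
  unfolding G_eq F_eq Q_def chart_diff_frame(2)[OF c(1) chart_inv_topspace(2)[OF assms]] list.map
  by (rule cross_product_works) (rule metric alternating_4(1) form_alternating chart_inv_topspace assms | assumption)+

text \<open>The cross product is only given pointwise through \<open>sharp\<close>; by
  \<open>G_Q\<close> it solves a linear system whose coefficients are differentiable.\<close>

lemma Q_differentiable: 
  assumes "length ws = 3"
  shows "(\<lambda>y. Q y ws) differentiable (at x0)"
proof -
  obtain a b d where ws: "ws = [a, b, d]"
    using assms by (auto simp: length_Suc_conv numeral_3_eq_3)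
  show ?thesis
    unfolding ws
    by (rule differentiable_dual[where b = "\<lambda>y w. - F y [w, a, b, d]" and G = G])
      (rule open_U x0 G_bilinear G_pos G_differentiable G_Q | assumption | simp add: F_differentiable)+
qed

section \<open>Christoffel symbols, the derivative of the form and the derivative of the cross
  product\<close>

lemma \<Gamma>: "linear (\<lambda>v. \<Gamma> v w)" "linear (\<Gamma> v)" "\<Gamma> v w = \<Gamma> w v"
  unfolding \<Gamma>_def[abs_def] by (rule levi_civita_coord(1-3)[OF p c_def levi_civita])+

lemma dG: "frechet_derivative (\<lambda>y. G y u w) (at x0) v = g p (\<Gamma> v u) w + g p u (\<Gamma> v w)"
  unfolding G_def x0_def \<Gamma>_def by (rule connection_metric[OF p c_def levi_civita])

lemma T_eq: "T v a b d e = frechet_derivative (\<lambda>y. F y [a, b, d, e]) (at x0) v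
    - (\<Phi> p [\<Gamma> v a, b, d, e] + \<Phi> p [a, \<Gamma> v b, d, e] + \<Phi> p [a, b, \<Gamma> v d, e] + \<Phi> p [a, b, d, \<Gamma> v e])"
proof -
  have "fun_rep c (\<lambda>q. \<Phi> q [coord_vf A c a q, coord_vf A c b q, coord_vf A c d q, coord_vf A c e q])
      = (\<lambda>y. F y [a, b, d, e])"
    by (simp add: fun_eq_iff fun_rep_def form_rep_def coord_vf_def)
  then show ?thesis
    unfolding T_def nabla_form_def dir_deriv_def Let_def c_def[symmetric] x0_def[symmetric]
    by (simp add: eval_nat_numeral flip: \<Gamma>_def)
qed

lemmas \<Phi>_linear = alternating_4(1-4)[OF form_alternating[OF p]]
lemmas \<Phi>_swap = alternating_4(5-7)[OF form_alternating[OF p]]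
lemmas g_bilinear = metric(1)[OF p]

lemma linear_dF: "linear (frechet_derivative (\<lambda>y. F y [a, b, d, e]) (at x0))"
  by (intro linear_frechet_derivative F_differentiable) simp

lemma T_linear_fst: "linear (\<lambda>v. T v a b d e)"
  unfolding T_eq
  by (intro linear_compose_sub linear_compose_add linear_dF linear_compose[OF \<Gamma>(1), unfolded o_def] \<Phi>_linear)

lemma dF_cong:
  assumes "\<And>y. y \<in> U \<Longrightarrow> f y = h y"
  shows "frechet_derivative f (at x0) v = frechet_derivative h (at x0) v"
  by (simp add: frechet_derivative_cong[OF open_U x0 assms])

lemma dF_linear: "linear (\<lambda>a. frechet_derivative (\<lambda>y. F y [a, b, d, e]) (at x0) v)"
proof (rule linearI)
  note diff = F_differentiable[of "[a, b, d, e]" for a, simplified, unfolded frechet_derivative_works]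
  fix a a' r
  have "frechet_derivative (\<lambda>y. F y [a + a', b, d, e]) (at x0) v
      = frechet_derivative (\<lambda>y. F y [a, b, d, e] + F y [a', b, d, e]) (at x0) v"
    by (rule dF_cong) (rule linear_add[OF F_linear])
  then show "frechet_derivative (\<lambda>y. F y [a + a', b, d, e]) (at x0) v
      = frechet_derivative (\<lambda>y. F y [a, b, d, e]) (at x0) v + frechet_derivative (\<lambda>y. F y [a', b, d, e]) (at x0) v"
    by (simp only: frechet_derivative_eqI[OF has_derivative_add[OF diff diff]])
  have "frechet_derivative (\<lambda>y. F y [r *\<^sub>R a, b, d, e]) (at x0) v
      = frechet_derivative (\<lambda>y. r *\<^sub>R F y [a, b, d, e]) (at x0) v"
    by (rule dF_cong) (rule linear_scale[OF F_linear])
  then show "frechet_derivative (\<lambda>y. F y [r *\<^sub>R a, b, d, e]) (at x0) v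
      = r *\<^sub>R frechet_derivative (\<lambda>y. F y [a, b, d, e]) (at x0) v"
    by (simp only: frechet_derivative_eqI[OF has_derivative_scaleR_right[OF diff]])
qed

lemma dF_swap:
  "frechet_derivative (\<lambda>y. F y [b, a, d, e]) (at x0) v = - frechet_derivative (\<lambda>y. F y [a, b, d, e]) (at x0) v"
  "frechet_derivative (\<lambda>y. F y [a, d, b, e]) (at x0) v = - frechet_derivative (\<lambda>y. F y [a, b, d, e]) (at x0) v"
  "frechet_derivative (\<lambda>y. F y [a, b, e, d]) (at x0) v = - frechet_derivative (\<lambda>y. F y [a, b, d, e]) (at x0) v"
proof -
  note diff = F_differentiable[of "[a, b, d, e]", simplified, unfolded frechet_derivative_works]
  have "frechet_derivative (\<lambda>y. - F y [a, b, d, e]) (at x0) v = - frechet_derivative (\<lambda>y. F y [a, b, d, e]) (at x0) v"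
    by (simp only: frechet_derivative_eqI[OF has_derivative_minus[OF diff]])
  then show
    "frechet_derivative (\<lambda>y. F y [b, a, d, e]) (at x0) v = - frechet_derivative (\<lambda>y. F y [a, b, d, e]) (at x0) v"
    "frechet_derivative (\<lambda>y. F y [a, d, b, e]) (at x0) v = - frechet_derivative (\<lambda>y. F y [a, b, d, e]) (at x0) v"
    "frechet_derivative (\<lambda>y. F y [a, b, e, d]) (at x0) v = - frechet_derivative (\<lambda>y. F y [a, b, d, e]) (at x0) v"
    using dF_cong[of "\<lambda>y. F y [b, a, d, e]" "\<lambda>y. - F y [a, b, d, e]", OF F_swap(1)]
      dF_cong[of "\<lambda>y. F y [a, d, b, e]" "\<lambda>y. - F y [a, b, d, e]", OF F_swap(2)]
      dF_cong[of "\<lambda>y. F y [a, b, e, d]" "\<lambda>y. - F y [a, b, d, e]", OF F_swap(3)]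
    by simp_all
qed

lemma T_linear: "linear (\<lambda>a. T v a b d e)"
  unfolding T_eq
  by (intro linear_compose_sub linear_compose_add dF_linear linear_compose[OF \<Gamma>(2), unfolded o_def] \<Phi>_linear)

lemma T_swap: "T v b a d e = - T v a b d e" "T v a d b e = - T v a b d e" "T v a b e d = - T v a b d e"
proof -
  show "T v b a d e = - T v a b d e"
    using dF_swap(1)[of b a d e v] \<Phi>_swap(1)[of "\<Gamma> v b" a d e] \<Phi>_swap(1)[of b "\<Gamma> v a" d e]
      \<Phi>_swap(1)[of b a "\<Gamma> v d" e] \<Phi>_swap(1)[of b a d "\<Gamma> v e"]
    unfolding T_eq by linarith
  show "T v a d b e = - T v a b d e"
    using dF_swap(2)[of a d b e v] \<Phi>_swap(2)[of "\<Gamma> v a" d b e] \<Phi>_swap(2)[of a "\<Gamma> v d" b e]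
      \<Phi>_swap(2)[of a d "\<Gamma> v b" e] \<Phi>_swap(2)[of a d b "\<Gamma> v e"]
    unfolding T_eq by linarith
  show "T v a b e d = - T v a b d e"
    using dF_swap(3)[of a b e d v] \<Phi>_swap(3)[of "\<Gamma> v a" b e d] \<Phi>_swap(3)[of a "\<Gamma> v b" e d]
      \<Phi>_swap(3)[of a b "\<Gamma> v e" d] \<Phi>_swap(3)[of a b e "\<Gamma> v d"]
    unfolding T_eq by linarith
qed

lemma G_nondegenerate:
  assumes "y \<in> U" "\<And>w. G y u w = G y v w"
  shows "u = v"
proof (rule ccontr)
  assume "u \<noteq> v"
  have "G y (u - v) (u - v) = 0"
    by (simp add: bilinear_lsub[OF G_bilinear[OF assms(1)]] assms(2))
  then show False
    using G_pos[OF assms(1), of "u - v"] \<open>u \<noteq> v\<close> by simp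
qed

lemma g_nondegenerate: "(\<And>w. g p u w = g p v w) \<Longrightarrow> u = v"
  using G_nondegenerate[OF x0] by (simp add: G_x0)

lemma Q_swap:
  assumes "y \<in> U"
  shows "Q y [b, a, d] = - Q y [a, b, d]" "Q y [a, d, b] = - Q y [a, b, d]"
proof -
  show "Q y [b, a, d] = - Q y [a, b, d]"
    by (rule G_nondegenerate[OF assms])
      (simp add: bilinear_lneg[OF G_bilinear[OF assms]] G_Q[OF assms] F_swap(2)[OF assms, of _ b a])
  show "Q y [a, d, b] = - Q y [a, b, d]"
    by (rule G_nondegenerate[OF assms])
      (simp add: bilinear_lneg[OF G_bilinear[OF assms]] G_Q[OF assms] F_swap(3)[OF assms, of _ a d b])
qed

lemma K_swap: "K p [b, a, d] = - K p [a, b, d]" "K p [a, d, b] = - K p [a, b, d]"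
  by (rule Q_swap[OF x0, unfolded Q_x0])+

lemma g_K: "g p (K p [a, b, d]) w = - \<Phi> p [w, a, b, d]"
  using G_Q[OF x0] by (simp add: G_x0 F_x0 Q_x0)

lemma g_K': "g p (K p [a, b, d]) w = \<Phi> p [a, b, d, w]"
proof -
  have "\<Phi> p [w, a, b, d] = - \<Phi> p [a, b, d, w]"
    using \<Phi>_swap(1)[of w a b d] \<Phi>_swap(2)[of a w b d] \<Phi>_swap(3)[of a b w d] by linarith
  then show ?thesis
    by (simp add: g_K)
qed

lemma K_linear: "linear (\<lambda>a. K p [a, b, d])"
proof (rule linearI)
  fix a a' r
  show "K p [a + a', b, d] = K p [a, b, d] + K p [a', b, d]"
    by (rule g_nondegenerate) (simp add: bilinear_ladd[OF g_bilinear] g_K linear_add[OF \<Phi>_linear(2)])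
  show "K p [r *\<^sub>R a, b, d] = r *\<^sub>R K p [a, b, d]"
    by (rule g_nondegenerate) (simp add: bilinear_lmul[OF g_bilinear] g_K linear_scale[OF \<Phi>_linear(2)])
qed

lemma K_zero:
  assumes "length ws = 3" "i < 3"
  shows "K p (ws[i := 0]) = 0"
proof -
  obtain a b d where ws: "ws = [a, b, d]"
    using assms by (auto simp: length_Suc_conv numeral_3_eq_3)
  have "i = 0 \<or> i = 1 \<or> i = 2"
    using assms(2) by auto
  moreover have "K p [0, b, d] = 0" "K p [a, 0, d] = 0" "K p [a, b, 0] = 0"
    by (rule g_nondegenerate, simp add: g_K linear_0[OF \<Phi>_linear(2)] linear_0[OF \<Phi>_linear(3)]
        linear_0[OF \<Phi>_linear(4)] bilinear_lzero[OF g_bilinear])+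
  ultimately show ?thesis
    unfolding ws by (auto simp: eval_nat_numeral)
qed

lemma R_linear: "linear (\<lambda>v. R v ws)"
proof (cases "length ws = 3")
  case True
  then show ?thesis
    unfolding R_def using linear_frechet_derivative[OF Q_differentiable[OF True]] by simp
qed (simp add: R_def linear_zero)

lemma R_swap: "R v [b, a, d] = - R v [a, b, d]" "R v [a, d, b] = - R v [a, b, d]"
proof -
  have diff: "((\<lambda>y. Q y [a, b, d]) has_derivative frechet_derivative (\<lambda>y. Q y [a, b, d]) (at x0)) (at x0)"
    using Q_differentiable[of "[a, b, d]"] by (simp only: frechet_derivative_works[symmetric]) simp
  have "frechet_derivative (\<lambda>y. - Q y [a, b, d]) (at x0) v = - frechet_derivative (\<lambda>y. Q y [a, b, d]) (at x0) v"
    by (simp only: frechet_derivative_eqI[OF has_derivative_minus[OF diff]])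
  then show "R v [b, a, d] = - R v [a, b, d]" "R v [a, d, b] = - R v [a, b, d]"
    using frechet_derivative_cong[OF open_U x0, of "\<lambda>y. Q y [b, a, d]" "\<lambda>y. - Q y [a, b, d]", OF Q_swap(1)]
      frechet_derivative_cong[OF open_U x0, of "\<lambda>y. Q y [a, d, b]" "\<lambda>y. - Q y [a, b, d]", OF Q_swap(2)]
    by (simp_all add: R_def)
qed

text \<open>Obtained by differentiating \<open>G_Q\<close>; metric compatibility converts the
  derivative of \<open>G\<close> into the two terms with \<open>\<Gamma>\<close>.\<close>

lemma g_R: "g p (R v [a, b, d]) w = - frechet_derivative (\<lambda>y. F y [w, a, b, d]) (at x0) v
    - g p (\<Gamma> v (K p [a, b, d])) w - g p (K p [a, b, d]) (\<Gamma> v w)"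
proof -
  define q where "q y = Q y [a, b, d]" for y
  define dq where "dq = frechet_derivative q (at x0)"
  have dq: "(q has_derivative dq) (at x0)"
    using Q_differentiable[of "[a, b, d]"] unfolding q_def dq_def by (simp add: frechet_derivative_works[symmetric])
  have R: "R v [a, b, d] = dq v"
    by (simp add: R_def dq_def q_def[abs_def])
  let ?dG = "\<lambda>i. frechet_derivative (\<lambda>y. G y (axis i 1) w) (at x0)"
  have dG': "((\<lambda>y. G y (axis i 1) w) has_derivative ?dG i) (at x0)" for i
    using G_differentiable by (simp only: frechet_derivative_works[symmetric])
  \<comment> \<open>Both the metric and its first argument depend on \<open>y\<close>. Expanding
    that argument in the standard basis reduces the derivative to the product rule for real
    functions.\<close>
  have "(\<Sum>i\<in>UNIV. q y $ i * G y (axis i 1) w) = - F y [w, a, b, d]" if "y \<in> U" for y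
  proof -
    have "linear (\<lambda>u. G y u w)"
      using G_bilinear[OF that] by (auto simp: bilinear_def)
    from sum_nth_scaleR_linear[OF this, of "q y"] show ?thesis
      by (simp add: q_def G_Q[OF that])
  qed
  then have eq: "frechet_derivative (\<lambda>y. \<Sum>i\<in>UNIV. q y $ i * G y (axis i 1) w) (at x0) v
      = frechet_derivative (\<lambda>y. - F y [w, a, b, d]) (at x0) v"
    by (rule dF_cong)
  have lhs: "((\<lambda>y. \<Sum>i\<in>UNIV. q y $ i * G y (axis i 1) w) has_derivative
      (\<lambda>v. \<Sum>i\<in>UNIV. q x0 $ i * ?dG i v + dq v $ i * G x0 (axis i 1) w)) (at x0)"
    by (intro has_derivative_sum has_derivative_mult dG' bounded_linear.has_derivative[OF bounded_linear_vec_nth dq])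
  have rhs: "((\<lambda>y. F y [w, a, b, d]) has_derivative frechet_derivative (\<lambda>y. F y [w, a, b, d]) (at x0)) (at x0)"
    using F_differentiable[of "[w, a, b, d]"] by (simp only: frechet_derivative_works[symmetric]) simp
  have "(\<Sum>i\<in>UNIV. q x0 $ i * ?dG i v + dq v $ i * G x0 (axis i 1) w)
      = - frechet_derivative (\<lambda>y. F y [w, a, b, d]) (at x0) v"
    using eq unfolding frechet_derivative_eqI[OF lhs] frechet_derivative_eqI[OF has_derivative_minus[OF rhs]] .
  moreover have "(\<Sum>i\<in>UNIV. q x0 $ i * ?dG i v) = g p (\<Gamma> v (q x0)) w + g p (q x0) (\<Gamma> v w)"
  proof -
    have "linear (\<lambda>u. g p (\<Gamma> v u) w + g p u (\<Gamma> v w))"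
      using g_bilinear by (auto simp: bilinear_def intro!: linear_compose_add linear_compose[OF \<Gamma>(2), unfolded o_def])
    from sum_nth_scaleR_linear[OF this, of "q x0"] show ?thesis
      by (simp add: dG)
  qed
  moreover have "(\<Sum>i\<in>UNIV. dq v $ i * G x0 (axis i 1) w) = g p (dq v) w"
  proof -
    have "linear (\<lambda>u. g p u w)"
      using g_bilinear by (auto simp: bilinear_def)
    from sum_nth_scaleR_linear[OF this, of "dq v"] show ?thesis
      by (simp add: G_x0)
  qed
  moreover have "q x0 = K p [a, b, d]"
    by (simp add: q_def Q_x0)
  ultimately show ?thesis
    by (simp add: R sum.distrib)
qed

text \<open>The metric is parallel, so lowering an index commutes with covariant differentiation:
  the term of \<open>D\<close> with \<open>\<Gamma> v (K p [a, b, d])\<close> cancels against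
  \<open>g_R\<close>, and the last term of \<open>g_R\<close> is the connection term for
  \<open>w\<close>.\<close>

lemma g_D: "g p (D v a b d) w = T v a b d w"
proof -
  have "T v w a b d = - T v a b d w"
    using T_swap(1)[of v w a b d] T_swap(2)[of v a w b d] T_swap(3)[of v a b w d] by linarith
  moreover have "g p (D v a b d) w = - T v w a b d"
    by (simp add: D_def T_eq bilinear_ladd[OF g_bilinear] bilinear_lsub[OF g_bilinear] g_R g_K)
  ultimately show ?thesis
    by simp
qed

text \<open>The comass inequality is sharp at a calibrated quadruple, which determines \<open>\<Phi>\<close> when one
  argument varies.\<close>

lemma calibrated_fst:
  assumes "(\<Phi> p [x, y, z, w])\<^sup>2 = g p x x * g p y y * g p z z * g p w w"
  shows "\<Phi> p [x, y, z, w] * \<Phi> p [u, y, z, w] = g p x u * (g p y y * g p z z * g p w w)"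
proof -
  let ?k = "g p y y * g p z z * g p w w" and ?a = "\<Phi> p [x, y, z, w]" and ?b = "\<Phi> p [u, y, z, w]"
  have "0 \<le> s * (2 * (g p x u * ?k - ?a * ?b)) + s\<^sup>2 * (g p u u * ?k - ?b\<^sup>2)" for s
  proof -
    have "\<Phi> p [x + s *\<^sub>R u, y, z, w] = ?a + s * ?b"
      by (simp add: linear_add[OF \<Phi>_linear(1)] linear_scale[OF \<Phi>_linear(1)])
    moreover have "g p (x + s *\<^sub>R u) (x + s *\<^sub>R u) = g p x x + 2 * s * g p x u + s\<^sup>2 * g p u u"
      using metric(2)[OF p, of u x] by (simp add: bilinear_ladd[OF g_bilinear] bilinear_radd[OF g_bilinear]
          bilinear_lmul[OF g_bilinear] bilinear_rmul[OF g_bilinear] power2_eq_square algebra_simps)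
    ultimately have "(?a + s * ?b)\<^sup>2 \<le> (g p x x + 2 * s * g p x u + s\<^sup>2 * g p u u) * ?k"
      using form_le[OF p, of "x + s *\<^sub>R u" y z w] by (simp add: mult.assoc)
    moreover have "?a\<^sup>2 = g p x x * ?k"
      using assms by (simp add: mult.assoc)
    ultimately show ?thesis
      by (simp add: power2_eq_square algebra_simps)
  qed
  from quadratic_nonneg_linear_zero[OF this] show ?thesis
    by simp
qed

text \<open>By \<open>F_le\<close> the function \<open>h\<close> below has a minimum at \<open>x0\<close>, so its derivative vanishes there.\<close>

lemma T_calibrated:
  assumes eq: "(\<Phi> p [x, y, z, w])\<^sup>2 = g p x x * g p y y * g p z z * g p w w" and "\<Phi> p [x, y, z, w] \<noteq> 0"
  shows "T v x y z w = 0"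
proof -
  let ?f = "\<Phi> p [x, y, z, w]" and ?dF = "frechet_derivative (\<lambda>y'. F y' [x, y, z, w]) (at x0)"
  let ?dG = "\<lambda>u. frechet_derivative (\<lambda>y. G y u u) (at x0)"
  define h where "h y' = G y' x x * G y' y y * G y' z z * G y' w w - (F y' [x, y, z, w])\<^sup>2" for y'
  have dF: "((\<lambda>y'. F y' [x, y, z, w]) has_derivative ?dF) (at x0)"
    using F_differentiable[of "[x, y, z, w]"] by (simp only: frechet_derivative_works[symmetric]) simp
  have dG': "((\<lambda>y. G y u u) has_derivative ?dG u) (at x0)" for u
    using G_differentiable by (simp only: frechet_derivative_works[symmetric])
  let ?dh = "\<lambda>v. g p x x * g p y y * g p z z * ?dG w v + (g p x x * g p y y * ?dG z v
      + (g p x x * ?dG y v + ?dG x v * g p y y) * g p z z) * g p w w - 2 * ?f * ?dF v"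
  have "(h has_derivative ?dh) (at x0)"
    unfolding h_def power2_eq_square
    by (rule has_derivative_eq_rhs[OF has_derivative_diff[OF has_derivative_mult[OF has_derivative_mult[OF has_derivative_mult[OF
      dG' dG'] dG'] dG'] has_derivative_mult[OF dF dF]]]) (simp add: G_x0 F_x0 fun_eq_iff algebra_simps)
  moreover have "h x0 = 0"
    using eq by (simp add: h_def G_x0 F_x0)
  then have "\<forall>y\<in>U. h x0 \<le> h y"
    using F_le by (simp add: h_def)
  ultimately have "?dh = (\<lambda>v. 0)"
    using differential_zero_maxmin[OF x0 open_U] by blast
  then have "?dh v = 0"
    by meson
  then have 1: "?f * ?dF v = g p x (\<Gamma> v x) * (g p y y * g p z z * g p w w) + g p y (\<Gamma> v y) * (g p x x * g p z z * g p w w)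
      + g p z (\<Gamma> v z) * (g p x x * g p y y * g p w w) + g p w (\<Gamma> v w) * (g p x x * g p y y * g p z z)"
    unfolding dG metric(2)[OF p, of "\<Gamma> v _"] by algebra
  \<comment> \<open>The four products of \<open>?f\<close> with the connection terms of
    \<open>T\<close> are the four summands on the right of 1, so \<open>?f * T\<close> vanishes. For
    the later slots the varied argument is moved to the front; the resulting sign occurs in both
    factors and cancels.\<close>
  have "?f * \<Phi> p [\<Gamma> v x, y, z, w] = g p x (\<Gamma> v x) * (g p y y * g p z z * g p w w)"
    by (rule calibrated_fst[OF eq])
  moreover have "?f * \<Phi> p [x, \<Gamma> v y, z, w] = g p y (\<Gamma> v y) * (g p x x * g p z z * g p w w)"
    using calibrated_fst[of y x z w "\<Gamma> v y"] eq \<Phi>_swap(1)[of y x z w] \<Phi>_swap(1)[of "\<Gamma> v y" x z w]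
    by (simp add: mult_ac)
  moreover have "?f * \<Phi> p [x, y, \<Gamma> v z, w] = g p z (\<Gamma> v z) * (g p x x * g p y y * g p w w)"
  proof -
    have "\<Phi> p [u, x, y, w] = \<Phi> p [x, y, u, w]" for u
      using \<Phi>_swap(1)[of u x y w] \<Phi>_swap(2)[of x u y w] by linarith
    then show ?thesis
      using calibrated_fst[of z x y w "\<Gamma> v z"] eq by (simp add: mult_ac)
  qed
  moreover have "?f * \<Phi> p [x, y, z, \<Gamma> v w] = g p w (\<Gamma> v w) * (g p x x * g p y y * g p z z)"
  proof -
    have "\<Phi> p [u, x, y, z] = - \<Phi> p [x, y, z, u]" for u
      using \<Phi>_swap(1)[of u x y z] \<Phi>_swap(2)[of x u y z] \<Phi>_swap(3)[of x y u z] by linarith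
    then show ?thesis
      using calibrated_fst[of w x y z "\<Gamma> v w"] eq by (simp add: mult_ac)
  qed
  ultimately have "?f * T v x y z w = 0"
    unfolding T_eq by (simp add: 1 algebra_simps)
  then show ?thesis
    using assms(2) by simp
qed

section \<open>The bracket in terms of the covariant derivative, and the equivalence\<close>

lemma fn_bracket_eq:
  "fn_bracket A 3 3 K K p vs = (1 / 18) *\<^sub>R
     (alt_sum 6 (\<lambda>u. D (K p [u 0, u 1, u 2]) (u 3) (u 4) (u 5)) ((!) vs)
      + 3 *\<^sub>R alt_sum 6 (\<lambda>u. K p [D (u 5) (u 0) (u 1) (u 2), u 3, u 4]) ((!) vs))"
proof -
  have "fn_bracket A 3 3 K K p vs = (1 / 18) *\<^sub>R
     (alt_sum 6 (\<lambda>u. R (K p [u 0, u 1, u 2]) [u 3, u 4, u 5]) ((!) vs)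
      + 3 *\<^sub>R alt_sum 6 (\<lambda>u. K p [R (u 5) [u 0, u 1, u 2], u 3, u 4]) ((!) vs))"
    unfolding bracket_alt_sum[of "K p" R vs, OF K_linear R_linear K_swap R_swap, symmetric]
    by (rule fn_bracket_coord[OF p c_def, of K vs, folded Q_def x0_def, folded R_def, OF Q_differentiable K_zero])
  also have "alt_sum 6 (\<lambda>u. R (K p [u 0, u 1, u 2]) [u 3, u 4, u 5]) ((!) vs)
      + 3 *\<^sub>R alt_sum 6 (\<lambda>u. K p [R (u 5) [u 0, u 1, u 2], u 3, u 4]) ((!) vs)
    = alt_sum 6 (\<lambda>u. D (K p [u 0, u 1, u 2]) (u 3) (u 4) (u 5)) ((!) vs)
      + 3 *\<^sub>R alt_sum 6 (\<lambda>u. K p [D (u 5) (u 0) (u 1) (u 2), u 3, u 4]) ((!) vs)"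
    by (rule alt_sum_connection_terms[where q = "\<lambda>x y z. K p [x, y, z]" and r = "\<lambda>v x y z. R v [x, y, z]" and \<Gamma> = \<Gamma>])
      (rule K_linear K_swap \<Gamma>(3) | simp add: D_def)+
  finally show ?thesis .
qed

lemma torsion_identity:
  assumes "\<And>vs. length vs = 6 \<Longrightarrow> fn_bracket A 3 3 K K p vs = 0"
  shows "alt_sum 6 (\<lambda>u. T (K p [u 0, u 1, u 2]) (u 3) (u 4) (u 5) w) u
    = 3 * alt_sum 6 (\<lambda>u. T (u 5) (u 0) (u 1) (u 2) (K p [u 3, u 4, w])) u"
proof -
  \<comment> \<open>The bracket takes lists, whereas \<open>u\<close> is an arbitrary sequence; only
    its first six values matter.\<close>
  define vs where "vs = [u 0, u 1, u 2, u 3, u 4, u 5]"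
  let ?D = "\<lambda>u. D (K p [u 0, u 1, u 2]) (u 3) (u 4) (u 5)" and ?K = "\<lambda>u. K p [D (u 5) (u 0) (u 1) (u 2), u 3, u 4]"
  have vs: "vs ! i = u i" if "i < 6" for i
  proof -
    have "i \<in> {0, 1, 2, 3, 4, 5}"
      using that by auto
    then show ?thesis
      by (auto simp: vs_def)
  qed
  have "alt_sum 6 ?D u = alt_sum 6 ?D ((!) vs)" "alt_sum 6 ?K u = alt_sum 6 ?K ((!) vs)"
    by (rule alt_sum_cong; simp add: vs)+
  then have "alt_sum 6 ?D u + 3 *\<^sub>R alt_sum 6 ?K u = 0"
    using assms[of vs] by (simp add: fn_bracket_eq vs_def)
  then have "g p (alt_sum 6 ?D u + 3 *\<^sub>R alt_sum 6 ?K u) w = 0"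
    by (simp add: bilinear_lzero[OF g_bilinear])
  moreover have "linear (\<lambda>x. g p x w)"
    using g_bilinear by (auto simp: bilinear_def)
  then have "g p (alt_sum 6 ?D u) w = alt_sum 6 (\<lambda>u. g p (?D u) w) u" "g p (alt_sum 6 ?K u) w = alt_sum 6 (\<lambda>u. g p (?K u) w) u"
    by (rule alt_sum_linear)+
  \<comment> \<open>Inserting \<open>x\<close> is skew-adjoint to inserting \<open>w\<close>. This
    frees \<open>D\<close> from the inner slot of the cross product, so that \<open>g_D\<close>
    applies, and it produces the sign that places the two sums on opposite sides.\<close>
  moreover have "g p (K p [x, a, b]) w = - g p x (K p [a, b, w])" for x a b
    using g_K'[of x a b w] g_K[of a b w x] metric(2)[OF p, of x "K p [a, b, w]"] by simp
  then have "g p (?K u) w = - T (u 5) (u 0) (u 1) (u 2) (K p [u 3, u 4, w])" for u :: "nat \<Rightarrow> real^8"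
    by (simp add: g_D)
  ultimately show ?thesis
    by (simp add: bilinear_ladd[OF g_bilinear] bilinear_lmul[OF g_bilinear] g_D alt_sum_minus)
qed

lemma torsion_free_iff:
  "(\<forall>v ws. length ws = 4 \<longrightarrow> nabla_form A nabla \<Phi> p v ws = 0) \<longleftrightarrow>
   (\<forall>vs. length vs = 6 \<longrightarrow> fn_bracket A 3 3 K K p vs = 0)"
proof
  assume "\<forall>v ws. length ws = 4 \<longrightarrow> nabla_form A nabla \<Phi> p v ws = 0"
  then have "T v x y z w = 0" for v x y z w
    by (simp add: T_def)
  then have "D v x y z = 0" for v x y z
    by (intro g_nondegenerate) (simp add: g_D bilinear_lzero[OF g_bilinear])
  then show "\<forall>vs. length vs = 6 \<longrightarrow> fn_bracket A 3 3 K K p vs = 0"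
    by (simp add: fn_bracket_eq alt_sum_def linear_0[OF K_linear])
next
  assume 0: "\<forall>vs. length vs = 6 \<longrightarrow> fn_bracket A 3 3 K K p vs = 0"
  obtain e where e: "spin7_frame \<Phi> p e" and ortho: "\<And>\<mu> \<nu>. g p (e \<mu>) (e \<nu>) = (if \<mu> = \<nu> then 1 else 0)"
    using frame[OF p] by blast
  have "pos_basis e"
    using e by (simp add: spin7_frame_def)
  \<comment> \<open>Indexing by natural numbers gives the order comparisons on which the sorting
    rules rest; on the type \<open>8\<close> arithmetic is modulo 8.\<close>
  define E where "E i = [e 0, e 1, e 2, e 3, e 4, e 5, e 6, e 7] ! i" for i
  have g_E: "g p (E i) (E j) = (if i = j then 1 else 0)" if "i < 8" "j < 8" for i j
  proof -
    have "i \<in> {0, 1, 2, 3, 4, 5, 6, 7}" "j \<in> {0, 1, 2, 3, 4, 5, 6, 7}"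
      using that by auto
    then show ?thesis
      by (elim insertE emptyE) (simp_all add: E_def ortho)
  qed
  have E_span: "x = (\<Sum>i<8. g p x (E i) *\<^sub>R E i)" for x
  proof -
    have "x = (\<Sum>\<mu>\<in>UNIV. g p x (e \<mu>) *\<^sub>R e \<mu>)"
      by (simp add: orthonormal_basis_expansion(1)[OF \<open>pos_basis e\<close> g_bilinear ortho] dual_basis_expansion[OF \<open>pos_basis e\<close>])
    then show ?thesis
      by (simp add: sum_8 E_def eval_nat_numeral)
  qed
  interpret spin7_torsion "g p" "\<lambda>x y z w. \<Phi> p [x, y, z, w]" "\<lambda>x y z. K p [x, y, z]" T E
    by (rule spin7_torsion.intro)
      (rule g_bilinear metric[OF p] \<Phi>_linear(1) \<Phi>_swap form_le[OF p] g_K' T_linear_fst T_linear T_swap g_E E_span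
        | (erule (1) T_calibrated) | assumption | simp add: E_def spin7_frame_values[OF e])+
  have T_0: "T v x y z w = 0" for v x y z w
    using 0 by (intro T_eq_0 torsion_identity) simp
  show "\<forall>v ws. length ws = 4 \<longrightarrow> nabla_form A nabla \<Phi> p v ws = 0"
  proof (intro allI impI)
    fix v and ws :: "(real^8) list"
    assume "length ws = 4"
    then obtain x y z w where "ws = [x, y, z, w]"
      by (auto simp: length_Suc_conv numeral_eq_Suc)
    then show "nabla_form A nabla \<Phi> p v ws = 0"
      using T_0[of v x y z w] by (simp add: T_def)
  qed
qed

end

theorem theorem1p2:
  fixes X :: "'a topology"
    and A :: "('a, 8) chart set"
    and \<Phi> :: "('a, 8) form"
    and g :: "('a, 8) metric"
    and nabla :: "('a, 8) connection"
    and p :: 'a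
  assumes "oriented_manifold X A"
    and "spin7_structure X A \<Phi>"
    and "spin7_metric X A \<Phi> g"
    and "levi_civita X A g nabla"
    and "p \<in> topspace X"
  shows "(\<forall>v ws. length ws = 4 \<longrightarrow> nabla_form A nabla \<Phi> p v ws = 0) \<longleftrightarrow>
         (\<forall>vs. length vs = 6 \<longrightarrow>
            fn_bracket A 3 3 (cross_product g \<Phi>) (cross_product g \<Phi>) p vs = 0)"
proof -
  interpret spin7_point X A \<Phi> g nabla p
    using assms by (simp add: spin7_point_def atlas_def spin7_point_axioms_def)
  show ?thesis
    by (rule torsion_free_iff)
qed

end
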